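(* (1) Let $G$ be a code loop with trivial radical, and suppose that, for some $S\le G$, either $(G,S,\alpha,h)$ satisfies condition (C) for some $\alpha,h$, or $(G,S,\beta,\gamma,h)$ satisfies condition (D) for some $\beta,\gamma,h$. Then $G/S$ is isomorphic to the cyclic group $C_2$ or to the Klein four-group $V_4$. The resulting loop $(G,* )$ is a code loop with trivial radical, and the associators of $G$ and $(G,* )$ are equivalent. (2) Every Moufang loop whose associator is equivalent to the associator of a code loop with trivial radical is itself a code loop with trivial radical. (3) Any two code loops $G$, $G'$ with equivalent associators can be connected by the cyclic and dihedral constructions, possibly repeated: there are $s\ge 0$ and loops $H_0\simeq G,H_1,\dots,H_s\simeq G'$ such that, for $0\le i<s$, $H_{i+1}$ is obtained from $H_i$ by the cyclic or the dihedral construction.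
   Context: A Moufang loop is a loop satisfying $((xy)x)z=x(y(xz))$. In a loop, the associator $[x,y,z]$ is the unique $w$ with $(xy)z=(x(yz))w$ and the commutator $[x,y]$ is the unique $w$ with $xy=(yx)w$. For a Moufang loop $G$: $N(G)=\{x:[x,y,z]=1\ \forall y,z\}$ (nucleus), $Z(G)=\{x:[x,y]=[x,y,z]=1\ \forall y,z\}$ (center). Two loops $G,L$ have equivalent associators if there is a bijection $f:G\to L$ with $f([x,y,z])=[f(x),f(y),f(z)]$ for all $x,y,z\in G$. The constructions. Let $m\ge 1$, $M=\{-m+1,\dots,m\}$, and $\sigma:\mathbb Z\to\{-1,0,1\}$ with $\sigma(i)=1$ if $i>m$, $0$ if $i\in M$, $-1$ if $i<1-m$. Condition (C) for $(G,S,\alpha,h)$: $G$ is a Moufang loop; $S\unlhd G$ and $G/S=\langle\alpha\rangle$ is cyclic of order $2m$; $1\ne h\in S\cap Z(G)$. The cyclic construction produces $(G,* )$ with $x*y=xy\,h^{\sigma(i+j)}$ for $x\in\alpha^i$, $y\in\alpha^j$, $i,j\in M$. Condition (D) for $(G,S,\beta,\gamma,h)$: $G$ is a Moufang loop; $S\unlhd G$ and $G/S$ is dihedral of order $4m$ (for $m=1$ this means $V_4$); $\beta,\gamma$ are involutions of $G/S$ such that $\alpha=\beta\gamma$ has order $2m$; with $G_0=\bigcup_{i\in M}\alpha^i$, $G_1=G\setminus G_0$, one has $1\neq h\in S\cap Z(G_0)\cap N(G)$ and $hxh=x$ for some (equivalently every) $x\in G_1$. Choosing $e\in\beta$, $f\in\gamma$,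 the dihedral construction produces $(G,* )$ with $x*y=xy\,h^{(-1)^r\sigma(i+j)}$ for $x\in\alpha^i\cup e\alpha^i$, $y\in(\alpha^j\cup\alpha^jf)\cap G_r$, $i,j\in M$, $r\in\{0,1\}$ (independent of $e,f$). Code loops. A finite loop $G$ is symplectic if it has a central subloop $Z$ of order $2$ with $G/Z$ an elementary abelian $2$-group. Identify $Z$ with $F=GF(2)$ and $G/Z$ with a finite vector space $V$ over $F$. The power map $P:V\to F$, commutator map $C:V^2\to F$ and associator map $A:V^3\to F$ are given by $P(aZ)=a^2$, $C(aZ,bZ)=[a,b]$, $A(aZ,bZ,cZ)=[a,b,c]$. For $f:V\to F$ with $f(0)=0$ the $n$th derived form is $f_n(v_1,\dots,v_n)=\sum f(v_{i_1}+\dots+v_{i_k})$, summed over all nonempty subsets $\{i_1,\dots,i_k\}\subseteq\{1,\dots,n\}$; the combinatorial degree $\operatorname{cdeg}f$ is the least $n\ge 0$ with $f_{n+1}=0$. A symplectic loop is a code loop if $\operatorname{cdeg}P\le 3$, $C=P_2$ and $A=P_3$. The code loop has trivial radical if $\operatorname{Rad}P_3=\{v\in V: P_3(v,v_2,v_3)=0\ \forall v_2,v_3\in V\}$ is zero, i.e. if its nucleus has exactly two elements. *)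

theory Defs
  imports "HOL-Algebra.Algebra" "HOL-Library.Z2"
begin

section \<open>Loops\<close>

locale loop =
  fixes G :: "('a, 'b) monoid_scheme" (structure)
  assumes m_closed: "\<lbrakk>x \<in> carrier G; y \<in> carrier G\<rbrakk> \<Longrightarrow> x \<otimes> y \<in> carrier G"
    and one_closed: "\<one> \<in> carrier G"
    and l_one: "x \<in> carrier G \<Longrightarrow> \<one> \<otimes> x = x"
    and r_one: "x \<in> carrier G \<Longrightarrow> x \<otimes> \<one> = x"
    and l_div: "\<lbrakk>a \<in> carrier G; b \<in> carrier G\<rbrakk> \<Longrightarrow> \<exists>!x. x \<in> carrier G \<and> a \<otimes> x = b"
    and r_div: "\<lbrakk>a \<in> carrier G; b \<in> carrier G\<rbrakk> \<Longrightarrow> \<exists>!y. y \<in> carrier G \<and> y \<otimes> a = b"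

locale moufang_loop = loop +
  assumes moufang: "\<lbrakk>x \<in> carrier G; y \<in> carrier G; z \<in> carrier G\<rbrakk>
    \<Longrightarrow> ((x \<otimes> y) \<otimes> x) \<otimes> z = x \<otimes> (y \<otimes> (x \<otimes> z))"

definition associator :: "('a, 'b) monoid_scheme \<Rightarrow> 'a \<Rightarrow> 'a \<Rightarrow> 'a \<Rightarrow> 'a" where
  "associator G x y z = (THE w. w \<in> carrier G \<and>
     (x \<otimes>\<^bsub>G\<^esub> y) \<otimes>\<^bsub>G\<^esub> z = (x \<otimes>\<^bsub>G\<^esub> (y \<otimes>\<^bsub>G\<^esub> z)) \<otimes>\<^bsub>G\<^esub> w)"

definition commutator :: "('a, 'b) monoid_scheme \<Rightarrow> 'a \<Rightarrow> 'a \<Rightarrow> 'a" where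
  "commutator G x y = (THE w. w \<in> carrier G \<and> x \<otimes>\<^bsub>G\<^esub> y = (y \<otimes>\<^bsub>G\<^esub> x) \<otimes>\<^bsub>G\<^esub> w)"

text \<open>
  The next two definitions are meant for Moufang loops only, where associating in one
  position implies associating in every position.
\<close>

definition nucleus :: "('a, 'b) monoid_scheme \<Rightarrow> 'a set" where
  "nucleus G = {x \<in> carrier G. \<forall>y\<in>carrier G. \<forall>z\<in>carrier G. associator G x y z = \<one>\<^bsub>G\<^esub>}"

definition moufang_center :: "('a, 'b) monoid_scheme \<Rightarrow> 'a set" where
  "moufang_center G = {x \<in> carrier G. \<forall>y\<in>carrier G. \<forall>z\<in>carrier G.
     commutator G x y = \<one>\<^bsub>G\<^esub> \<and> associator G x y z = \<one>\<^bsub>G\<^esub>}"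

definition subloop :: "'a set \<Rightarrow> ('a, 'b) monoid_scheme \<Rightarrow> bool" where
  "subloop S G \<longleftrightarrow> S \<subseteq> carrier G \<and> loop (G\<lparr>carrier := S\<rparr>)"

definition normal_subloop :: "'a set \<Rightarrow> ('a, 'b) monoid_scheme \<Rightarrow> bool" where
  "normal_subloop S G \<longleftrightarrow> subloop S G \<and>
     (\<forall>x\<in>carrier G. x <#\<^bsub>G\<^esub> S = S #>\<^bsub>G\<^esub> x) \<and>
     (\<forall>x\<in>carrier G. \<forall>y\<in>carrier G. (S #>\<^bsub>G\<^esub> x) #>\<^bsub>G\<^esub> y = S #>\<^bsub>G\<^esub> (x \<otimes>\<^bsub>G\<^esub> y)) \<and>
     (\<forall>x\<in>carrier G. \<forall>y\<in>carrier G. x <#\<^bsub>G\<^esub> (y <#\<^bsub>G\<^esub> S) = (x \<otimes>\<^bsub>G\<^esub> y) <#\<^bsub>G\<^esub> S)"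

text \<open>
  Centrality in an arbitrary loop, where all three positions in the associator matter.
\<close>

definition central_subloop :: "'a set \<Rightarrow> ('a, 'b) monoid_scheme \<Rightarrow> bool" where
  "central_subloop Z G \<longleftrightarrow> subloop Z G \<and>
     (\<forall>c\<in>Z. \<forall>x\<in>carrier G. \<forall>y\<in>carrier G. commutator G c x = \<one>\<^bsub>G\<^esub> \<and>
        associator G c x y = \<one>\<^bsub>G\<^esub> \<and> associator G x c y = \<one>\<^bsub>G\<^esub> \<and> associator G x y c = \<one>\<^bsub>G\<^esub>)"

definition equivalent_associators ::
    "('a, 'c) monoid_scheme \<Rightarrow> ('b, 'd) monoid_scheme \<Rightarrow> bool" where
  "equivalent_associators G L \<longleftrightarrow> (\<exists>f. bij_betw f (carrier G) (carrier L) \<and>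
     (\<forall>x\<in>carrier G. \<forall>y\<in>carrier G. \<forall>z\<in>carrier G.
        f (associator G x y z) = associator L (f x) (f y) (f z)))"


section \<open>The cyclic and dihedral constructions\<close>

text \<open>
  For a normal subloop \<open>S\<close> the quotient loop \<open>G/S\<close> is \<open>G Mod S\<close> (set product on cosets).
\<close>

definition index_range :: "nat \<Rightarrow> int set" where
  "index_range m = {- int m + 1..int m}"

definition sigma :: "nat \<Rightarrow> int \<Rightarrow> int" where
  "sigma m i = (if i > int m then 1 else if i < 1 - int m then -1 else 0)"

definition index_of :: "nat \<Rightarrow> (int \<Rightarrow> 'a set) \<Rightarrow> 'a \<Rightarrow> int" where
  "index_of m B x = (THE i. i \<in> index_range m \<and> x \<in> B i)"

definition condition_C ::
    "nat \<Rightarrow> ('a, 'b) monoid_scheme \<Rightarrow> 'a set \<Rightarrow> 'a set \<Rightarrow> 'a \<Rightarrow> bool" where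
  "condition_C m G S \<alpha> h \<longleftrightarrow> m \<ge> 1 \<and> moufang_loop G \<and> normal_subloop S G \<and>
     group (G Mod S) \<and> \<alpha> \<in> carrier (G Mod S) \<and>
     carrier (G Mod S) = generate (G Mod S) {\<alpha>} \<and> order (G Mod S) = 2 * m \<and>
     h \<noteq> \<one>\<^bsub>G\<^esub> \<and> h \<in> S \<inter> moufang_center G"

definition cyclic_construction ::
    "nat \<Rightarrow> ('a, 'b) monoid_scheme \<Rightarrow> 'a set \<Rightarrow> 'a set \<Rightarrow> 'a \<Rightarrow> ('a, 'b) monoid_scheme" where
  "cyclic_construction m G S \<alpha> h = G\<lparr>mult := \<lambda>x y.
     (let idx = index_of m (\<lambda>i. \<alpha> [^]\<^bsub>G Mod S\<^esub> i)
      in (x \<otimes>\<^bsub>G\<^esub> y) \<otimes>\<^bsub>G\<^esub> (h [^]\<^bsub>G\<^esub> sigma m (idx x + idx y)))\<rparr>"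

definition dihedral_of_order :: "('a, 'b) monoid_scheme \<Rightarrow> nat \<Rightarrow> bool" where
  "dihedral_of_order K k \<longleftrightarrow> group K \<and> order K = k \<and>
     (\<exists>r\<in>carrier K. \<exists>s\<in>carrier K. 2 * group.ord K r = k \<and> group.ord K s = 2 \<and>
        s \<otimes>\<^bsub>K\<^esub> r \<otimes>\<^bsub>K\<^esub> s = inv\<^bsub>K\<^esub> r \<and> carrier K = generate K {r, s})"

definition involution :: "('a, 'b) monoid_scheme \<Rightarrow> 'a \<Rightarrow> bool" where
  "involution K x \<longleftrightarrow> x \<in> carrier K \<and> x \<noteq> \<one>\<^bsub>K\<^esub> \<and> x \<otimes>\<^bsub>K\<^esub> x = \<one>\<^bsub>K\<^esub>"

definition G0_part :: "nat \<Rightarrow> ('a, 'b) monoid_scheme \<Rightarrow> 'a set \<Rightarrow> 'a set \<Rightarrow> 'a set" where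
  "G0_part m G S \<alpha> = (\<Union>i\<in>index_range m. \<alpha> [^]\<^bsub>G Mod S\<^esub> i)"

definition condition_D ::
    "nat \<Rightarrow> ('a, 'b) monoid_scheme \<Rightarrow> 'a set \<Rightarrow> 'a set \<Rightarrow> 'a set \<Rightarrow> 'a \<Rightarrow> bool" where
  "condition_D m G S \<beta> \<gamma> h \<longleftrightarrow> m \<ge> 1 \<and> moufang_loop G \<and> normal_subloop S G \<and>
     dihedral_of_order (G Mod S) (4 * m) \<and>
     involution (G Mod S) \<beta> \<and> involution (G Mod S) \<gamma> \<and>
     (let \<alpha> = \<beta> \<otimes>\<^bsub>G Mod S\<^esub> \<gamma>; G0 = G0_part m G S \<alpha>; G1 = carrier G - G0
      in group.ord (G Mod S) \<alpha> = 2 * m \<and>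
         h \<noteq> \<one>\<^bsub>G\<^esub> \<and> h \<in> S \<inter> moufang_center (G\<lparr>carrier := G0\<rparr>) \<inter> nucleus G \<and>
         (\<exists>x\<in>G1. (h \<otimes>\<^bsub>G\<^esub> x) \<otimes>\<^bsub>G\<^esub> h = x))"

text \<open>Here \<open>e\<close> and \<open>f\<close> are the chosen representatives of the cosets \<open>\<beta>\<close> and \<open>\<gamma>\<close>.\<close>

definition dihedral_construction ::
    "nat \<Rightarrow> ('a, 'b) monoid_scheme \<Rightarrow> 'a set \<Rightarrow> 'a set \<Rightarrow> 'a set \<Rightarrow> 'a \<Rightarrow> 'a \<Rightarrow> 'a
      \<Rightarrow> ('a, 'b) monoid_scheme" where
  "dihedral_construction m G S \<beta> \<gamma> e f h = G\<lparr>mult := \<lambda>x y.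
     (let \<alpha> = \<beta> \<otimes>\<^bsub>G Mod S\<^esub> \<gamma>;
          i = index_of m (\<lambda>i. (\<alpha> [^]\<^bsub>G Mod S\<^esub> i) \<union> (e <#\<^bsub>G\<^esub> (\<alpha> [^]\<^bsub>G Mod S\<^esub> i))) x;
          j = index_of m (\<lambda>j. (\<alpha> [^]\<^bsub>G Mod S\<^esub> j) \<union> ((\<alpha> [^]\<^bsub>G Mod S\<^esub> j) #>\<^bsub>G\<^esub> f)) y;
          r = (if y \<in> G0_part m G S \<alpha> then 0 else 1 :: nat)
      in (x \<otimes>\<^bsub>G\<^esub> y) \<otimes>\<^bsub>G\<^esub> (h [^]\<^bsub>G\<^esub> ((- 1) ^ r * sigma m (i + j))))\<rparr>"

definition obtained_by_cyclic ::
    "('a, 'b) monoid_scheme \<Rightarrow> ('a, 'b) monoid_scheme \<Rightarrow> bool" where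
  "obtained_by_cyclic G H \<longleftrightarrow>
     (\<exists>m S \<alpha> h. condition_C m G S \<alpha> h \<and> H = cyclic_construction m G S \<alpha> h)"

definition obtained_by_dihedral ::
    "('a, 'b) monoid_scheme \<Rightarrow> ('a, 'b) monoid_scheme \<Rightarrow> bool" where
  "obtained_by_dihedral G H \<longleftrightarrow>
     (\<exists>m S \<beta> \<gamma> h. condition_D m G S \<beta> \<gamma> h \<and>
        (\<exists>e\<in>\<beta>. \<exists>f\<in>\<gamma>. H = dihedral_construction m G S \<beta> \<gamma> e f h))"


section \<open>Code loops\<close>

definition elementary_abelian_2_group :: "('a, 'b) monoid_scheme \<Rightarrow> bool" where
  "elementary_abelian_2_group K \<longleftrightarrow>
     comm_group K \<and> (\<forall>x\<in>carrier K. x \<otimes>\<^bsub>K\<^esub> x = \<one>\<^bsub>K\<^esub>)"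

definition symplectic_loop :: "('a, 'b) monoid_scheme \<Rightarrow> 'a set \<Rightarrow> bool" where
  "symplectic_loop G Z \<longleftrightarrow> loop G \<and> finite (carrier G) \<and> central_subloop Z G \<and> card Z = 2 \<and>
     elementary_abelian_2_group (G Mod Z)"

text \<open>
  The identification of the two-element subloop \<open>Z\<close> with \<open>GF(2)\<close>, and the maps \<open>P\<close>, \<open>C\<close>, \<open>A\<close>.
  Vectors are elements of \<open>G Mod Z\<close>, so vector addition is written multiplicatively.
  Since \<open>Z\<close> is central, the values below do not depend on the coset representatives.
\<close>

definition to_GF2 :: "('a, 'b) monoid_scheme \<Rightarrow> 'a \<Rightarrow> bit" where
  "to_GF2 G c = (if c = \<one>\<^bsub>G\<^esub> then 0 else 1)"

definition power_map :: "('a, 'b) monoid_scheme \<Rightarrow> 'a set \<Rightarrow> bit" where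
  "power_map G u = to_GF2 G (THE c. \<exists>a\<in>u. c = a \<otimes>\<^bsub>G\<^esub> a)"

definition commutator_map :: "('a, 'b) monoid_scheme \<Rightarrow> 'a set \<Rightarrow> 'a set \<Rightarrow> bit" where
  "commutator_map G u v = to_GF2 G (THE c. \<exists>a\<in>u. \<exists>b\<in>v. c = commutator G a b)"

definition associator_map :: "('a, 'b) monoid_scheme \<Rightarrow> 'a set \<Rightarrow> 'a set \<Rightarrow> 'a set \<Rightarrow> bit" where
  "associator_map G u v w =
     to_GF2 G (THE c. \<exists>a\<in>u. \<exists>b\<in>v. \<exists>d\<in>w. c = associator G a b d)"

text \<open>
  The \<open>n\<close>th derived form of \<open>f\<close> is evaluated at the list \<open>[v\<^sub>1, \<dots>, v\<^sub>n]\<close>.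
\<close>

definition derived_form :: "('v, 'b) monoid_scheme \<Rightarrow> ('v \<Rightarrow> bit) \<Rightarrow> 'v list \<Rightarrow> bit" where
  "derived_form V f vs =
     (\<Sum>I\<in>{I. I \<subseteq> {..<length vs} \<and> I \<noteq> {}}. f (finprod V (\<lambda>i. vs ! i) I))"

text \<open>On a finite space \<open>V\<close> with \<open>f 0 = 0\<close> an \<open>n\<close> as required always exists.\<close>

definition cdeg :: "('v, 'b) monoid_scheme \<Rightarrow> ('v \<Rightarrow> bit) \<Rightarrow> nat" where
  "cdeg V f = (LEAST n. \<forall>vs. length vs = n + 1 \<and> set vs \<subseteq> carrier V \<longrightarrow> derived_form V f vs = 0)"

definition radical3 :: "('v, 'b) monoid_scheme \<Rightarrow> ('v \<Rightarrow> bit) \<Rightarrow> 'v set" where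
  "radical3 V f = {v \<in> carrier V. \<forall>v2\<in>carrier V. \<forall>v3\<in>carrier V. derived_form V f [v, v2, v3] = 0}"

definition code_loop_over :: "('a, 'b) monoid_scheme \<Rightarrow> 'a set \<Rightarrow> bool" where
  "code_loop_over G Z \<longleftrightarrow> symplectic_loop G Z \<and>
     (let V = G Mod Z; P = power_map G
      in cdeg V P \<le> 3 \<and>
         (\<forall>u\<in>carrier V. \<forall>v\<in>carrier V. commutator_map G u v = derived_form V P [u, v]) \<and>
         (\<forall>u\<in>carrier V. \<forall>v\<in>carrier V. \<forall>w\<in>carrier V.
            associator_map G u v w = derived_form V P [u, v, w]))"

definition code_loop :: "('a, 'b) monoid_scheme \<Rightarrow> bool" where
  "code_loop G \<longleftrightarrow> (\<exists>Z. code_loop_over G Z)"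

definition code_loop_trivial_radical :: "('a, 'b) monoid_scheme \<Rightarrow> bool" where
  "code_loop_trivial_radical G \<longleftrightarrow>
     (\<exists>Z. code_loop_over G Z \<and> radical3 (G Mod Z) (power_map G) = {\<one>\<^bsub>G Mod Z\<^esub>})"

abbreviation C2 :: "int monoid" where
  "C2 \<equiv> integer_mod_group 2"

abbreviation V4 :: "(int \<times> int) monoid" where
  "V4 \<equiv> C2 \<times>\<times> C2"

end

theory Submission
  imports Defs
begin

text \<open>
  Writing \<open>P\<close> for the squaring map, a code loop over \<open>{1, z}\<close> is a loop with central involution \<open>z\<close>
  whose commutators and associators are the derived forms \<open>P\<^sub>2\<close> and \<open>P\<^sub>3\<close>. The 3-cocycle identity
  makes any symmetric associator with values in \<open>{1, z}\<close> trilinear.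

  With trivial radical, \<open>h = z\<close> and \<open>G/S\<close> has exponent 2, so \<open>m = 1\<close> and both
  constructions replace \<open>xy\<close> by \<open>xy z\<^bsup>l(x) m(y)\<^esup>\<close> for linear functionals \<open>l\<close>, \<open>m\<close>; this adds
  the quadratic form \<open>l m\<close> to \<open>P\<close> and preserves associators. If a Moufang loop \<open>L\<close> has an
  equivalent associator, then this associator is symmetric, hence trilinear, and squares and
  commutators of \<open>L\<close> lie in its nucleus, which has order 2 and is therefore central.

  An equivalence of associators is multiplicative modulo the nuclei and can be corrected to a linear
  isomorphism preserving \<open>P\<^sub>3\<close>. The difference of the two squaring maps is then a quadratic
  form, that is, a sum of products of linear functionals, each realized by one construction. A code
  loop is determined up to isomorphism by its squaring map.
\<close>

section \<open>Loops with a central involution\<close>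

text \<open>Code loops are not associative, so nothing can be calculated as in a group. The remedy
  is to carry an exponent: \<open>shift x b\<close> is \<open>x z^b\<close> with \<open>b\<close> in
  GF(2), and every reordering or rebracketing of a product becomes an equation between bits.

  Linear algebra enters through one abstract structure, a finite set that is an elementary abelian
  2-group modulo a congruence. It is instantiated three times: for a code loop modulo its central
  subloop, for pairs of elements modulo both central subloops, and for a set of pairs modulo the
  diagonal of the two. Its main tool is a subgroup of index two that contains a given subgroup and
  avoids a given element; this yields linear functionals in the first case and an isomorphism of
  code loops in the last.

  The code loops in (3) may have large nuclei, and associators do not distinguish the elements of a
  coset of the nucleus. Hence the linear isomorphism cannot be read off from the given bijection; it
  is built as a relation between the two loops.

  Sums of products of functionals include single functionals, since \<open>l = l l\<close> for bits:
  squares \<open>l l\<close> belong to the cyclic construction and products of independent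
  functionals to the dihedral one.\<close>

lemma bit_add_self: "b + b = (0::bit)" "b + (b + c) = (c::bit)"
  by (cases b; cases c; simp)+

lemma bit_mult_self: "b * b = (b::bit)" "b * (b * c) = (b * c :: bit)"
  by (cases b; cases c; simp)+

lemma bit_eq_iff_add: "b = c \<longleftrightarrow> b + c = (0::bit)"
  by (cases b; cases c; simp)

\<comment> \<open>By default the simplifier turns sums and products of bits into bit operations.\<close>
declare add_bit_eq_xor [simp del] mult_bit_eq_and [simp del]
declare bit_add_self [simp] bit_mult_self [simp]

context loop
begin

lemmas loop_simps = m_closed one_closed l_one r_one

lemma l_cancel: "\<lbrakk>a \<in> carrier G; x \<in> carrier G; y \<in> carrier G\<rbrakk> \<Longrightarrow> a \<otimes> x = a \<otimes> y \<longleftrightarrow> x = y"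
  by (metis l_div m_closed)

lemma associator_eqI:
  assumes "x \<in> carrier G" "y \<in> carrier G" "w \<in> carrier G" "c \<in> carrier G"
    and "(x \<otimes> y) \<otimes> w = (x \<otimes> (y \<otimes> w)) \<otimes> c"
  shows "associator G x y w = c"
  unfolding associator_def using assms by (intro the_equality) (auto simp: l_cancel m_closed)

lemma commutator_eqI:
  assumes "x \<in> carrier G" "y \<in> carrier G" "c \<in> carrier G" and "x \<otimes> y = (y \<otimes> x) \<otimes> c"
  shows "commutator G x y = c"
  unfolding commutator_def using assms by (intro the_equality) (auto simp: l_cancel m_closed)

lemma associator:
  assumes "x \<in> carrier G" "y \<in> carrier G" "w \<in> carrier G"
  shows "associator G x y w \<in> carrier G"
    and "(x \<otimes> y) \<otimes> w = (x \<otimes> (y \<otimes> w)) \<otimes> associator G x y w"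
proof -
  obtain c where "c \<in> carrier G" "(x \<otimes> (y \<otimes> w)) \<otimes> c = (x \<otimes> y) \<otimes> w"
    using l_div[of "x \<otimes> (y \<otimes> w)" "(x \<otimes> y) \<otimes> w"] assms m_closed by blast
  with associator_eqI[OF assms, of c]
  show "associator G x y w \<in> carrier G"
    "(x \<otimes> y) \<otimes> w = (x \<otimes> (y \<otimes> w)) \<otimes> associator G x y w" by simp_all
qed

lemma commutator:
  assumes "x \<in> carrier G" "y \<in> carrier G"
  shows "commutator G x y \<in> carrier G" and "x \<otimes> y = (y \<otimes> x) \<otimes> commutator G x y"
proof -
  obtain c where "c \<in> carrier G" "(y \<otimes> x) \<otimes> c = x \<otimes> y"
    using l_div[of "y \<otimes> x" "x \<otimes> y"] assms m_closed by blast
  with commutator_eqI[OF assms, of c]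
  show "commutator G x y \<in> carrier G" "x \<otimes> y = (y \<otimes> x) \<otimes> commutator G x y" by simp_all
qed

end

text \<open>These rules carry \<open>z\<close> from any place in a product to its right end, the
  form in which centrality is used for rewriting.\<close>

locale central_involution = loop G for G :: "('a, 'b) monoid_scheme" (structure) +
  fixes z :: 'a
  assumes z_closed: "z \<in> carrier G" and z_neq_one: "z \<noteq> \<one>" and z_z: "z \<otimes> z = \<one>"
    and z_comm: "x \<in> carrier G \<Longrightarrow> z \<otimes> x = x \<otimes> z"
    and z_mid: "\<lbrakk>x \<in> carrier G; y \<in> carrier G\<rbrakk> \<Longrightarrow> (x \<otimes> z) \<otimes> y = (x \<otimes> y) \<otimes> z"
    and z_right: "\<lbrakk>x \<in> carrier G; y \<in> carrier G\<rbrakk> \<Longrightarrow> x \<otimes> (y \<otimes> z) = (x \<otimes> y) \<otimes> z"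
begin

text \<open>The element \<open>x z^b\<close>. Since \<open>z\<close> has order two the exponent
  lives in GF(2), and by \<open>shift_shift\<close> exponents add.\<close>

definition shift :: "'a \<Rightarrow> bit \<Rightarrow> 'a" where
  "shift x b = (if b = 0 then x else x \<otimes> z)"

lemma shift_closed: "x \<in> carrier G \<Longrightarrow> shift x b \<in> carrier G"
  by (simp add: shift_def m_closed z_closed)

lemma shift_mult_left: "\<lbrakk>x \<in> carrier G; y \<in> carrier G\<rbrakk> \<Longrightarrow> shift x b \<otimes> y = shift (x \<otimes> y) b"
  by (simp add: shift_def z_mid)

lemma shift_mult_right: "\<lbrakk>x \<in> carrier G; y \<in> carrier G\<rbrakk> \<Longrightarrow> x \<otimes> shift y b = shift (x \<otimes> y) b"
  by (simp add: shift_def z_right)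

lemma shift_shift: "x \<in> carrier G \<Longrightarrow> shift (shift x b) c = shift x (b + c)"
  by (cases b; cases c; simp add: shift_def z_right[symmetric] z_closed z_z r_one)

lemma shift_0: "shift x 0 = x"
  by (simp add: shift_def)

lemma z_shift: "shift \<one> 1 = z" "shift z 1 = \<one>" "x \<otimes> z = shift x 1"
  by (simp_all add: shift_def l_one z_closed z_z)

lemma z_mult: "x \<in> carrier G \<Longrightarrow> z \<otimes> x = shift x 1"
  by (simp add: z_comm z_shift)

lemmas shift_simps = loop_simps z_closed shift_closed shift_mult_left shift_mult_right shift_shift
  shift_0 z_shift(1,2) z_mult

lemma shift_inject: "x \<in> carrier G \<Longrightarrow> shift x b = shift x c \<longleftrightarrow> b = c"
proof -
  assume x: "x \<in> carrier G"
  have "x \<otimes> z \<noteq> x"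
    using l_cancel[OF x z_closed one_closed] x by (simp add: r_one z_neq_one)
  then show ?thesis by (cases b; cases c; auto simp: shift_def)
qed

lemma shift_eq_one_iff: "shift \<one> b = \<one> \<longleftrightarrow> b = 0"
  using shift_inject[of \<one> b 0] by (simp add: shift_0 one_closed)

lemma shift_eq_swap:
  assumes "x \<in> carrier G" "y \<in> carrier G"
  shows "shift x b = y \<longleftrightarrow> x = shift y b"
  using assms by (auto simp: shift_shift shift_0)

lemma shift_eqD:
  assumes "x \<in> carrier G" "y \<in> carrier G" "shift x b = shift y c"
  shows "x = shift y (b + c)"
  using assms by (metis add.commute shift_closed shift_eq_swap shift_shift)

lemma shift_one_iff: "(\<exists>b. x = shift \<one> b) \<longleftrightarrow> x \<in> {\<one>, z}"
  by (auto simp: shift_def l_one z_closed)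

text \<open>
  Writing the associator additively, the pentagon gives the 3-cocycle identity. For symmetric
  \<open>a\<close> it says that the defect \<open>D\<close> of additivity satisfies
  \<open>D x y u w + D y u x w + D u w x y = 0\<close>; comparing with its cyclic shift shows that
  \<open>D\<close> is invariant under rotation, so the first and the last term cancel.
\<close>

lemma symmetric_associator_additive:
  fixes a :: "'a \<Rightarrow> 'a \<Rightarrow> 'a \<Rightarrow> bit"
  assumes assoc: "\<And>x y w. \<lbrakk>x \<in> carrier G; y \<in> carrier G; w \<in> carrier G\<rbrakk>
      \<Longrightarrow> (x \<otimes> y) \<otimes> w = shift (x \<otimes> (y \<otimes> w)) (a x y w)"
    and sym1: "\<And>x y w. \<lbrakk>x \<in> carrier G; y \<in> carrier G; w \<in> carrier G\<rbrakk> \<Longrightarrow> a x y w = a y x w"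
    and sym2: "\<And>x y w. \<lbrakk>x \<in> carrier G; y \<in> carrier G; w \<in> carrier G\<rbrakk> \<Longrightarrow> a x y w = a x w y"
    and "x \<in> carrier G" "y \<in> carrier G" "u \<in> carrier G" "w \<in> carrier G"
  shows "a (x \<otimes> y) u w = a x u w + a y u w"
proof -
  define D where "D x y u w = a (x \<otimes> y) u w + a x u w + a y u w" for x y u w
  have coc: "a x y u + a x (y \<otimes> u) w + a y u w + a (x \<otimes> y) u w + a x y (u \<otimes> w) = 0"
    if *: "x \<in> carrier G" "y \<in> carrier G" "u \<in> carrier G" "w \<in> carrier G" for x y u w
  proof -
    have "((x \<otimes> y) \<otimes> u) \<otimes> w = shift (x \<otimes> (y \<otimes> (u \<otimes> w))) (a x y (u \<otimes> w) + a (x \<otimes> y) u w)"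
      using * by (simp add: assoc[of "x \<otimes> y" u w] assoc[of x y "u \<otimes> w"] shift_simps)
    moreover have "((x \<otimes> y) \<otimes> u) \<otimes> w
        = shift (x \<otimes> (y \<otimes> (u \<otimes> w))) (a y u w + a x (y \<otimes> u) w + a x y u)"
      using * by (simp add: assoc[of x y u] assoc[of x "y \<otimes> u" w] assoc[of y u w] shift_simps)
    ultimately have "a x y (u \<otimes> w) + a (x \<otimes> y) u w = a y u w + a x (y \<otimes> u) w + a x y u"
      using * by (simp add: shift_inject m_closed)
    then have "a x y (u \<otimes> w) + a (x \<otimes> y) u w + (a y u w + a x (y \<otimes> u) w + a x y u) = 0"
      by (simp only: bit_add_self)
    then show ?thesis by (simp add: ac_simps)
  qed
  have cyc: "D x y u w + D y u x w + D u w x y = 0"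
    if *: "x \<in> carrier G" "y \<in> carrier G" "u \<in> carrier G" "w \<in> carrier G" for x y u w
  proof -
    have "a (y \<otimes> u) x w = a x (y \<otimes> u) w" "a (u \<otimes> w) x y = a x y (u \<otimes> w)"
      "a y x w = a x y w" "a u x w = a x u w" "a u x y = a x y u" "a w x y = a x y w"
      using * sym1 sym2 by (metis m_closed)+
    then show ?thesis
      using coc[OF *] unfolding D_def by (simp add: ac_simps)
  qed
  have swap: "D x y u w = D x y w u"
    if "x \<in> carrier G" "y \<in> carrier G" "u \<in> carrier G" "w \<in> carrier G" for x y u w
    using that unfolding D_def by (simp add: sym2[of _ u w] m_closed)
  have rot: "D x y u w = D w x y u"
    if *: "x \<in> carrier G" "y \<in> carrier G" "u \<in> carrier G" "w \<in> carrier G" for x y u w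
  proof -
    have "D x y u w + D y u x w + D u w x y + (D y u w x + D u w y x + D w x y u) = 0"
      using cyc[of x y u w] cyc[of y u w x] * by simp
    then have "D x y u w + D w x y u = 0"
      using swap[of y u w x] swap[of u w y x] * by (simp add: ac_simps)
    then show ?thesis by (rule iffD2[OF bit_eq_iff_add])
  qed
  have "D x y u w = 0"
    using cyc[of u x y w] rot[of u x y w] rot[of w u x y] assms by (simp add: ac_simps)
  then show ?thesis
    unfolding D_def by (subst bit_eq_iff_add) (simp only: add.assoc)
qed

end

section \<open>Code loops in terms of the squaring map\<close>

text \<open>This map and the two forms below are \<open>P\<close>, its second and its third derived
  form, pulled back from cosets to elements. They are defined for any structure, so that two loops
  on one carrier can be compared.\<close>

definition sq_bit :: "('a, 'b) monoid_scheme \<Rightarrow> 'a \<Rightarrow> bit" where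
  "sq_bit G x = to_GF2 G (x \<otimes>\<^bsub>G\<^esub> x)"

definition comm_form :: "('a, 'b) monoid_scheme \<Rightarrow> 'a \<Rightarrow> 'a \<Rightarrow> bit" where
  "comm_form G x y = sq_bit G x + sq_bit G y + sq_bit G (x \<otimes>\<^bsub>G\<^esub> y)"

definition assoc_form :: "('a, 'b) monoid_scheme \<Rightarrow> 'a \<Rightarrow> 'a \<Rightarrow> 'a \<Rightarrow> bit" where
  "assoc_form G x y w = sq_bit G x + sq_bit G y + sq_bit G w +
     sq_bit G (x \<otimes>\<^bsub>G\<^esub> y) + sq_bit G (x \<otimes>\<^bsub>G\<^esub> w) + sq_bit G (y \<otimes>\<^bsub>G\<^esub> w) +
     sq_bit G ((x \<otimes>\<^bsub>G\<^esub> y) \<otimes>\<^bsub>G\<^esub> w)"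

text \<open>Each derived form measures the failure of the preceding one to be additive. Hence loops
  with the same third form have second forms that differ by something biadditive.\<close>

lemma assoc_form_eq:
  "assoc_form G x y w = comm_form G (x \<otimes>\<^bsub>G\<^esub> y) w + comm_form G x w + comm_form G y w"
  by (simp add: assoc_form_def comm_form_def ac_simps)

context central_involution
begin

text \<open>A linear functional on \<open>G / {1, z}\<close> lifted to \<open>G\<close>; the value
  at \<open>z\<close> makes it constant on cosets.\<close>

definition functional :: "('a \<Rightarrow> bit) \<Rightarrow> bool" where
  "functional l \<longleftrightarrow> (\<forall>x\<in>carrier G. \<forall>y\<in>carrier G. l (x \<otimes> y) = l x + l y) \<and> l z = 0"

lemma functional_mult:
  "\<lbrakk>functional l; x \<in> carrier G; y \<in> carrier G\<rbrakk> \<Longrightarrow> l (x \<otimes> y) = l x + l y"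
  by (simp add: functional_def)

lemma functional_shift: "\<lbrakk>functional l; x \<in> carrier G\<rbrakk> \<Longrightarrow> l (shift x b) = l x"
  by (simp add: functional_def shift_def z_closed)

lemma to_GF2_shift: "to_GF2 G (shift \<one> b) = b"
  by (cases b) (auto simp: to_GF2_def shift_eq_one_iff)

end

text \<open>Squares, commutators and associators are powers of \<open>z\<close> whose exponents are
  the derived forms of \<open>P\<close>. The bound on the degree of \<open>P\<close> reappears as
  trilinearity in \<open>assoc_form_add1\<close>.\<close>

locale based_code_loop = central_involution +
  assumes finite_carrier: "finite (carrier G)"
    and sq: "x \<in> carrier G \<Longrightarrow> x \<otimes> x = shift \<one> (sq_bit G x)"
    and comm: "\<lbrakk>x \<in> carrier G; y \<in> carrier G\<rbrakk> \<Longrightarrow> x \<otimes> y = shift (y \<otimes> x) (comm_form G x y)"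
    and assoc: "\<lbrakk>x \<in> carrier G; y \<in> carrier G; w \<in> carrier G\<rbrakk>
      \<Longrightarrow> (x \<otimes> y) \<otimes> w = shift (x \<otimes> (y \<otimes> w)) (assoc_form G x y w)"
begin

lemma sq_bit_shift [simp]: "x \<in> carrier G \<Longrightarrow> sq_bit G (shift x b) = sq_bit G x"
  by (simp add: sq_bit_def shift_simps)

lemma sq_bit_one [simp]: "sq_bit G \<one> = 0"
  by (simp add: sq_bit_def to_GF2_def shift_simps)

lemma sq_bit_comm: "\<lbrakk>x \<in> carrier G; y \<in> carrier G\<rbrakk> \<Longrightarrow> sq_bit G (x \<otimes> y) = sq_bit G (y \<otimes> x)"
  using arg_cong[OF comm[of x y], of "sq_bit G"] by (simp add: m_closed)

lemma sq_bit_assoc: "\<lbrakk>x \<in> carrier G; y \<in> carrier G; w \<in> carrier G\<rbrakk>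
    \<Longrightarrow> sq_bit G ((x \<otimes> y) \<otimes> w) = sq_bit G (x \<otimes> (y \<otimes> w))"
  using arg_cong[OF assoc[of x y w], of "sq_bit G"] by (simp add: m_closed)

lemma sq_bit_sq [simp]: "x \<in> carrier G \<Longrightarrow> sq_bit G (x \<otimes> x) = 0"
  by (simp add: sq shift_simps)

lemma assoc_form_shift [simp]:
  assumes "x \<in> carrier G" "y \<in> carrier G" "w \<in> carrier G"
  shows "assoc_form G (shift x b) y w = assoc_form G x y w"
    "assoc_form G x (shift y b) w = assoc_form G x y w"
    "assoc_form G x y (shift w b) = assoc_form G x y w"
  using assms by (simp_all add: assoc_form_def shift_simps)

text \<open>\<open>sq_bit\<close> ignores powers of \<open>z\<close>, hence the order and the
  brackets in a product. The associator thereby inherits the symmetry of a derived form, as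
  \<open>symmetric_associator_additive\<close> requires.\<close>

lemma assoc_form_swap12:
  assumes "x \<in> carrier G" "y \<in> carrier G" "w \<in> carrier G"
  shows "assoc_form G x y w = assoc_form G y x w"
proof -
  have "(x \<otimes> y) \<otimes> w = shift ((y \<otimes> x) \<otimes> w) (comm_form G x y)"
    using assms by (subst comm[of x y]) (simp_all add: shift_simps)
  then have "sq_bit G ((x \<otimes> y) \<otimes> w) = sq_bit G ((y \<otimes> x) \<otimes> w)"
    using assms by (simp add: m_closed)
  then show ?thesis
    using assms by (simp add: assoc_form_def sq_bit_comm[of x y] ac_simps)
qed

lemma assoc_form_swap23:
  assumes "x \<in> carrier G" "y \<in> carrier G" "w \<in> carrier G"
  shows "assoc_form G x y w = assoc_form G x w y"
proof -
  have "x \<otimes> (y \<otimes> w) = shift (x \<otimes> (w \<otimes> y)) (comm_form G y w)"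
    using assms by (subst comm[of y w]) (simp_all add: shift_simps)
  then have "sq_bit G (x \<otimes> (y \<otimes> w)) = sq_bit G (x \<otimes> (w \<otimes> y))"
    using assms by (simp add: m_closed)
  then have "sq_bit G ((x \<otimes> y) \<otimes> w) = sq_bit G ((x \<otimes> w) \<otimes> y)"
    using assms by (simp add: sq_bit_assoc)
  then show ?thesis
    using assms by (simp add: assoc_form_def sq_bit_comm[of y w] ac_simps)
qed

lemma assoc_form_swap13:
  assumes "x \<in> carrier G" "y \<in> carrier G" "w \<in> carrier G"
  shows "assoc_form G x y w = assoc_form G w y x"
  using assms by (metis assoc_form_swap12 assoc_form_swap23)

lemma assoc_form_add1:
  assumes "x \<in> carrier G" "y \<in> carrier G" "u \<in> carrier G" "w \<in> carrier G"
  shows "assoc_form G (x \<otimes> y) u w = assoc_form G x u w + assoc_form G y u w"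
  using assms by (intro symmetric_associator_additive assoc assoc_form_swap12 assoc_form_swap23)

lemma assoc_form_add2:
  assumes "x \<in> carrier G" "y \<in> carrier G" "u \<in> carrier G" "w \<in> carrier G"
  shows "assoc_form G u (x \<otimes> y) w = assoc_form G u x w + assoc_form G u y w"
  using assoc_form_add1[OF assms] assms by (simp add: assoc_form_swap12 m_closed)

lemma assoc_form_add3:
  assumes "x \<in> carrier G" "y \<in> carrier G" "u \<in> carrier G" "w \<in> carrier G"
  shows "assoc_form G u w (x \<otimes> y) = assoc_form G u w x + assoc_form G u w y"
  using assoc_form_add2[OF assms] assms by (simp add: assoc_form_swap23 m_closed)

text \<open>The form is alternating; this is the source of the alternative law
  \<open>left_alt\<close> and of the Moufang identity.\<close>

lemma assoc_form_same [simp]: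
  assumes "x \<in> carrier G" "w \<in> carrier G"
  shows "assoc_form G x x w = 0" "assoc_form G x w x = 0" "assoc_form G w x x = 0"
proof -
  show *: "assoc_form G x x w = 0"
    using assms by (simp add: assoc_form_def) (simp add: sq shift_simps)
  show "assoc_form G x w x = 0" using * assoc_form_swap23[of x x w] assms by simp
  then show "assoc_form G w x x = 0" using assoc_form_swap12[of w x x] assms by simp
qed

lemma assoc_form_one [simp]:
  assumes "y \<in> carrier G" "w \<in> carrier G"
  shows "assoc_form G \<one> y w = 0" "assoc_form G z y w = 0"
proof -
  show *: "assoc_form G \<one> y w = 0"
    using assms by (simp add: assoc_form_def shift_simps)
  show "assoc_form G z y w = 0"
    using assms * assoc_form_shift(1)[of \<one> y w 1] by (simp add: shift_simps)
qed

lemma sq_mult: "\<lbrakk>x \<in> carrier G; y \<in> carrier G\<rbrakk> \<Longrightarrow> (x \<otimes> x) \<otimes> y = shift y (sq_bit G x)"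
  by (simp add: sq shift_simps)

lemma left_alt: "\<lbrakk>x \<in> carrier G; y \<in> carrier G\<rbrakk> \<Longrightarrow> x \<otimes> (x \<otimes> y) = shift y (sq_bit G x)"
  using assoc[of x x y] by (simp add: sq_mult shift_simps)

lemma associator_eq:
  "\<lbrakk>x \<in> carrier G; y \<in> carrier G; w \<in> carrier G\<rbrakk>
    \<Longrightarrow> associator G x y w = shift \<one> (assoc_form G x y w)"
  by (rule associator_eqI) (simp_all add: shift_simps, simp add: assoc shift_simps)

lemma commutator_eq:
  "\<lbrakk>x \<in> carrier G; y \<in> carrier G\<rbrakk> \<Longrightarrow> commutator G x y = shift \<one> (comm_form G x y)"
  by (rule commutator_eqI) (simp_all add: shift_simps, simp add: comm[of x y])

text \<open>Both sides are compared with \<open>(x y)(x w)\<close>. The two associators that arise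
  reduce to those of \<open>y, x, w\<close> and \<open>x, y, w\<close> by additivity and
  alternation, and they cancel by symmetry.\<close>

lemma is_moufang: "moufang_loop G"
proof
  fix x y w assume *: "x \<in> carrier G" "y \<in> carrier G" "w \<in> carrier G"
  show "((x \<otimes> y) \<otimes> x) \<otimes> w = x \<otimes> (y \<otimes> (x \<otimes> w))"
    using * by (simp add: assoc[of "x \<otimes> y" x w] assoc[of x y "x \<otimes> w"] shift_simps
        assoc_form_add1 assoc_form_add3 assoc_form_swap12[of y x w])
qed

text \<open>The bilinear map \<open>l x * m y\<close> is a 2-cocycle, so it leaves associators
  alone. Its diagonal \<open>l x * m x\<close> is added to the squaring map and its symmetrization
  to the commutator, which keeps the commutator equal to the second derived form.\<close>

lemma twist:
  fixes H :: "('a, 'c) monoid_scheme"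
  assumes l: "functional l" and m: "functional m"
    and carr: "carrier H = carrier G" and one: "\<one>\<^bsub>H\<^esub> = \<one>"
    and mult: "\<And>x y. \<lbrakk>x \<in> carrier G; y \<in> carrier G\<rbrakk> \<Longrightarrow> x \<otimes>\<^bsub>H\<^esub> y = shift (x \<otimes> y) (l x * m y)"
  shows "based_code_loop H z"
    and "\<And>x b. x \<in> carrier G \<Longrightarrow> central_involution.shift H z x b = shift x b"
    and "\<And>x. x \<in> carrier G \<Longrightarrow> sq_bit H x = sq_bit G x + l x * m x"
    and "\<And>x y w. \<lbrakk>x \<in> carrier G; y \<in> carrier G; w \<in> carrier G\<rbrakk>
      \<Longrightarrow> assoc_form H x y w = assoc_form G x y w"
proof -
  note fs = functional_mult[OF l] functional_mult[OF m] functional_shift[OF l] functional_shift[OF m]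
  have lz: "l z = 0" "m z = 0" using l m by (auto simp: functional_def)
  have one0: "l \<one> = 0" "m \<one> = 0" using fs(1,2)[of \<one> \<one>] by (simp_all add: l_one one_closed)
  have ldiv: "\<exists>!x. x \<in> carrier G \<and> a \<otimes>\<^bsub>H\<^esub> x = b" if ab: "a \<in> carrier G" "b \<in> carrier G" for a b
  proof -
    \<comment> \<open>A solution satisfies \<open>m x = m a + m b\<close>, so the exponent is known
      before \<open>x\<close> is and can be moved to the right-hand side.\<close>
    have "x \<in> carrier G \<and> a \<otimes>\<^bsub>H\<^esub> x = b \<longleftrightarrow> x \<in> carrier G \<and> a \<otimes> x = shift b (l a * (m a + m b))"
      (is "?L \<longleftrightarrow> ?R") for x
    proof
      assume ?L
      then have "b = shift (a \<otimes> x) (l a * m x)" "x \<in> carrier G" using mult ab by auto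
      then show ?R using ab by (simp add: fs shift_simps)
    next
      assume ?R
      then have "m (a \<otimes> x) = m b" using ab by (simp add: fs shift_simps)
      then have "m b = m a + m x" using \<open>?R\<close> ab fs(2)[of a x] by metis
      then show ?L using \<open>?R\<close> ab by (simp add: mult shift_simps)
    qed
    then show ?thesis using l_div[of a "shift b (l a * (m a + m b))"] ab by (simp add: shift_closed)
  qed
  have rdiv: "\<exists>!y. y \<in> carrier G \<and> y \<otimes>\<^bsub>H\<^esub> a = b" if ab: "a \<in> carrier G" "b \<in> carrier G" for a b
  proof -
    have "x \<in> carrier G \<and> x \<otimes>\<^bsub>H\<^esub> a = b \<longleftrightarrow> x \<in> carrier G \<and> x \<otimes> a = shift b ((l a + l b) * m a)"
      (is "?L \<longleftrightarrow> ?R") for x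
    proof
      assume ?L
      then have "b = shift (x \<otimes> a) (l x * m a)" "x \<in> carrier G" using mult ab by auto
      then show ?R using ab by (simp add: fs shift_simps ac_simps)
    next
      assume ?R
      then have "l (x \<otimes> a) = l b" using ab by (simp add: fs shift_simps)
      then have "l b = l x + l a" using \<open>?R\<close> ab fs(1)[of x a] by metis
      then show ?L using \<open>?R\<close> ab by (simp add: mult shift_simps ac_simps)
    qed
    then show ?thesis using r_div[of a "shift b ((l a + l b) * m a)"] ab by (simp add: shift_closed)
  qed
  interpret H: central_involution H z
    by unfold_locales
      (use ldiv rdiv in \<open>simp_all add: carr one mult shift_simps fs lz one0 z_neq_one z_z z_shift(3) add.commute\<close>)
  show sh: "H.shift x b = shift x b" if "x \<in> carrier G" for x b
    using that by (simp add: H.shift_def shift_def mult z_closed lz)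
  show sqH: "sq_bit H x = sq_bit G x + l x * m x" if "x \<in> carrier G" for x
  proof -
    have "x \<otimes>\<^bsub>H\<^esub> x = H.shift \<one>\<^bsub>H\<^esub> (sq_bit G x + l x * m x)"
      using that by (simp add: sh one one_closed mult sq shift_simps)
    then show ?thesis by (simp add: sq_bit_def H.to_GF2_shift)
  qed
  \<comment> \<open>A product of two linear functionals has degree two, so its third derived form
    vanishes.\<close>
  show aH: "assoc_form H x y w = assoc_form G x y w"
    if "x \<in> carrier G" "y \<in> carrier G" "w \<in> carrier G" for x y w
    using that by (simp add: assoc_form_def sqH mult shift_simps fs algebra_simps)
  show "based_code_loop H z"
  proof
    show "finite (carrier H)" using carr finite_carrier by simp
  next
    fix x assume "x \<in> carrier H"
    then show "x \<otimes>\<^bsub>H\<^esub> x = H.shift \<one>\<^bsub>H\<^esub> (sq_bit H x)"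
      by (simp add: carr one one_closed mult sqH sh sq shift_simps)
  next
    fix x y assume "x \<in> carrier H" "y \<in> carrier H"
    then have *: "x \<in> carrier G" "y \<in> carrier G" by (simp_all add: carr)
    have "comm_form H x y = comm_form G x y + l x * m y + l y * m x"
      using * by (simp add: comm_form_def sqH mult shift_simps fs algebra_simps)
    then show "x \<otimes>\<^bsub>H\<^esub> y = H.shift (y \<otimes>\<^bsub>H\<^esub> x) (comm_form H x y)"
      using * by (simp add: mult sh shift_simps comm[of x y] ac_simps)
  next
    fix x y w assume "x \<in> carrier H" "y \<in> carrier H" "w \<in> carrier H"
    then have *: "x \<in> carrier G" "y \<in> carrier G" "w \<in> carrier G" by (simp_all add: carr)
    show "(x \<otimes>\<^bsub>H\<^esub> y) \<otimes>\<^bsub>H\<^esub> w = H.shift (x \<otimes>\<^bsub>H\<^esub> (y \<otimes>\<^bsub>H\<^esub> w)) (assoc_form H x y w)"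
      using * by (simp add: mult aH sh shift_simps fs assoc algebra_simps)
  qed
qed

end

section \<open>Elementary abelian quotients\<close>

text \<open>
  The quotient group itself is never formed: its subgroups are represented by the saturated
  subsets of \<open>K\<close>.
\<close>

locale elementary_quotient =
  fixes K :: "'a set" and prod :: "'a \<Rightarrow> 'a \<Rightarrow> 'a" (infixl \<open>\<bullet>\<close> 70)
    and cong :: "'a \<Rightarrow> 'a \<Rightarrow> bool" (infix \<open>\<asymp>\<close> 50)
  assumes finite_K: "finite K"
    and K_closed: "\<lbrakk>x \<in> K; y \<in> K\<rbrakk> \<Longrightarrow> x \<bullet> y \<in> K"
    and K_sym: "\<lbrakk>x \<in> K; y \<in> K; x \<asymp> y\<rbrakk> \<Longrightarrow> y \<asymp> x"
    and K_trans: "\<lbrakk>x \<in> K; y \<in> K; w \<in> K; x \<asymp> y; y \<asymp> w\<rbrakk> \<Longrightarrow> x \<asymp> w"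
    and K_cong: "\<lbrakk>x \<in> K; y \<in> K; w \<in> K; x \<asymp> y\<rbrakk> \<Longrightarrow> w \<bullet> x \<asymp> w \<bullet> y"
    and K_comm: "\<lbrakk>x \<in> K; y \<in> K\<rbrakk> \<Longrightarrow> x \<bullet> y \<asymp> y \<bullet> x"
    and K_assoc: "\<lbrakk>x \<in> K; y \<in> K; w \<in> K\<rbrakk> \<Longrightarrow> x \<bullet> y \<bullet> w \<asymp> x \<bullet> (y \<bullet> w)"
    and K_sq: "\<lbrakk>x \<in> K; y \<in> K\<rbrakk> \<Longrightarrow> x \<bullet> x \<bullet> y \<asymp> y"
begin

definition saturated :: "'a set \<Rightarrow> bool" where
  "saturated U \<longleftrightarrow> U \<subseteq> K \<and> U \<noteq> {} \<and> (\<forall>x\<in>U. \<forall>y\<in>U. x \<bullet> y \<in> U) \<and>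
     (\<forall>x\<in>U. \<forall>y\<in>K. x \<asymp> y \<longrightarrow> y \<in> U)"

text \<open>In exponent two, \<open>x\<close> lies in the coset of \<open>k\<close> iff
  \<open>k \<bullet> x\<close> lies in the subgroup. So this is already the subgroup generated by
  \<open>U\<close> and \<open>k\<close>.\<close>

definition adjoin :: "'a \<Rightarrow> 'a set \<Rightarrow> 'a set" where
  "adjoin k U = {x \<in> K. x \<in> U \<or> k \<bullet> x \<in> U}"

lemma saturatedD:
  assumes "saturated U"
  shows "x \<in> U \<Longrightarrow> x \<in> K" "\<lbrakk>x \<in> U; y \<in> U\<rbrakk> \<Longrightarrow> x \<bullet> y \<in> U" "\<lbrakk>x \<in> U; y \<in> K; x \<asymp> y\<rbrakk> \<Longrightarrow> y \<in> U"
  using assms unfolding saturated_def by blast+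

lemma saturated_cong:
  "\<lbrakk>saturated U; x \<in> K; y \<in> K; x \<asymp> y\<rbrakk> \<Longrightarrow> x \<in> U \<longleftrightarrow> y \<in> U"
  using saturatedD(3) K_sym by blast

lemma K_swap_left:
  assumes "x \<in> K" "y \<in> K" "w \<in> K"
  shows "x \<bullet> (y \<bullet> w) \<asymp> y \<bullet> (x \<bullet> w)"
proof -
  note [simp] = assms K_closed
  have 1: "x \<bullet> (y \<bullet> w) \<asymp> w \<bullet> (x \<bullet> y)"
    by (rule K_trans[OF _ _ _ K_sym[OF _ _ K_assoc] K_comm]) simp_all
  have 2: "w \<bullet> (x \<bullet> y) \<asymp> w \<bullet> (y \<bullet> x)" by (intro K_cong K_comm) simp_all
  have 3: "w \<bullet> (y \<bullet> x) \<asymp> y \<bullet> (x \<bullet> w)"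
    by (rule K_trans[OF _ _ _ K_comm K_assoc]) simp_all
  show ?thesis
    by (rule K_trans[OF _ _ _ 1 K_trans[OF _ _ _ 2 3]]) simp_all
qed

lemma K_cancel: "\<lbrakk>x \<in> K; y \<in> K\<rbrakk> \<Longrightarrow> x \<bullet> (x \<bullet> y) \<asymp> y"
  by (rule K_trans[OF _ _ _ K_sym[OF _ _ K_assoc] K_sq]) (simp_all add: K_closed)

lemma saturated_mult_iff:
  assumes U: "saturated U" and "x \<in> U" "y \<in> K"
  shows "x \<bullet> y \<in> U \<longleftrightarrow> y \<in> U" "y \<bullet> x \<in> U \<longleftrightarrow> y \<in> U"
proof -
  have x: "x \<in> K" using saturatedD(1)[OF U] assms by blast
  show *: "x \<bullet> y \<in> U \<longleftrightarrow> y \<in> U"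
    using saturatedD(2)[OF U, of x] assms x saturated_cong[OF U _ _ K_cancel[of x y]] K_closed by blast
  show "y \<bullet> x \<in> U \<longleftrightarrow> y \<in> U"
    using * saturated_cong[OF U _ _ K_comm[of x y]] x assms K_closed by blast
qed

text \<open>The structure has no distinguished identity; all squares represent it, and containing
  them takes the place of containing the identity.\<close>

lemma saturated_sq:
  assumes U: "saturated U" and "x \<in> K"
  shows "x \<bullet> x \<in> U"
proof -
  obtain u where u: "u \<in> U" "u \<in> K" using U unfolding saturated_def by blast
  have "(x \<bullet> x) \<bullet> u \<in> U" using saturated_cong[OF U _ _ K_sq[of x u]] u assms K_closed by blast
  then show ?thesis using saturated_mult_iff(2)[OF U u(1)] assms K_closed by blast
qed

lemma prod_eliminate:
  assumes "k \<in> K" "x \<in> K" "y \<in> K"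
  shows "(k \<bullet> x) \<bullet> (k \<bullet> y) \<asymp> x \<bullet> y"
proof -
  note [simp] = assms K_closed
  have 1: "(k \<bullet> x) \<bullet> (k \<bullet> y) \<asymp> k \<bullet> (x \<bullet> (k \<bullet> y))" by (intro K_assoc) simp_all
  have 2: "k \<bullet> (x \<bullet> (k \<bullet> y)) \<asymp> k \<bullet> (k \<bullet> (x \<bullet> y))" by (intro K_cong K_swap_left) simp_all
  have 3: "k \<bullet> (k \<bullet> (x \<bullet> y)) \<asymp> x \<bullet> y" by (intro K_cancel) simp_all
  show ?thesis by (rule K_trans[OF _ _ _ 1 K_trans[OF _ _ _ 2 3]]) simp_all
qed

lemma K_medial:
  assumes "x \<in> K" "y \<in> K" "u \<in> K" "w \<in> K"
  shows "(x \<bullet> y) \<bullet> (u \<bullet> w) \<asymp> (x \<bullet> u) \<bullet> (y \<bullet> w)"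
proof -
  note [simp] = assms K_closed
  have 1: "(x \<bullet> y) \<bullet> (u \<bullet> w) \<asymp> x \<bullet> (y \<bullet> (u \<bullet> w))" by (intro K_assoc) simp_all
  have 2: "x \<bullet> (y \<bullet> (u \<bullet> w)) \<asymp> x \<bullet> (u \<bullet> (y \<bullet> w))" by (intro K_cong K_swap_left) simp_all
  have 3: "x \<bullet> (u \<bullet> (y \<bullet> w)) \<asymp> (x \<bullet> u) \<bullet> (y \<bullet> w)" by (intro K_sym[OF _ _ K_assoc]) simp_all
  show ?thesis by (rule K_trans[OF _ _ _ 1 K_trans[OF _ _ _ 2 3]]) simp_all
qed

lemma saturated_adjoin:
  assumes U: "saturated U" and k: "k \<in> K"
  shows "saturated (adjoin k U)" "U \<subseteq> adjoin k U" "k \<in> adjoin k U"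
proof -
  note D = saturatedD[OF U]
  show sub: "U \<subseteq> adjoin k U" using D(1) by (auto simp: adjoin_def)
  show "k \<in> adjoin k U" using saturated_sq[OF U k] k by (simp add: adjoin_def)
  have "x \<bullet> y \<in> adjoin k U" if "x \<in> adjoin k U" "y \<in> adjoin k U" for x y
  proof -
    note adj = that
    have xy: "x \<in> K" "y \<in> K" using adj by (auto simp: adjoin_def)
    have kx: "k \<bullet> x \<in> K" "k \<bullet> y \<in> K" "x \<bullet> y \<in> K" using xy k K_closed by auto
    have r1: "k \<bullet> (x \<bullet> y) \<in> U \<longleftrightarrow> x \<bullet> (k \<bullet> y) \<in> U"
      by (rule saturated_cong[OF U _ _ K_swap_left]) (simp_all add: xy k kx K_closed)
    have r2: "k \<bullet> x \<bullet> y \<in> U \<longleftrightarrow> k \<bullet> (x \<bullet> y) \<in> U"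
      by (rule saturated_cong[OF U _ _ K_assoc]) (simp_all add: xy k kx K_closed)
    have r3: "(k \<bullet> x) \<bullet> (k \<bullet> y) \<in> U \<longleftrightarrow> x \<bullet> y \<in> U"
      by (rule saturated_cong[OF U _ _ prod_eliminate]) (simp_all add: xy k kx K_closed)
    have "x \<bullet> y \<in> U \<or> k \<bullet> (x \<bullet> y) \<in> U"
      using adj D(2)[of x y] D(2)[of x "k \<bullet> y"] D(2)[of "k \<bullet> x" y] D(2)[of "k \<bullet> x" "k \<bullet> y"]
        r1 r2 r3 unfolding adjoin_def by blast
    then show ?thesis using kx by (simp add: adjoin_def)
  qed
  moreover have "y \<in> adjoin k U" if "x \<in> adjoin k U" "y \<in> K" "x \<asymp> y" for x y
  proof -
    have x: "x \<in> K" using that by (simp add: adjoin_def)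
    have "x \<in> U \<longleftrightarrow> y \<in> U" using saturated_cong[OF U x] that by blast
    moreover have "k \<bullet> x \<in> U \<longleftrightarrow> k \<bullet> y \<in> U"
      by (rule saturated_cong[OF U _ _ K_cong]) (use x k that K_closed in auto)
    ultimately show ?thesis using that by (simp add: adjoin_def)
  qed
  ultimately show "saturated (adjoin k U)"
    using sub U unfolding saturated_def[of "adjoin k U"]
    by (metis (no_types, lifting) adjoin_def mem_Collect_eq saturated_def subset_empty subsetI)
qed

text \<open>A saturated set that is maximal among those containing \<open>U\<close> and avoiding
  \<open>v\<close> has index two: adjoining any further \<open>x\<close> captures \<open>v\<close>,
  so \<open>x\<close> lies in the coset of \<open>v\<close>.\<close>

lemma ex_hyperplane:
  assumes U: "saturated U" and v: "v \<in> K - U"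
  obtains M where "saturated M" "U \<subseteq> M" "v \<notin> M" "\<And>x. x \<in> K \<Longrightarrow> x \<in> M \<or> v \<bullet> x \<in> M"
proof -
  define \<M> where "\<M> = {M. saturated M \<and> U \<subseteq> M \<and> v \<notin> M}"
  have "finite \<M>"
    by (rule finite_subset[of _ "Pow K"]) (auto simp: \<M>_def saturated_def finite_K)
  moreover have "U \<in> \<M>" using U v by (simp add: \<M>_def)
  ultimately obtain M where M\<M>: "M \<in> \<M>" and max: "\<forall>N\<in>\<M>. M \<subseteq> N \<longrightarrow> M = N"
    using finite_has_maximal[of \<M>] by blast
  then have M: "saturated M" "U \<subseteq> M" "v \<notin> M" by (simp_all add: \<M>_def)
  have "v \<bullet> x \<in> M" if x: "x \<in> K" "x \<notin> M" for x
  proof -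
    note a = saturated_adjoin[OF M(1) x(1)]
    have "adjoin x M \<notin> \<M>" using a max x by blast
    then have "v \<in> adjoin x M" using a M by (auto simp: \<M>_def)
    then have "x \<bullet> v \<in> M" using M by (simp add: adjoin_def)
    then show ?thesis using saturated_cong[OF M(1) _ _ K_comm[of x v]] x v K_closed by blast
  qed
  then show ?thesis using M that by blast
qed

text \<open>Two elements outside \<open>M\<close> lie in the same coset, that of \<open>v\<close>,
  and multiply into \<open>M\<close>. This makes the indicator of \<open>M\<close> a linear
  functional.\<close>

lemma hyperplane_mult_iff:
  assumes M: "saturated M" and v: "v \<in> K" "\<And>x. x \<in> K \<Longrightarrow> x \<in> M \<or> v \<bullet> x \<in> M"
    and xy: "x \<in> K" "y \<in> K"
  shows "x \<bullet> y \<in> M \<longleftrightarrow> (x \<in> M \<longleftrightarrow> y \<in> M)"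
proof (cases "x \<in> M \<or> y \<in> M")
  case True
  then show ?thesis using saturated_mult_iff[OF M] xy by blast
next
  case False
  then have "(v \<bullet> x) \<bullet> (v \<bullet> y) \<in> M" using v(2)[of x] v(2)[of y] saturatedD(2)[OF M] xy by blast
  then show ?thesis
    using saturated_cong[OF M _ _ prod_eliminate[of v x y]] v(1) xy False K_closed by blast
qed

text \<open>Induction on the number of missing elements. Adjoining one vector at a time replaces the
  choice of a basis.\<close>

lemma saturated_induct [consumes 1, case_names base step]:
  assumes U0: "saturated U0" and base: "P U0"
    and step: "\<And>U v. \<lbrakk>saturated U; v \<in> K - U; P U\<rbrakk> \<Longrightarrow> P (adjoin v U)"
  shows "P K"
proof -
  have "P K" if "saturated U" "P U" for U
    using that
  proof (induction "card (K - U)" arbitrary: U rule: less_induct)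
    case less
    show ?case
    proof (cases "U = K")
      case False
      then obtain v where v: "v \<in> K - U" using less.prems unfolding saturated_def by blast
      note a = saturated_adjoin[OF less.prems(1), of v]
      have "adjoin v U \<subseteq> K" by (auto simp: adjoin_def)
      then have "K - adjoin v U \<subset> K - U" using a v by blast
      then have "card (K - adjoin v U) < card (K - U)" using finite_K by (simp add: psubset_card_mono)
      then show ?thesis using less.hyps[of "adjoin v U"] a v step less.prems by blast
    qed (use less.prems in simp)
  qed
  then show ?thesis using U0 base by blast
qed

end

section \<open>Factor loops and the characterization of code loops\<close>

context based_code_loop
begin

sublocale mod_z: elementary_quotient "carrier G" "(\<otimes>)" "\<lambda>x y. \<exists>b. y = shift x b"
proof
  show "finite (carrier G)" by (rule finite_carrier)
  fix x y w assume x: "x \<in> carrier G" and y: "y \<in> carrier G"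
  show "x \<otimes> y \<in> carrier G" using x y by (rule m_closed)
  show "\<exists>b. x = shift y b" if "\<exists>b. y = shift x b"
    using that x by (metis bit_add_self(1) shift_0 shift_shift)
  show "\<exists>b. y \<otimes> x = shift (x \<otimes> y) b" using comm[of y x] x y by blast
  show "\<exists>b. y = shift (x \<otimes> x \<otimes> y) b"
    using x y sq_mult[of x y] by (metis bit_add_self(1) shift_0 shift_shift)
  assume w: "w \<in> carrier G"
  show "\<exists>b. w = shift x b" if "\<exists>b. y = shift x b" "\<exists>b. w = shift y b"
    using that x by (metis shift_shift)
  show "\<exists>b. w \<otimes> y = shift (w \<otimes> x) b" if "\<exists>b. y = shift x b"
    using that x w by (metis shift_mult_right)
  show "\<exists>b. x \<otimes> (y \<otimes> w) = shift (x \<otimes> y \<otimes> w) b"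
    using assoc[of x y w] x y w by (metis bit_add_self(1) m_closed shift_0 shift_shift)
qed

text \<open>Modulo \<open>S\<close> every element is its own inverse, so
  \<open>x \<otimes> u \<in> S\<close> describes the coset of \<open>x\<close> without
  inverses.\<close>

definition coset :: "'a set \<Rightarrow> 'a \<Rightarrow> 'a set" where
  "coset S x = {u \<in> carrier G. x \<otimes> u \<in> S}"

section \<open>Cosets of a saturated set and the factor group\<close>

context
  fixes S assumes S: "mod_z.saturated S"
begin

lemma cong_mem: "\<lbrakk>x \<in> carrier G; \<exists>b. y = shift x b\<rbrakk> \<Longrightarrow> x \<in> S \<longleftrightarrow> y \<in> S"
  using mod_z.saturated_cong[OF S, of x y] shift_closed by blast

lemma shift_mem: "x \<in> carrier G \<Longrightarrow> shift x b \<in> S \<longleftrightarrow> x \<in> S"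
  using cong_mem by blast

lemma one_z_mem: "\<one> \<in> S" "z \<in> S"
proof -
  show "\<one> \<in> S" using mod_z.saturated_sq[OF S, of \<one>] by (simp add: loop_simps)
  then show "z \<in> S" using shift_mem[of \<one> 1] by (simp add: shift_simps)
qed

lemma coset_one: "coset S \<one> = S"
  using mod_z.saturatedD(1)[OF S] by (auto simp: coset_def l_one)

lemma self_mem_coset: "x \<in> carrier G \<Longrightarrow> x \<in> coset S x"
  using mod_z.saturated_sq[OF S] by (simp add: coset_def)

lemma coset_eq_iff:
  assumes "x \<in> carrier G" "y \<in> carrier G"
  shows "coset S x = coset S y \<longleftrightarrow> x \<otimes> y \<in> S"
proof
  assume "coset S x = coset S y"
  then have "y \<in> coset S x" using self_mem_coset assms by blast
  then show "x \<otimes> y \<in> S" by (simp add: coset_def)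
next
  assume xy: "x \<otimes> y \<in> S"
  have "x \<otimes> u \<in> S \<longleftrightarrow> y \<otimes> u \<in> S" if u: "u \<in> carrier G" for u
  proof -
    have "x \<otimes> u \<in> S \<longleftrightarrow> (x \<otimes> y) \<otimes> (x \<otimes> u) \<in> S"
      using mod_z.saturated_mult_iff(1)[OF S xy] assms u m_closed by blast
    also have "\<dots> \<longleftrightarrow> y \<otimes> u \<in> S"
      using cong_mem[OF _ mod_z.prod_eliminate[of x y u]] assms u m_closed by blast
    finally show ?thesis .
  qed
  then show "coset S x = coset S y" by (auto simp: coset_def)
qed

lemma coset_cong:
  assumes "x \<in> carrier G" "\<exists>b. y = shift x b"
  shows "coset S x = coset S y"
proof -
  obtain b where "y = shift x b" using assms by blast
  then show ?thesis
    using assms mod_z.saturated_sq[OF S, of x] coset_eq_iff[of x y]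
    by (simp add: shift_closed shift_mult_right shift_mem m_closed)
qed

text \<open>By the medial law \<open>(x y)(u y)\<close> is congruent to \<open>(x u)(y y)\<close>,
  and the square is absorbed by \<open>S\<close>. Division by \<open>y\<close> shows that the whole
  coset is reached.\<close>

lemma coset_r_coset:
  assumes "x \<in> carrier G" "y \<in> carrier G"
  shows "coset S x #> y = coset S (x \<otimes> y)"
proof -
  have *: "(x \<otimes> y) \<otimes> (u \<otimes> y) \<in> S \<longleftrightarrow> x \<otimes> u \<in> S" if u: "u \<in> carrier G" for u
  proof -
    have "(x \<otimes> y) \<otimes> (u \<otimes> y) \<in> S \<longleftrightarrow> (x \<otimes> u) \<otimes> (y \<otimes> y) \<in> S"
      using cong_mem[OF _ mod_z.K_medial[of x y u y]] assms u m_closed by blast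
    then show ?thesis
      using mod_z.saturated_mult_iff(2)[OF S mod_z.saturated_sq[OF S]] assms u m_closed by blast
  qed
  show ?thesis
  proof
    show "coset S x #> y \<subseteq> coset S (x \<otimes> y)"
      using assms * by (auto simp: coset_def r_coset_def m_closed)
    show "coset S (x \<otimes> y) \<subseteq> coset S x #> y"
    proof
      fix w assume w: "w \<in> coset S (x \<otimes> y)"
      then obtain u where "u \<in> carrier G" "u \<otimes> y = w"
        using r_div[of y w] assms by (auto simp: coset_def)
      then show "w \<in> coset S x #> y" using * w by (auto simp: coset_def r_coset_def)
    qed
  qed
qed

lemma coset_l_coset:
  assumes "x \<in> carrier G" "y \<in> carrier G"
  shows "x <# coset S y = coset S (x \<otimes> y)"
proof -
  have *: "(x \<otimes> y) \<otimes> (x \<otimes> u) \<in> S \<longleftrightarrow> y \<otimes> u \<in> S" if u: "u \<in> carrier G" for u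
    using cong_mem[OF _ mod_z.prod_eliminate[of x y u]] assms u m_closed by blast
  show ?thesis
  proof
    show "x <# coset S y \<subseteq> coset S (x \<otimes> y)"
      using assms * by (auto simp: coset_def l_coset_def m_closed)
    show "coset S (x \<otimes> y) \<subseteq> x <# coset S y"
    proof
      fix w assume w: "w \<in> coset S (x \<otimes> y)"
      then obtain u where "u \<in> carrier G" "x \<otimes> u = w"
        using l_div[of x w] assms by (auto simp: coset_def)
      then show "w \<in> x <# coset S y" using * w by (auto simp: coset_def l_coset_def)
    qed
  qed
qed

lemma r_coset_eq: "x \<in> carrier G \<Longrightarrow> S #> x = coset S x"
  using coset_r_coset[of \<one> x] by (simp add: coset_one loop_simps)

lemma l_coset_eq: "x \<in> carrier G \<Longrightarrow> x <# S = coset S x"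
  using coset_l_coset[of x \<one>] by (simp add: coset_one loop_simps)

lemma coset_set_mult:
  assumes "x \<in> carrier G" "y \<in> carrier G"
  shows "coset S x <#> coset S y = coset S (x \<otimes> y)"
proof
  show "coset S x <#> coset S y \<subseteq> coset S (x \<otimes> y)"
  proof
    fix w assume "w \<in> coset S x <#> coset S y"
    then obtain u v where uv: "u \<in> carrier G" "x \<otimes> u \<in> S" "v \<in> carrier G" "y \<otimes> v \<in> S" "w = u \<otimes> v"
      by (auto simp: set_mult_def coset_def)
    have "(x \<otimes> u) \<otimes> (y \<otimes> v) \<in> S" using uv mod_z.saturatedD(2)[OF S] by blast
    then have "(x \<otimes> y) \<otimes> (u \<otimes> v) \<in> S"
      using cong_mem[OF _ mod_z.K_medial[of x u y v]] uv assms m_closed by blast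
    then show "w \<in> coset S (x \<otimes> y)" using uv by (simp add: coset_def m_closed)
  qed
  have "coset S (x \<otimes> y) = x <# coset S y" using coset_l_coset assms by simp
  also have "\<dots> \<subseteq> coset S x <#> coset S y"
    using self_mem_coset[OF assms(1)] by (auto simp: set_mult_def l_coset_def)
  finally show "coset S (x \<otimes> y) \<subseteq> coset S x <#> coset S y" .
qed

lemma factor_carrier: "carrier (G Mod S) = coset S ` carrier G"
  by (auto simp: FactGroup_def RCOSETS_def r_coset_eq)

lemma factor_mult:
  "\<lbrakk>x \<in> carrier G; y \<in> carrier G\<rbrakk> \<Longrightarrow> coset S x \<otimes>\<^bsub>G Mod S\<^esub> coset S y = coset S (x \<otimes> y)"
  by (simp add: coset_set_mult)

lemma factor_one: "\<one>\<^bsub>G Mod S\<^esub> = S"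
  by (simp add: FactGroup_def)

lemma factor_sq: "A \<in> carrier (G Mod S) \<Longrightarrow> A \<otimes>\<^bsub>G Mod S\<^esub> A = \<one>\<^bsub>G Mod S\<^esub>"
proof -
  assume "A \<in> carrier (G Mod S)"
  then obtain x where x: "x \<in> carrier G" "A = coset S x" by (auto simp: factor_carrier)
  then have "coset S (x \<otimes> x) = S"
    using mod_z.saturated_sq[OF S x(1)] coset_eq_iff[of "x \<otimes> x" \<one>]
    by (simp add: coset_one loop_simps)
  then show ?thesis using x by (simp add: coset_set_mult)
qed

text \<open>Commutators and associators are powers of \<open>z\<close>, and every saturated set
  contains \<open>z\<close>.\<close>

lemma factor_comm_group: "comm_group (G Mod S)"
proof (rule comm_groupI)
  show "\<one>\<^bsub>G Mod S\<^esub> \<in> carrier (G Mod S)"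
    using coset_one one_closed by (auto simp: factor_one factor_carrier)
  fix A B C assume A: "A \<in> carrier (G Mod S)" and B: "B \<in> carrier (G Mod S)"
  show "A \<otimes>\<^bsub>G Mod S\<^esub> B \<in> carrier (G Mod S)"
    using A B by (auto simp: factor_carrier coset_set_mult m_closed)
  show "A \<otimes>\<^bsub>G Mod S\<^esub> B = B \<otimes>\<^bsub>G Mod S\<^esub> A"
  proof -
    obtain x y where "x \<in> carrier G" "A = coset S x" "y \<in> carrier G" "B = coset S y"
      using A B by (auto simp: factor_carrier)
    then show ?thesis using coset_cong[OF _ mod_z.K_comm[of x y]] by (simp add: coset_set_mult m_closed)
  qed
  show "\<one>\<^bsub>G Mod S\<^esub> \<otimes>\<^bsub>G Mod S\<^esub> A = A"
    using A factor_mult[OF one_closed] by (auto simp: factor_carrier factor_one coset_one l_one)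
  show "\<exists>B\<in>carrier (G Mod S). B \<otimes>\<^bsub>G Mod S\<^esub> A = \<one>\<^bsub>G Mod S\<^esub>"
    using A factor_sq by blast
  assume C: "C \<in> carrier (G Mod S)"
  show "A \<otimes>\<^bsub>G Mod S\<^esub> B \<otimes>\<^bsub>G Mod S\<^esub> C = A \<otimes>\<^bsub>G Mod S\<^esub> (B \<otimes>\<^bsub>G Mod S\<^esub> C)"
  proof -
    obtain x y w where "x \<in> carrier G" "A = coset S x" "y \<in> carrier G" "B = coset S y"
      "w \<in> carrier G" "C = coset S w"
      using A B C by (auto simp: factor_carrier)
    then show ?thesis
      using coset_cong[OF _ mod_z.K_assoc[of x y w]] by (simp add: coset_set_mult m_closed)
  qed
qed

lemma saturated_subloop: "subloop S G"
proof -
  note D = mod_z.saturatedD[OF S]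
  have "loop (G\<lparr>carrier := S\<rparr>)"
  proof
    fix a b assume "a \<in> carrier (G\<lparr>carrier := S\<rparr>)" "b \<in> carrier (G\<lparr>carrier := S\<rparr>)"
    then have ab: "a \<in> S" "b \<in> S" "a \<in> carrier G" "b \<in> carrier G" using D(1) by auto
    have "x \<in> S \<and> a \<otimes> x = b \<longleftrightarrow> x \<in> carrier G \<and> a \<otimes> x = b" for x
      using mod_z.saturated_mult_iff(1)[OF S ab(1)] ab D(1) by blast
    then show "\<exists>!x. x \<in> carrier (G\<lparr>carrier := S\<rparr>) \<and> a \<otimes>\<^bsub>G\<lparr>carrier := S\<rparr>\<^esub> x = b"
      using l_div[OF ab(3,4)] by simp
    have "x \<in> S \<and> x \<otimes> a = b \<longleftrightarrow> x \<in> carrier G \<and> x \<otimes> a = b" for x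
      using mod_z.saturated_mult_iff(2)[OF S ab(1)] ab D(1) by blast
    then show "\<exists>!y. y \<in> carrier (G\<lparr>carrier := S\<rparr>) \<and> y \<otimes>\<^bsub>G\<lparr>carrier := S\<rparr>\<^esub> a = b"
      using r_div[OF ab(3,4)] by simp
  qed (simp_all add: D(1,2) one_z_mem l_one r_one)
  then show ?thesis using D(1) by (auto simp: subloop_def)
qed

lemma saturated_normal: "normal_subloop S G"
  unfolding normal_subloop_def
  using saturated_subloop
  by (simp add: r_coset_eq l_coset_eq coset_r_coset coset_l_coset m_closed)

end

lemma saturated_one_z: "mod_z.saturated {\<one>, z}"
  unfolding mod_z.saturated_def
  by (auto simp: loop_simps z_closed z_z) (auto simp: shift_def z_closed l_one z_z)

end

section \<open>Derived forms of order two, three and four\<close>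

lemma sum_Pow_insert:
  assumes "finite A" "a \<notin> A"
  shows "sum g (Pow (insert a A)) = sum g (Pow A) + (\<Sum>I\<in>Pow A. g (insert a I))"
proof -
  have "inj_on (insert a) (Pow A)"
    using assms(2) by (intro inj_onI) (metis Diff_insert_absorb PowD insert_Diff_if subsetD)
  moreover have "Pow A \<inter> insert a ` Pow A = {}" using assms by auto
  ultimately show ?thesis
    using assms by (simp add: Pow_insert sum.union_disjoint sum.reindex)
qed

text \<open>With the empty set included the sum runs over a full power set, which splits one index
  at a time by \<open>sum_Pow_insert\<close>. In GF(2) the extra term is removed by adding it
  again.\<close>

lemma derived_form_Pow:
  "derived_form V f vs =
     (\<Sum>I\<in>Pow {..<length vs}. f (finprod V (\<lambda>i. vs ! i) I)) + f (finprod V (\<lambda>i. vs ! i) {})"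
proof -
  have "{I. I \<subseteq> {..<length vs} \<and> I \<noteq> {}} = Pow {..<length vs} - {{}}" by auto
  then show ?thesis by (simp add: derived_form_def sum_diff1)
qed

context comm_group
begin

lemma derived_form2:
  assumes "u \<in> carrier G" "v \<in> carrier G"
  shows "derived_form G f [u, v] = f u + f v + f (u \<otimes> v)"
proof -
  have "{..<length [u, v]} = insert 1 (insert 0 {})" by auto
  then show ?thesis
    unfolding derived_form_Pow using assms
    by (simp only: sum_Pow_insert finite.intros Pow_empty) (simp add: sum_Pow_insert m_ac ac_simps)
qed

lemma derived_form3:
  assumes "u \<in> carrier G" "v \<in> carrier G" "w \<in> carrier G"
  shows "derived_form G f [u, v, w] = f u + f v + f w + f (u \<otimes> v) + f (u \<otimes> w) + f (v \<otimes> w) + f (u \<otimes> v \<otimes> w)"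
proof -
  have "{..<length [u, v, w]} = insert 2 (insert 1 (insert 0 {}))" by auto
  then show ?thesis
    unfolding derived_form_Pow using assms
    by (simp only:) (simp add: sum_Pow_insert m_ac ac_simps numeral_2_eq_2)
qed

text \<open>The fourth form is the additivity defect of the third, so degree at most three amounts
  to trilinearity.\<close>

lemma derived_form4:
  assumes "t \<in> carrier G" "u \<in> carrier G" "v \<in> carrier G" "w \<in> carrier G"
  shows "derived_form G f [t, u, v, w] =
    derived_form G f [t \<otimes> u, v, w] + derived_form G f [t, v, w] + derived_form G f [u, v, w]"
proof -
  have "{..<length [t, u, v, w]} = insert 3 (insert 2 (insert 1 (insert 0 {})))" by auto
  then show ?thesis
    unfolding derived_form_Pow[of _ _ "[t, u, v, w]"] using assms
    by (simp only:) (simp add: derived_form3 sum_Pow_insert m_ac ac_simps numeral_2_eq_2 numeral_3_eq_3)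
qed

end

lemma UNIV_bit: "(UNIV :: bit set) = {0, 1}"
  by (auto intro: bit.exhaust)

section \<open>The factor by the central subloop of order two\<close>

context central_involution
begin

text \<open>\<open>coset\<close> is available only in a code loop. Describing cosets as orbits of
  \<open>shift\<close> also works before a loop is known to be one, as
  \<open>code_loop_over_based\<close> requires.\<close>

lemma z_coset: "x \<in> carrier G \<Longrightarrow> {\<one>, z} #> x = range (shift x)"
proof -
  assume x: "x \<in> carrier G"
  have "{\<one>, z} #> x = {shift x 0, shift x 1}"
    using x by (auto simp: r_coset_def shift_simps)
  then show ?thesis by (simp add: UNIV_bit)
qed

lemma z_factor_carrier: "carrier (G Mod {\<one>, z}) = (\<lambda>x. range (shift x)) ` carrier G"
  by (auto simp: FactGroup_def RCOSETS_def z_coset)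

lemma z_factor_mult:
  assumes "x \<in> carrier G" "y \<in> carrier G"
  shows "range (shift x) \<otimes>\<^bsub>G Mod {\<one>, z}\<^esub> range (shift y) = range (shift (x \<otimes> y))"
proof
  show "range (shift x) \<otimes>\<^bsub>G Mod {\<one>, z}\<^esub> range (shift y) \<subseteq> range (shift (x \<otimes> y))"
    using assms by (auto simp: set_mult_def shift_simps)
  have "shift (x \<otimes> y) b = shift x 0 \<otimes> shift y b" for b
    using assms by (simp add: shift_simps)
  then show "range (shift (x \<otimes> y)) \<subseteq> range (shift x) \<otimes>\<^bsub>G Mod {\<one>, z}\<^esub> range (shift y)"
    unfolding mult_FactGroup set_mult_def by blast
qed

lemma z_factor_one: "\<one>\<^bsub>G Mod {\<one>, z}\<^esub> = range (shift \<one>)"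
  by (auto simp: UNIV_bit shift_simps)

lemma power_map_eq:
  assumes "x \<in> carrier G"
  shows "power_map G (range (shift x)) = sq_bit G x"
proof -
  have "(THE c. \<exists>a\<in>range (shift x). c = a \<otimes> a) = x \<otimes> x"
    using assms by (intro the_equality) (auto simp: shift_simps)
  then show ?thesis by (simp add: power_map_def sq_bit_def)
qed

lemma commutator_map_eq:
  assumes "x \<in> carrier G" "y \<in> carrier G"
  shows "commutator_map G (range (shift x)) (range (shift y)) = to_GF2 G (commutator G x y)"
proof -
  have *: "commutator G (shift x b) (shift y c) = commutator G x y" for b c
    using assms commutator[OF assms]
    by (intro commutator_eqI) (simp_all add: shift_simps add.commute)
  have "(THE c. \<exists>a\<in>range (shift x). \<exists>b\<in>range (shift y). c = commutator G a b) = commutator G x y"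
    by (intro the_equality) (auto simp: *)
  then show ?thesis by (simp add: commutator_map_def)
qed

lemma associator_map_eq:
  assumes "x \<in> carrier G" "y \<in> carrier G" "w \<in> carrier G"
  shows "associator_map G (range (shift x)) (range (shift y)) (range (shift w))
    = to_GF2 G (associator G x y w)"
proof -
  have *: "associator G (shift x b) (shift y c) (shift w d) = associator G x y w" for b c d
    using assms associator[OF assms]
    by (intro associator_eqI) (simp_all add: shift_simps ac_simps)
  have "(THE c. \<exists>a\<in>range (shift x). \<exists>b\<in>range (shift y). \<exists>d\<in>range (shift w).
      c = associator G a b d) = associator G x y w"
    by (intro the_equality) (auto simp: *)
  then show ?thesis by (simp add: associator_map_def)
qed

lemma z_derived_forms:
  assumes V: "comm_group (G Mod {\<one>, z})"
    and "x \<in> carrier G" "y \<in> carrier G" "w \<in> carrier G"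
  shows "derived_form (G Mod {\<one>, z}) (power_map G) [range (shift x), range (shift y)] = comm_form G x y"
    and "derived_form (G Mod {\<one>, z}) (power_map G) [range (shift x), range (shift y), range (shift w)]
      = assoc_form G x y w"
  using assms
  by (simp_all add: comm_group.derived_form2[OF V] comm_group.derived_form3[OF V] z_factor_carrier
      z_factor_mult power_map_eq comm_form_def assoc_form_def m_closed del: mult_FactGroup)

lemma range_shift_eqD:
  assumes "x \<in> carrier G" "y \<in> carrier G" "range (shift x) = range (shift y)"
  obtains b where "x = shift y b"
proof -
  have "shift x 0 \<in> range (shift y)" using assms by blast
  then show ?thesis using that by (auto simp: shift_0)
qed

end

context based_code_loop
begin

lemma code_loop_over: "code_loop_over G {\<one>, z}"
proof -
  let ?V = "G Mod {\<one>, z}"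
  note V = factor_comm_group[OF saturated_one_z]
  interpret V: comm_group ?V by (rule V)
  have "central_subloop {\<one>, z} G"
    unfolding central_subloop_def
    using saturated_subloop[OF saturated_one_z]
    by (auto simp: z_closed loop_simps shift_simps z_shift(3) intro!: commutator_eqI associator_eqI)
  moreover have "elementary_abelian_2_group ?V"
    using V factor_sq[OF saturated_one_z] by (simp add: elementary_abelian_2_group_def)
  ultimately have symp: "symplectic_loop G {\<one>, z}"
    using z_neq_one finite_carrier loop_axioms by (simp add: symplectic_loop_def)
  have "derived_form ?V (power_map G) vs = 0" if len: "length vs = 3 + 1 \<and> set vs \<subseteq> carrier ?V" for vs
  proof -
    obtain t u v w where "vs = [t, u, v, w]" using len
      by (auto simp: numeral_3_eq_3 length_Suc_conv)
    then obtain a b c d where vs: "vs = map (\<lambda>x. range (shift x)) [a, b, c, d]"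
      and *: "a \<in> carrier G" "b \<in> carrier G" "c \<in> carrier G" "d \<in> carrier G"
      using len by (auto simp: z_factor_carrier)
    have "range (shift x) \<in> carrier ?V" if "x \<in> carrier G" for x
      using that by (simp add: z_factor_carrier)
    then have "derived_form ?V (power_map G) vs
        = assoc_form G (a \<otimes> b) c d + assoc_form G a c d + assoc_form G b c d"
      using * by (simp add: vs V.derived_form4 z_factor_mult z_derived_forms[OF V] m_closed del: mult_FactGroup)
    then show ?thesis using * by (simp add: assoc_form_add1 ac_simps)
  qed
  then have "cdeg ?V (power_map G) \<le> 3" unfolding cdeg_def by (intro Least_le) blast
  moreover have "commutator_map G u v = derived_form ?V (power_map G) [u, v]"
    if "u \<in> carrier ?V" "v \<in> carrier ?V" for u v
    using that
    by (auto simp: z_factor_carrier z_derived_forms[OF V] commutator_map_eq commutator_eq to_GF2_shift)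
  moreover have "associator_map G u v w = derived_form ?V (power_map G) [u, v, w]"
    if "u \<in> carrier ?V" "v \<in> carrier ?V" "w \<in> carrier ?V" for u v w
    using that
    by (auto simp: z_factor_carrier z_derived_forms[OF V] associator_map_eq associator_eq to_GF2_shift)
  ultimately show ?thesis using symp by (simp add: code_loop_over_def Let_def)
qed

lemma radical3_trivial_iff:
  "radical3 (G Mod {\<one>, z}) (power_map G) = {\<one>\<^bsub>G Mod {\<one>, z}\<^esub>} \<longleftrightarrow>
    (\<forall>x\<in>carrier G. (\<forall>y\<in>carrier G. \<forall>w\<in>carrier G. assoc_form G x y w = 0) \<longrightarrow> x \<in> {\<one>, z})"
proof -
  let ?V = "G Mod {\<one>, z}"
  note V = factor_comm_group[OF saturated_one_z]
  have eq: "range (shift x) = range (shift \<one>) \<longleftrightarrow> x \<in> {\<one>, z}" if x: "x \<in> carrier G" for x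
  proof
    assume "range (shift x) = range (shift \<one>)"
    then show "x \<in> {\<one>, z}" using range_shift_eqD[OF x one_closed] shift_one_iff[of x] by metis
  next
    assume "x \<in> {\<one>, z}"
    then show "range (shift x) = range (shift \<one>)" by (auto simp: UNIV_bit shift_simps)
  qed
  define R where "R = {x \<in> carrier G. \<forall>y\<in>carrier G. \<forall>w\<in>carrier G. assoc_form G x y w = 0}"
  have R: "radical3 ?V (power_map G) = (\<lambda>x. range (shift x)) ` R"
    by (auto simp: R_def radical3_def z_factor_carrier z_derived_forms[OF V])
  have "\<one> \<in> R" by (simp add: R_def one_closed)
  then have "f ` R = {f \<one>} \<longleftrightarrow> (\<forall>x\<in>R. f x = f \<one>)" for f :: "'a \<Rightarrow> 'a set"
    by auto
  then have "(\<lambda>x. range (shift x)) ` R = {range (shift \<one>)} \<longleftrightarrow> (\<forall>x\<in>R. range (shift x) = range (shift \<one>))" .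
  also have "\<dots> \<longleftrightarrow> (\<forall>x\<in>R. x \<in> {\<one>, z})" using eq by (intro ball_cong) (simp_all add: R_def)
  finally show ?thesis unfolding R z_factor_one by (auto simp: R_def)
qed

end

text \<open>Since the factor group is elementary abelian, every square, commutator and associator is
  some power of \<open>z\<close>; the maps \<open>P\<close>, \<open>C\<close> and \<open>A\<close>
  then identify the exponent.\<close>

lemma code_loop_over_based:
  fixes G (structure)
  assumes "code_loop_over G Z"
  obtains z where "Z = {\<one>, z}" "based_code_loop G z"
proof -
  have symp: "symplectic_loop G Z" using assms by (simp add: code_loop_over_def)
  interpret loop G using symp by (simp add: symplectic_loop_def)
  have central: "subloop Z G"
    "\<And>c x y. \<lbrakk>c \<in> Z; x \<in> carrier G; y \<in> carrier G\<rbrakk> \<Longrightarrow> commutator G c x = \<one>"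
    "\<And>c x y. \<lbrakk>c \<in> Z; x \<in> carrier G; y \<in> carrier G\<rbrakk> \<Longrightarrow> associator G x c y = \<one>"
    "\<And>c x y. \<lbrakk>c \<in> Z; x \<in> carrier G; y \<in> carrier G\<rbrakk> \<Longrightarrow> associator G x y c = \<one>"
    using symp by (auto simp: symplectic_loop_def central_subloop_def)
  interpret Z: loop "G\<lparr>carrier := Z\<rparr>" using central(1) by (simp add: subloop_def)
  have sub: "Z \<subseteq> carrier G" using central(1) by (simp add: subloop_def)
  have one: "\<one> \<in> Z" using Z.one_closed by simp
  have "card Z = 2" using symp by (simp add: symplectic_loop_def)
  then obtain z where Z: "Z = {\<one>, z}" and neq: "z \<noteq> \<one>"
    using one by (auto simp: card_2_iff)
  have zG: "z \<in> carrier G" using Z sub by simp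
  have zz: "z \<otimes> z = \<one>"
  proof -
    have "z \<otimes> z \<in> Z" using Z.m_closed[of z z] Z by simp
    moreover have "z \<otimes> z \<noteq> z" using l_cancel[OF zG zG one_closed] zG neq by (simp add: r_one)
    ultimately show ?thesis using Z by blast
  qed
  have comm: "z \<otimes> x = x \<otimes> z" if "x \<in> carrier G" for x
    using commutator(2)[OF zG that] central(2)[of z x x] that zG by (simp add: Z r_one m_closed)
  have mid: "(x \<otimes> z) \<otimes> y = x \<otimes> (z \<otimes> y)" and right: "(x \<otimes> y) \<otimes> z = x \<otimes> (y \<otimes> z)"
    if xy: "x \<in> carrier G" "y \<in> carrier G" for x y
  proof -
    have "associator G x z y = \<one>" "associator G x y z = \<one>" using central(3,4) xy Z by simp_all
    then show "(x \<otimes> z) \<otimes> y = x \<otimes> (z \<otimes> y)" "(x \<otimes> y) \<otimes> z = x \<otimes> (y \<otimes> z)"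
      using associator(2)[OF xy(1) zG xy(2)] associator(2)[OF xy zG] xy zG by (metis m_closed r_one)+
  qed
  interpret central_involution G z
  proof
    fix x y assume xy: "x \<in> carrier G" "y \<in> carrier G"
    show "z \<otimes> x = x \<otimes> z" using comm xy by blast
    show "(x \<otimes> z) \<otimes> y = (x \<otimes> y) \<otimes> z" by (simp only: mid[OF xy] right[OF xy] comm[OF xy(2)])
    show "x \<otimes> (y \<otimes> z) = (x \<otimes> y) \<otimes> z" using right[OF xy] by simp
  qed (rule zG neq zz)+
  have V: "comm_group (G Mod {\<one>, z})"
    and V2: "\<And>u. u \<in> carrier (G Mod {\<one>, z}) \<Longrightarrow> u \<otimes>\<^bsub>G Mod {\<one>, z}\<^esub> u = \<one>\<^bsub>G Mod {\<one>, z}\<^esub>"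
    using symp by (simp_all add: symplectic_loop_def elementary_abelian_2_group_def Z del: mult_FactGroup)
  interpret V: comm_group "G Mod {\<one>, z}" by (rule V)
  have q: "range (shift x) \<in> carrier (G Mod {\<one>, z})" if "x \<in> carrier G" for x
    using that by (simp add: z_factor_carrier)
  have C: "to_GF2 G (commutator G x y) = comm_form G x y" if "x \<in> carrier G" "y \<in> carrier G" for x y
    using assms that q[of x] q[of y] z_derived_forms(1)[OF V that that(1)] commutator_map_eq[OF that]
    by (simp add: code_loop_over_def Let_def Z)
  have A: "to_GF2 G (associator G x y w) = assoc_form G x y w"
    if "x \<in> carrier G" "y \<in> carrier G" "w \<in> carrier G" for x y w
    using assms that q[of x] q[of y] q[of w] z_derived_forms(2)[OF V that] associator_map_eq[OF that]
    by (simp add: code_loop_over_def Let_def Z)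
  have "based_code_loop G z"
  proof
    show "finite (carrier G)" using symp by (simp add: symplectic_loop_def)
  next
    fix x assume x: "x \<in> carrier G"
    have "range (shift (x \<otimes> x)) = range (shift \<one>)"
      using V2[OF q[OF x]] z_factor_mult[OF x x] z_factor_one by metis
    then obtain b where "x \<otimes> x = shift \<one> b"
      using range_shift_eqD x m_closed one_closed by metis
    then show "x \<otimes> x = shift \<one> (sq_bit G x)" by (simp add: sq_bit_def to_GF2_shift)
  next
    fix x y assume xy: "x \<in> carrier G" "y \<in> carrier G"
    have "range (shift (x \<otimes> y)) = range (shift (y \<otimes> x))"
      using V.m_comm[OF q[OF xy(1)] q[OF xy(2)]] xy by (simp add: z_factor_mult del: mult_FactGroup)
    then obtain b where b: "x \<otimes> y = shift (y \<otimes> x) b"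
      using range_shift_eqD xy m_closed by metis
    then have "commutator G x y = shift \<one> b"
      using xy by (intro commutator_eqI) (simp_all add: shift_simps)
    then show "x \<otimes> y = shift (y \<otimes> x) (comm_form G x y)"
      using C[OF xy] b by (simp add: to_GF2_shift)
  next
    fix x y w assume xyw: "x \<in> carrier G" "y \<in> carrier G" "w \<in> carrier G"
    have "range (shift ((x \<otimes> y) \<otimes> w)) = range (shift (x \<otimes> (y \<otimes> w)))"
      using V.m_assoc[OF q[OF xyw(1)] q[OF xyw(2)] q[OF xyw(3)]] xyw
      by (simp add: z_factor_mult m_closed del: mult_FactGroup)
    then obtain b where b: "(x \<otimes> y) \<otimes> w = shift (x \<otimes> (y \<otimes> w)) b"
      using range_shift_eqD xyw m_closed by metis
    then have "associator G x y w = shift \<one> b"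
      using xyw by (intro associator_eqI) (simp_all add: shift_simps)
    then show "(x \<otimes> y) \<otimes> w = shift (x \<otimes> (y \<otimes> w)) (assoc_form G x y w)"
      using A[OF xyw] b by (simp add: to_GF2_shift)
  qed
  then show ?thesis using that Z by blast
qed

lemma code_loop_iff: "code_loop G \<longleftrightarrow> (\<exists>z. based_code_loop G z)"
  unfolding code_loop_def using code_loop_over_based based_code_loop.code_loop_over by metis

lemma code_loop_trivial_radical_iff:
  "code_loop_trivial_radical G \<longleftrightarrow> (\<exists>z. based_code_loop G z \<and>
     (\<forall>x\<in>carrier G. (\<forall>y\<in>carrier G. \<forall>w\<in>carrier G. assoc_form G x y w = 0) \<longrightarrow> x \<in> {\<one>\<^bsub>G\<^esub>, z}))"
proof
  assume "code_loop_trivial_radical G"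
  then obtain Z where Z: "code_loop_over G Z" "radical3 (G Mod Z) (power_map G) = {\<one>\<^bsub>G Mod Z\<^esub>}"
    unfolding code_loop_trivial_radical_def by blast
  obtain z where z: "Z = {\<one>\<^bsub>G\<^esub>, z}" "based_code_loop G z" using code_loop_over_based[OF Z(1)] .
  then show "\<exists>z. based_code_loop G z \<and>
     (\<forall>x\<in>carrier G. (\<forall>y\<in>carrier G. \<forall>w\<in>carrier G. assoc_form G x y w = 0) \<longrightarrow> x \<in> {\<one>\<^bsub>G\<^esub>, z})"
    using Z(2) based_code_loop.radical3_trivial_iff[OF z(2)] by blast
next
  assume "\<exists>z. based_code_loop G z \<and>
     (\<forall>x\<in>carrier G. (\<forall>y\<in>carrier G. \<forall>w\<in>carrier G. assoc_form G x y w = 0) \<longrightarrow> x \<in> {\<one>\<^bsub>G\<^esub>, z})"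
  then obtain z where z: "based_code_loop G z"
    and triv: "\<forall>x\<in>carrier G. (\<forall>y\<in>carrier G. \<forall>w\<in>carrier G. assoc_form G x y w = 0) \<longrightarrow> x \<in> {\<one>\<^bsub>G\<^esub>, z}"
    by (elim exE conjE)
  have "radical3 (G Mod {\<one>\<^bsub>G\<^esub>, z}) (power_map G) = {\<one>\<^bsub>G Mod {\<one>\<^bsub>G\<^esub>, z}\<^esub>}"
    by (rule iffD2[OF based_code_loop.radical3_trivial_iff[OF z] triv])
  then show "code_loop_trivial_radical G"
    unfolding code_loop_trivial_radical_def using based_code_loop.code_loop_over[OF z] by blast
qed

section \<open>The constructions as bilinear twists\<close>

context group
begin

lemma ord_involution:
  assumes "x \<in> carrier G" "x \<noteq> \<one>" "x \<otimes> x = \<one>"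
  shows "ord x = 2"
proof -
  have "ord x dvd 2" using assms by (simp add: pow_eq_id[symmetric] numeral_2_eq_2)
  moreover have "ord x \<noteq> 1" using assms ord_eq_1 by simp
  ultimately show ?thesis using prime_nat_iff two_is_prime_nat by blast
qed

lemma generate_involution:
  assumes "x \<in> carrier G" "x \<otimes> x = \<one>"
  shows "generate G {x} = {\<one>, x}"
proof
  have inv: "inv x = x" using assms by (intro inv_equality)
  show "generate G {x} \<subseteq> {\<one>, x}"
  proof
    fix y assume "y \<in> generate G {x}"
    then show "y \<in> {\<one>, x}" by induction (use assms inv in auto)
  qed
  show "{\<one>, x} \<subseteq> generate G {x}" by (auto intro: generate.intros)
qed

lemma iso_C2:
  assumes "carrier G = {\<one>, a}" "a \<noteq> \<one>" "a \<otimes> a = \<one>"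
  shows "G \<cong> C2"
proof (rule is_isoI, rule isoI)
  have a: "a \<in> carrier G" using assms by simp
  let ?f = "\<lambda>x. if x = \<one> then 0 else 1 :: int"
  show "?f \<in> hom G C2"
    using assms a by (auto simp: hom_def carrier_integer_mod_group)
  have "{0..<2} = {0, 1 :: int}" by auto
  then show "bij_betw ?f (carrier G) (carrier C2)"
    using assms by (auto simp: bij_betw_def carrier_integer_mod_group)
qed

end

context comm_group
begin

lemma klein_table:
  assumes "b \<in> carrier G" "c \<in> carrier G" "b \<otimes> b = \<one>" "c \<otimes> c = \<one>"
  shows "(b \<otimes> c) \<otimes> (b \<otimes> c) = \<one>" "(b \<otimes> c) \<otimes> b = c" "(b \<otimes> c) \<otimes> c = b"
    "b \<otimes> (b \<otimes> c) = c" "c \<otimes> (b \<otimes> c) = b"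
proof -
  show 1: "b \<otimes> (b \<otimes> c) = c" using assms by (simp add: m_assoc[symmetric])
  show 2: "c \<otimes> (b \<otimes> c) = b" using assms by (simp add: m_lcomm[of c b c])
  show "(b \<otimes> c) \<otimes> b = c" "(b \<otimes> c) \<otimes> c = b" 
    using assms 1 2 m_comm[of "b \<otimes> c" b] m_comm[of "b \<otimes> c" c] by simp_all
  show "(b \<otimes> c) \<otimes> (b \<otimes> c) = \<one>" using assms by (simp add: m_assoc 2)
qed

lemma iso_V4:
  assumes "b \<in> carrier G" "c \<in> carrier G" "b \<otimes> b = \<one>" "c \<otimes> c = \<one>"
    and carr: "carrier G = {\<one>, b \<otimes> c, b, c}" and "b \<noteq> \<one>" "c \<noteq> \<one>" "b \<otimes> c \<noteq> \<one>"
  shows "G \<cong> V4"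
proof (rule is_isoI, rule isoI)
  note t = klein_table[OF assms(1-4)]
  have ne: "b \<noteq> c" "b \<otimes> c \<noteq> b" "b \<otimes> c \<noteq> c"
    using t(4,5) assms(3,4,6-8) by metis+
  note simps = ne ne[symmetric] assms(6-8) assms(6-8)[symmetric]
  \<comment> \<open>The coordinates are the two characters with kernels \<open>{\<one>, b}\<close>
    and \<open>{\<one>, c}\<close>.\<close>
  let ?f = "\<lambda>x. (if x = \<one> \<or> x = b then 0 else 1 :: int, if x = \<one> \<or> x = c then 0 else 1 :: int)"
  have f: "?f \<one> = (0, 0)" "?f (b \<otimes> c) = (1, 1)" "?f b = (0, 1)" "?f c = (1, 0)"
    by (simp_all add: simps)
  show "?f \<in> hom G V4"
  proof (rule homI)
    fix x y assume xy: "x \<in> carrier G" "y \<in> carrier G"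
    show "?f x \<in> carrier V4" by (simp add: carrier_integer_mod_group)
    have "c \<otimes> b = b \<otimes> c" using assms(1,2) by (simp add: m_comm)
    then show "?f (x \<otimes> y) = ?f x \<otimes>\<^bsub>V4\<^esub> ?f y"
      using xy unfolding carr
      by (elim insertE emptyE) (simp_all add: simps t assms(1-4))
  qed
  have "{0..<2} \<times> {0..<2} = {(0, 0), (1, 1), (0, 1), (1, 0 :: int)} \<union> ({} :: (int \<times> int) set)" by auto
  then have "carrier V4 = {(0, 0), (1, 1), (0, 1), (1, 0)}"
    by (auto simp: carrier_integer_mod_group)
  moreover have "?f ` carrier G = {(0, 0), (1, 1), (0, 1), (1, 0)}"
    unfolding carr by (simp only: image_insert image_empty f)
  moreover have "inj_on ?f (carrier G)"
    unfolding carr by (rule inj_onI, elim insertE emptyE) (simp_all add: simps)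
  ultimately show "bij_betw ?f (carrier G) (carrier V4)" by (simp only: bij_betw_def)
qed

end

section \<open>The two constructions evaluated in a code loop\<close>

context based_code_loop
begin

text \<open>The constructions take \<open>h\<close> from \<open>S\<close>. Once
  \<open>h = z\<close>, the subloop \<open>S\<close> is a union of cosets of the central subloop and
  the theory of saturated sets applies.\<close>

lemma normal_saturated:
  assumes "normal_subloop S G" "z \<in> S"
  shows "mod_z.saturated S"
proof -
  interpret S: loop "G\<lparr>carrier := S\<rparr>" using assms by (simp add: normal_subloop_def subloop_def)
  have sub: "S \<subseteq> carrier G" using assms by (simp add: normal_subloop_def subloop_def)
  have closed: "x \<otimes> y \<in> S" if "x \<in> S" "y \<in> S" for x y using S.m_closed that by simp
  then have "shift x b \<in> S" if "x \<in> S" for x b using that assms by (simp add: shift_def)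
  then show ?thesis using assms sub closed by (auto simp: mod_z.saturated_def)
qed

text \<open>As \<open>z\<close> is its own inverse, the sign \<open>(-1)^r\<close> in the dihedral
  construction has no effect.\<close>

lemma z_int_pow: "z [^] (0::int) = \<one>" "z [^] (1::int) = z" "z [^] (-1::int) = z"
proof -
  have "inv z = z"
    unfolding m_inv_def using z_closed z_z by (intro the_equality) (metis l_cancel)+
  then show "z [^] (0::int) = \<one>" "z [^] (1::int) = z" "z [^] (-1::int) = z"
    by (simp_all add: int_pow_def2 nat_pow_def l_one z_closed)
qed

lemma mem_factor_iff:
  assumes S: "mod_z.saturated S" and "A \<in> carrier (G Mod S)" "x \<in> carrier G"
  shows "x \<in> A \<longleftrightarrow> coset S x = A"
proof -
  obtain a where a: "a \<in> carrier G" "A = coset S a" using assms by (auto simp: factor_carrier[OF S])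
  have "x \<in> A \<longleftrightarrow> a \<otimes> x \<in> S" using a assms by (simp add: coset_def)
  also have "\<dots> \<longleftrightarrow> coset S a = coset S x" using coset_eq_iff[OF S a(1) assms(3)] by simp
  finally show ?thesis using a by auto
qed

text \<open>For \<open>m = 1\<close> the index range is \<open>{0, 1}\<close>, so the index is an
  indicator.\<close>

lemma index_of_1:
  assumes "x \<in> B 0 \<longleftrightarrow> P" "x \<in> B 1 \<longleftrightarrow> \<not> P"
  shows "index_of 1 B x = (if P then 0 else 1)"
proof -
  have "i \<in> index_range 1 \<longleftrightarrow> i = 0 \<or> i = 1" for i by (auto simp: index_range_def)
  then show ?thesis unfolding index_of_def using assms by (intro the_equality) (auto split: if_splits)
qed

text \<open>For \<open>i\<close> and \<open>j\<close> in \<open>{0, 1}\<close> these values say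
  \<open>\<sigma>(i + j) = i j\<close>, which is where the product of two functionals comes
  from.\<close>

lemma sigma_1: "sigma 1 0 = 0" "sigma 1 1 = 0" "sigma 1 2 = 1"
  by (simp_all add: sigma_def)

definition indicator_functional :: "'a set \<Rightarrow> 'a \<Rightarrow> bit" where
  "indicator_functional T x = (if x \<in> T then 0 else 1)"

lemma functional_indicator:
  assumes "\<And>x y. \<lbrakk>x \<in> carrier G; y \<in> carrier G\<rbrakk> \<Longrightarrow> x \<otimes> y \<in> T \<longleftrightarrow> (x \<in> T \<longleftrightarrow> y \<in> T)" "z \<in> T"
  shows "functional (indicator_functional T)"
  using assms by (auto simp: functional_def indicator_functional_def)

lemma cyclic_construction_twist:
  assumes C: "condition_C m G S \<alpha> z"
  shows "G Mod S \<cong> C2" and "functional (indicator_functional S)"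
    and "\<And>x y. \<lbrakk>x \<in> carrier G; y \<in> carrier G\<rbrakk> \<Longrightarrow> x \<otimes>\<^bsub>cyclic_construction m G S \<alpha> z\<^esub> y
      = shift (x \<otimes> y) (indicator_functional S x * indicator_functional S y)"
proof -
  have S: "mod_z.saturated S" using C normal_saturated by (simp add: condition_C_def)
  let ?K = "G Mod S"
  interpret K: comm_group ?K by (rule factor_comm_group[OF S])
  have \<alpha>: "\<alpha> \<in> carrier ?K" using C unfolding condition_C_def by blast
  have \<alpha>\<alpha>: "\<alpha> \<otimes>\<^bsub>?K\<^esub> \<alpha> = \<one>\<^bsub>?K\<^esub>" by (rule factor_sq[OF S \<alpha>])
  have carr: "carrier ?K = {\<one>\<^bsub>?K\<^esub>, \<alpha>}"
    using C K.generate_involution[OF \<alpha> \<alpha>\<alpha>] by (simp add: condition_C_def)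
  have "order ?K = 2 * m" "m \<ge> 1" using C unfolding condition_C_def by blast+
  then have "2 * m = card {\<one>\<^bsub>?K\<^esub>, \<alpha>}" "m \<ge> 1" by (simp_all only: order_def carr)
  \<comment> \<open>An element of square one generates at most two elements, while the order is
    \<open>2 * m\<close>.\<close>
  then have m: "m = 1" and ne: "\<alpha> \<noteq> \<one>\<^bsub>?K\<^esub>" by (auto simp: card_insert_if split: if_splits)
  show "?K \<cong> C2" by (rule K.iso_C2[OF carr ne \<alpha>\<alpha>])
  have mem: "x \<in> S \<longleftrightarrow> coset S x = \<one>\<^bsub>?K\<^esub>" "x \<in> \<alpha> \<longleftrightarrow> coset S x = \<alpha>"
    "coset S x = \<one>\<^bsub>?K\<^esub> \<or> coset S x = \<alpha>" if "x \<in> carrier G" for x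
    using mem_factor_iff[OF S K.one_closed that] mem_factor_iff[OF S \<alpha> that] that carr
    by (auto simp: factor_one[OF S] factor_carrier[OF S])
  have hom: "coset S (x \<otimes> y) = coset S x \<otimes>\<^bsub>?K\<^esub> coset S y" if "x \<in> carrier G" "y \<in> carrier G" for x y
    using factor_mult[OF S that] by simp
  show "functional (indicator_functional S)"
  proof (rule functional_indicator)
    fix x y assume xy: "x \<in> carrier G" "y \<in> carrier G"
    show "x \<otimes> y \<in> S \<longleftrightarrow> (x \<in> S \<longleftrightarrow> y \<in> S)"
      using mem(3)[OF xy(1)] mem(3)[OF xy(2)] ne \<alpha> \<alpha>\<alpha>
      unfolding mem(1)[OF m_closed[OF xy]] mem(1)[OF xy(1)] mem(1)[OF xy(2)] hom[OF xy]
      by (elim disjE) (simp_all del: mult_FactGroup one_FactGroup)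
  qed (rule one_z_mem(2)[OF S])
  fix x y assume xy: "x \<in> carrier G" "y \<in> carrier G"
  have idx: "index_of 1 (\<lambda>i. \<alpha> [^]\<^bsub>?K\<^esub> i) u = (if u \<in> S then 0 else 1)" if "u \<in> carrier G" for u
  proof (rule index_of_1)
    show "u \<in> \<alpha> [^]\<^bsub>?K\<^esub> (0::int) \<longleftrightarrow> u \<in> S" by (simp add: int_pow_0)
    show "u \<in> \<alpha> [^]\<^bsub>?K\<^esub> (1::int) \<longleftrightarrow> u \<notin> S"
      using mem[OF that] ne K.int_pow_1[OF \<alpha>] by auto
  qed
  show "x \<otimes>\<^bsub>cyclic_construction m G S \<alpha> z\<^esub> y
      = shift (x \<otimes> y) (indicator_functional S x * indicator_functional S y)"
    using xy unfolding cyclic_construction_def m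
    by (simp add: Let_def idx indicator_functional_def sigma_1 z_int_pow shift_simps z_shift
        del: One_nat_def)
qed

text \<open>For \<open>m = 1\<close> index zero means \<open>S \<union> e S\<close> for the left
  factor and \<open>S \<union> S f\<close> for the right one, that is
  \<open>S \<union> \<beta>\<close> and \<open>S \<union> \<gamma>\<close>. These are two different
  subgroups of index two, the kernels of the two functionals.\<close>

lemma dihedral_construction_twist:
  assumes D: "condition_D m G S \<beta> \<gamma> z" and e: "e \<in> \<beta>" and f: "f \<in> \<gamma>"
  shows "G Mod S \<cong> V4" and "functional (indicator_functional (S \<union> \<beta>))"
    and "functional (indicator_functional (S \<union> \<gamma>))"
    and "\<And>x y. \<lbrakk>x \<in> carrier G; y \<in> carrier G\<rbrakk> \<Longrightarrow> x \<otimes>\<^bsub>dihedral_construction m G S \<beta> \<gamma> e f z\<^esub> y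
      = shift (x \<otimes> y) (indicator_functional (S \<union> \<beta>) x * indicator_functional (S \<union> \<gamma>) y)"
proof -
  have S: "mod_z.saturated S" using D normal_saturated by (auto simp: condition_D_def Let_def)
  let ?K = "G Mod S"
  interpret K: comm_group ?K by (rule factor_comm_group[OF S])
  define \<alpha> where "\<alpha> = \<beta> \<otimes>\<^bsub>?K\<^esub> \<gamma>"
  have in_K: "\<beta> \<in> carrier ?K" "\<gamma> \<in> carrier ?K" and ne: "\<beta> \<noteq> \<one>\<^bsub>?K\<^esub>" "\<gamma> \<noteq> \<one>\<^bsub>?K\<^esub>"
    using D by (auto simp: condition_D_def involution_def)
  have \<alpha>K: "\<alpha> \<in> carrier ?K" using in_K K.m_closed by (simp only: \<alpha>_def)
  note sq = factor_sq[OF S in_K(1)] factor_sq[OF S in_K(2)]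
  note t = K.klein_table[OF in_K sq, folded \<alpha>_def]
  have "K.ord \<alpha> = 2 * m" "m \<ge> 1" "order ?K = 4 * m"
    using D by (auto simp: condition_D_def Let_def \<alpha>_def dihedral_of_order_def)
  \<comment> \<open>The order \<open>2 * m\<close> of \<alpha> divides the exponent two of the
    factor group, whence \<open>m = 1\<close>.\<close>
  moreover have "K.ord \<alpha> dvd 2" using t(1) \<alpha>K K.pow_eq_id[OF \<alpha>K, of 2]
    by (simp add: numeral_2_eq_2 del: mult_FactGroup one_FactGroup)
  ultimately have m: "m = 1" and ord: "K.ord \<alpha> = 2" and "order ?K = 4"
    using dvd_imp_le[of "2 * m" 2] by auto
  have ne': "\<alpha> \<noteq> \<one>\<^bsub>?K\<^esub>" using ord K.ord_eq_1[OF \<alpha>K] by auto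
  then have ne2: "\<beta> \<noteq> \<gamma>" "\<alpha> \<noteq> \<beta>" "\<alpha> \<noteq> \<gamma>" using ne t sq K.r_one unfolding \<alpha>_def by metis+
  have carr: "carrier ?K = {\<one>\<^bsub>?K\<^esub>, \<alpha>, \<beta>, \<gamma>}"
  proof (rule card_subset_eq[symmetric])
    show "finite (carrier ?K)" using \<open>order ?K = 4\<close> by (simp add: order_def card_ge_0_finite)
    show "{\<one>\<^bsub>?K\<^esub>, \<alpha>, \<beta>, \<gamma>} \<subseteq> carrier ?K" using in_K \<alpha>K K.one_closed by blast
    show "card {\<one>\<^bsub>?K\<^esub>, \<alpha>, \<beta>, \<gamma>} = card (carrier ?K)"
      using \<open>order ?K = 4\<close> ne ne' ne2 by (simp add: order_def del: one_FactGroup)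
  qed
  show "?K \<cong> V4"
    by (rule K.iso_V4[OF in_K sq carr[unfolded \<alpha>_def] ne ne'[unfolded \<alpha>_def]])
  have mem: "x \<in> A \<longleftrightarrow> coset S x = A" if "A \<in> {\<one>\<^bsub>?K\<^esub>, \<alpha>, \<beta>, \<gamma>}" "x \<in> carrier G" for x A
    using mem_factor_iff[OF S, of A x] that carr by (simp only:)
  have four: "coset S x = \<one>\<^bsub>?K\<^esub> \<or> coset S x = \<alpha> \<or> coset S x = \<beta> \<or> coset S x = \<gamma>" if "x \<in> carrier G" for x
  proof -
    have "coset S x \<in> carrier ?K" using that by (simp only: factor_carrier[OF S] imageI)
    then show ?thesis unfolding carr by blast
  qed
  have memS: "x \<in> S \<longleftrightarrow> coset S x = \<one>\<^bsub>?K\<^esub>" if "x \<in> carrier G" for x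
    using mem[of "\<one>\<^bsub>?K\<^esub>" x] that by (simp add: factor_one[OF S])
  have hom: "coset S (x \<otimes> y) = coset S x \<otimes>\<^bsub>?K\<^esub> coset S y" if "x \<in> carrier G" "y \<in> carrier G" for x y
    using factor_mult[OF S that] by simp
  have "\<gamma> \<otimes>\<^bsub>?K\<^esub> \<beta> = \<alpha>" using in_K K.m_comm by (simp only: \<alpha>_def)
  note table = t sq this \<alpha>_def[symmetric] K.l_one K.r_one
  have mult_iff: "x \<otimes> y \<in> S \<union> A \<longleftrightarrow> (x \<in> S \<union> A \<longleftrightarrow> y \<in> S \<union> A)"
    if A: "A = \<beta> \<or> A = \<gamma>" and xy: "x \<in> carrier G" "y \<in> carrier G" for A x y
  proof -
    have "u \<in> S \<union> A \<longleftrightarrow> coset S u = \<one>\<^bsub>?K\<^esub> \<or> coset S u = A" if "u \<in> carrier G" for u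
      using memS[OF that] mem[of A u] that A by blast
    note r = this[OF xy(1)] this[OF xy(2)] this[OF m_closed[OF xy]]
    show ?thesis
      using A four[OF xy(1)] four[OF xy(2)] ne ne' ne2
      unfolding r hom[OF xy]
      by (elim disjE) (simp_all add: table in_K \<alpha>K del: mult_FactGroup one_FactGroup)
  qed
  show f1: "functional (indicator_functional (S \<union> \<beta>))"
    and f2: "functional (indicator_functional (S \<union> \<gamma>))"
    using mult_iff one_z_mem(2)[OF S] by (auto intro!: functional_indicator)
  have ef: "e \<in> carrier G" "coset S e = \<beta>" "f \<in> carrier G" "coset S f = \<gamma>"
  proof -
    have "\<beta> \<subseteq> carrier G" "\<gamma> \<subseteq> carrier G" using in_K by (auto simp: factor_carrier[OF S] coset_def)
    then show "e \<in> carrier G" "f \<in> carrier G" using e f by auto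
    then show "coset S e = \<beta>" "coset S f = \<gamma>" using e f mem by blast+
  qed
  obtain a where a: "a \<in> carrier G" "\<alpha> = coset S a" using \<alpha>K by (auto simp: factor_carrier[OF S])
  have e\<alpha>: "e <# S = \<beta>" "e <# \<alpha> = \<gamma>" and f\<alpha>: "S #> f = \<gamma>" "\<alpha> #> f = \<beta>"
    using ef a t coset_l_coset[OF S ef(1) a(1)] coset_r_coset[OF S a(1) ef(3)] hom[OF ef(1) a(1)] hom[OF a(1) ef(3)]
    by (simp_all add: l_coset_eq[OF S] r_coset_eq[OF S] del: mult_FactGroup)
  have pow: "\<alpha> [^]\<^bsub>?K\<^esub> (0::int) = S" "\<alpha> [^]\<^bsub>?K\<^esub> (1::int) = \<alpha>"
    using \<alpha>K K.int_pow_1 by (simp_all add: int_pow_0)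
  have idx: "index_of 1 (\<lambda>i. (\<alpha> [^]\<^bsub>?K\<^esub> i) \<union> (e <# (\<alpha> [^]\<^bsub>?K\<^esub> i))) u = (if u \<in> S \<union> \<beta> then 0 else 1)"
    "index_of 1 (\<lambda>i. (\<alpha> [^]\<^bsub>?K\<^esub> i) \<union> ((\<alpha> [^]\<^bsub>?K\<^esub> i) #> f)) u = (if u \<in> S \<union> \<gamma> then 0 else 1)"
    if u: "u \<in> carrier G" for u
  proof -
    have r: "u \<in> \<alpha> \<longleftrightarrow> coset S u = \<alpha>" "u \<in> \<beta> \<longleftrightarrow> coset S u = \<beta>" "u \<in> \<gamma> \<longleftrightarrow> coset S u = \<gamma>"
      using mem[of \<alpha> u] mem[of \<beta> u] mem[of \<gamma> u] u by blast+
    have "u \<in> \<alpha> \<union> \<gamma> \<longleftrightarrow> u \<notin> S \<union> \<beta>" "u \<in> \<alpha> \<union> \<beta> \<longleftrightarrow> u \<notin> S \<union> \<gamma>"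
      using four[OF u] ne ne' ne2 unfolding Un_iff memS[OF u] r by metis+
    then show "index_of 1 (\<lambda>i. (\<alpha> [^]\<^bsub>?K\<^esub> i) \<union> (e <# (\<alpha> [^]\<^bsub>?K\<^esub> i))) u = (if u \<in> S \<union> \<beta> then 0 else 1)"
      "index_of 1 (\<lambda>i. (\<alpha> [^]\<^bsub>?K\<^esub> i) \<union> ((\<alpha> [^]\<^bsub>?K\<^esub> i) #> f)) u = (if u \<in> S \<union> \<gamma> then 0 else 1)"
      by (intro index_of_1; simp only: pow e\<alpha> f\<alpha>)+
  qed
  fix x y assume xy: "x \<in> carrier G" "y \<in> carrier G"
  show "x \<otimes>\<^bsub>dihedral_construction m G S \<beta> \<gamma> e f z\<^esub> y
      = shift (x \<otimes> y) (indicator_functional (S \<union> \<beta>) x * indicator_functional (S \<union> \<gamma>) y)"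
    using xy unfolding dihedral_construction_def m \<alpha>_def[symmetric] Let_def
    by (simp add: idx indicator_functional_def sigma_1 z_int_pow shift_simps z_shift
        del: Un_iff One_nat_def)
qed

end

section \<open>Invariance of trivial radical and of associators\<close>

context based_code_loop
begin

lemma nucleus_eq:
  "nucleus G = {x \<in> carrier G. \<forall>y\<in>carrier G. \<forall>w\<in>carrier G. assoc_form G x y w = 0}"
  by (auto simp: nucleus_def associator_eq shift_eq_one_iff)

text \<open>The twist changes neither associator exponents nor multiplication by \<open>z\<close>,
  so the identity map is an equivalence of associators.\<close>

lemma twist_code_loop:
  fixes H :: "('a, 'c) monoid_scheme"
  assumes triv: "\<forall>x\<in>carrier G. (\<forall>y\<in>carrier G. \<forall>w\<in>carrier G. assoc_form G x y w = 0) \<longrightarrow> x \<in> {\<one>, z}"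
    and "functional l" "functional m"
    and carr: "carrier H = carrier G" and one: "\<one>\<^bsub>H\<^esub> = \<one>"
    and "\<And>x y. \<lbrakk>x \<in> carrier G; y \<in> carrier G\<rbrakk> \<Longrightarrow> x \<otimes>\<^bsub>H\<^esub> y = shift (x \<otimes> y) (l x * m y)"
  shows "code_loop_trivial_radical H \<and> equivalent_associators G H"
proof
  note tw = twist[OF assms(2-)]
  interpret H: based_code_loop H z by (rule tw(1))
  show "code_loop_trivial_radical H"
    unfolding code_loop_trivial_radical_iff
    using triv tw(1) by (intro exI[of _ z]) (simp add: carr one tw(4))
  show "equivalent_associators G H"
    unfolding equivalent_associators_def
    using carr one by (intro exI[of _ id]) (simp add: associator_eq H.associator_eq tw(2,4) one_closed)
qed

end

text \<open>A central \<open>h\<close> is nuclear, and trivial radical means that the nucleus is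
  \<open>{1, z}\<close>; so \<open>h = z\<close>. Condition (D) puts \<open>h\<close> into the
  nucleus directly.\<close>

lemma cyclic_construction_code_loop:
  assumes G: "code_loop_trivial_radical G" and C: "condition_C m G S \<alpha> h"
  shows "G Mod S \<cong> C2 \<and> code_loop_trivial_radical (cyclic_construction m G S \<alpha> h) \<and>
    equivalent_associators G (cyclic_construction m G S \<alpha> h)"
proof -
  obtain z where z: "based_code_loop G z" and triv: "\<forall>x\<in>carrier G.
      (\<forall>y\<in>carrier G. \<forall>w\<in>carrier G. assoc_form G x y w = 0) \<longrightarrow> x \<in> {\<one>\<^bsub>G\<^esub>, z}"
    using G unfolding code_loop_trivial_radical_iff by (elim exE conjE)
  interpret based_code_loop G z by (rule z)
  have "h \<in> nucleus G" using C by (auto simp: condition_C_def moufang_center_def nucleus_def)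
  then have "h \<in> {\<one>\<^bsub>G\<^esub>, z}" using triv unfolding nucleus_eq by blast
  then have h: "h = z" using C by (simp add: condition_C_def)
  note tw = cyclic_construction_twist[OF C[unfolded h]]
  show ?thesis
    unfolding h using tw(1) twist_code_loop[OF triv tw(2) tw(2) _ _ tw(3)]
    by (simp add: cyclic_construction_def)
qed

lemma dihedral_construction_code_loop:
  assumes G: "code_loop_trivial_radical G" and D: "condition_D m G S \<beta> \<gamma> h"
    and e: "e \<in> \<beta>" and f: "f \<in> \<gamma>"
  shows "G Mod S \<cong> V4 \<and> code_loop_trivial_radical (dihedral_construction m G S \<beta> \<gamma> e f h) \<and>
    equivalent_associators G (dihedral_construction m G S \<beta> \<gamma> e f h)"
proof -
  obtain z where z: "based_code_loop G z" and triv: "\<forall>x\<in>carrier G.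
      (\<forall>y\<in>carrier G. \<forall>w\<in>carrier G. assoc_form G x y w = 0) \<longrightarrow> x \<in> {\<one>\<^bsub>G\<^esub>, z}"
    using G unfolding code_loop_trivial_radical_iff by (elim exE conjE)
  interpret based_code_loop G z by (rule z)
  have "h \<in> nucleus G" "h \<noteq> \<one>\<^bsub>G\<^esub>" using D by (auto simp: condition_D_def Let_def)
  then have h: "h = z" using triv unfolding nucleus_eq by blast
  note tw = dihedral_construction_twist[OF D[unfolded h] e f]
  show ?thesis
    unfolding h using tw(1) twist_code_loop[OF triv tw(2) tw(3) _ _ tw(4)]
    by (simp add: dihedral_construction_def)
qed

text \<open>The type of \<open>G Mod S\<close> is proved for chosen \<open>e\<close> and
  \<open>f\<close> but claimed without them, so such representatives must exist.\<close>

lemma condition_D_nonempty: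
  assumes "condition_D m G S \<beta> \<gamma> h"
  shows "\<beta> \<noteq> {}" "\<gamma> \<noteq> {}"
proof -
  have S: "normal_subloop S G" and mem: "\<beta> \<in> rcosets\<^bsub>G\<^esub> S" "\<gamma> \<in> rcosets\<^bsub>G\<^esub> S"
    using assms by (auto simp: condition_D_def involution_def FactGroup_def)
  interpret S: loop "G\<lparr>carrier := S\<rparr>" using S by (simp add: normal_subloop_def subloop_def)
  have "S \<noteq> {}" using S.one_closed by auto
  then show "\<beta> \<noteq> {}" "\<gamma> \<noteq> {}" using mem by (auto simp: RCOSETS_def r_coset_def)
qed

section \<open>Moufang loops with the associator of a code loop\<close>

text \<open>Conjugating left multiplication by \<open>h\<close> with left multiplication by
  \<open>x\<close> gives, by the Moufang identity, left multiplication by a nuclear element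
  \<open>k\<close> with \<open>k x = x h\<close>. Since \<open>k\<close> is not the unit and the
  nucleus is \<open>{1, h}\<close>, it must be \<open>h\<close>.\<close>

lemma (in moufang_loop) nuclear_involution_commutes:
  assumes h: "h \<in> carrier G" "h \<noteq> \<one>" and x: "x \<in> carrier G"
    and h_nuc: "\<And>y w. \<lbrakk>y \<in> carrier G; w \<in> carrier G\<rbrakk> \<Longrightarrow> (h \<otimes> y) \<otimes> w = h \<otimes> (y \<otimes> w)"
    and nuc: "\<And>k. \<lbrakk>k \<in> carrier G; \<And>y w. \<lbrakk>y \<in> carrier G; w \<in> carrier G\<rbrakk> \<Longrightarrow> (k \<otimes> y) \<otimes> w = k \<otimes> (y \<otimes> w)\<rbrakk>
      \<Longrightarrow> k \<in> {\<one>, h}"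
  shows "h \<otimes> x = x \<otimes> h"
proof -
  define d where "d u = (THE v. v \<in> carrier G \<and> x \<otimes> v = u)" for u
  have d: "d (x \<otimes> v) = v" if "v \<in> carrier G" for v
    unfolding d_def using that x by (intro the_equality) (auto simp: l_cancel)
  have dc: "d u \<in> carrier G" if "u \<in> carrier G" for u
    unfolding d_def using theI'[OF l_div[OF x that]] by blast
  \<comment> \<open>\<open>g\<close> is left multiplication by \<open>h\<close> conjugated by \<open>x\<close>; it will be left multiplication by a nuclear element.\<close>
  define g where "g u = x \<otimes> (h \<otimes> d u)" for u
  have g_mult: "g (y \<otimes> w) = g y \<otimes> w" if yw: "y \<in> carrier G" "w \<in> carrier G" for y w
  proof -
    \<comment> \<open>The form \<open>y = (x u) x\<close> makes \<open>y w\<close> the left-hand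
      side of the Moufang identity.\<close>
    obtain t where t: "t \<in> carrier G" "t \<otimes> x = y" using r_div[OF x yw(1)] by blast
    obtain u where u: "u \<in> carrier G" "x \<otimes> u = t" using l_div[OF x t(1)] by blast
    have flex: "(x \<otimes> v) \<otimes> x = x \<otimes> (v \<otimes> x)" if "v \<in> carrier G" for v
      using moufang[OF x that one_closed] x that by (simp add: r_one m_closed)
    have y: "y = (x \<otimes> u) \<otimes> x" using t u by simp
    have "g (y \<otimes> w) = x \<otimes> ((h \<otimes> u) \<otimes> (x \<otimes> w))"
      using x u(1) yw h by (simp add: y g_def moufang d m_closed h_nuc)
    also have "\<dots> = ((x \<otimes> (h \<otimes> u)) \<otimes> x) \<otimes> w"
      using x u(1) yw h by (simp add: moufang m_closed)
    also have "\<dots> = g y \<otimes> w"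
      using x u(1) h by (simp add: y flex g_def d m_closed h_nuc)
    finally show ?thesis .
  qed
  have gc: "g u \<in> carrier G" if "u \<in> carrier G" for u
    using that x h dc by (simp add: g_def m_closed)
  have g_eq: "g w = g \<one> \<otimes> w" if "w \<in> carrier G" for w
    using g_mult[OF one_closed that] that by (simp add: l_one)
  have "(g \<one> \<otimes> y) \<otimes> w = g \<one> \<otimes> (y \<otimes> w)" if "y \<in> carrier G" "w \<in> carrier G" for y w
    using g_mult[OF that] g_eq[OF that(1)] g_eq[OF m_closed[OF that]] by simp
  then have k: "g \<one> \<in> {\<one>, h}" using nuc gc one_closed by blast
  have gx: "g x = x \<otimes> h"
    using d[OF one_closed] x h by (simp add: g_def r_one)
  moreover have "g \<one> \<noteq> \<one>"
  proof
    assume "g \<one> = \<one>"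
    then have "x \<otimes> h = x \<otimes> \<one>" using gx g_eq[OF x] x by (simp add: l_one r_one)
    then show False using l_cancel[OF x h(1) one_closed] h by simp
  qed
  ultimately show ?thesis using k g_eq[OF x] by auto
qed

lemma moufang_equivalent_code_loop:
  fixes L :: "('a, 'c) monoid_scheme" and G :: "('b, 'd) monoid_scheme"
  assumes "moufang_loop L" and G: "code_loop_trivial_radical G" and "equivalent_associators L G"
  shows "code_loop_trivial_radical L"
proof -
  obtain z where z: "based_code_loop G z" and triv: "\<forall>x\<in>carrier G.
      (\<forall>y\<in>carrier G. \<forall>w\<in>carrier G. assoc_form G x y w = 0) \<longrightarrow> x \<in> {\<one>\<^bsub>G\<^esub>, z}"
    using G unfolding code_loop_trivial_radical_iff by (elim exE conjE)
  obtain f where bij: "bij_betw f (carrier L) (carrier G)"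
    and f: "\<And>x y w. \<lbrakk>x \<in> carrier L; y \<in> carrier L; w \<in> carrier L\<rbrakk>
      \<Longrightarrow> f (associator L x y w) = associator G (f x) (f y) (f w)"
    using assms(3) unfolding equivalent_associators_def by blast
  interpret G: based_code_loop G z by (rule z)
  interpret L: moufang_loop L by fact
  have fc: "f x \<in> carrier G" if "x \<in> carrier L" for x using bij that bij_betwE by blast
  have inj: "x = y" if "f x = f y" "x \<in> carrier L" "y \<in> carrier L" for x y
    using bij that by (meson bij_betw_imp_inj_on inj_onD)
  have surj: "\<exists>x\<in>carrier L. f x = y" if "y \<in> carrier G" for y
    using bij that by (metis bij_betw_imp_surj_on imageE)
  define a where "a x y w = assoc_form G (f x) (f y) (f w)" for x y w
  have a_swap1: "a x y w = a y x w" and a_swap2: "a x y w = a x w y"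
    if "x \<in> carrier L" "y \<in> carrier L" "w \<in> carrier L" for x y w
    unfolding a_def using G.assoc_form_swap12[of "f x" "f y" "f w"] G.assoc_form_swap23[of "f x" "f y" "f w"]
      fc that by simp_all
  note a_swap = a_swap1 a_swap2
  have a_same: "a x x y = 0" "a x y x = 0" "a y x x = 0" if "x \<in> carrier L" "y \<in> carrier L" for x y
    using that by (simp_all add: a_def fc)
  have fa: "f (associator L x y w) = G.shift \<one>\<^bsub>G\<^esub> (a x y w)"
    if "x \<in> carrier L" "y \<in> carrier L" "w \<in> carrier L" for x y w
    using that by (simp add: f a_def G.associator_eq fc)
  \<comment> \<open>The unit is the associator of three units. This is how \<open>f\<close>, which
    respects only associators, is seen to preserve it.\<close>
  have "associator L \<one>\<^bsub>L\<^esub> \<one>\<^bsub>L\<^esub> \<one>\<^bsub>L\<^esub> = \<one>\<^bsub>L\<^esub>"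
    by (rule L.associator_eqI) (simp_all add: L.loop_simps)
  then have f1: "f \<one>\<^bsub>L\<^esub> = \<one>\<^bsub>G\<^esub>"
    using fa[of "\<one>\<^bsub>L\<^esub>" "\<one>\<^bsub>L\<^esub>" "\<one>\<^bsub>L\<^esub>"] a_same by (simp add: L.one_closed G.shift_0)
  obtain h where h: "h \<in> carrier L" "f h = z" using surj[OF G.z_closed] by blast
  have h1: "h \<noteq> \<one>\<^bsub>L\<^esub>" using h f1 G.z_neq_one by auto
  have assoc_eq: "associator L x y w = (if a x y w = 0 then \<one>\<^bsub>L\<^esub> else h)"
    if "x \<in> carrier L" "y \<in> carrier L" "w \<in> carrier L" for x y w
    using that fa[OF that] f1 h by (intro inj) (simp_all add: L.associator L.one_closed G.shift_simps)
  have a0_iff: "a x y w = 0 \<longleftrightarrow> (x \<otimes>\<^bsub>L\<^esub> y) \<otimes>\<^bsub>L\<^esub> w = x \<otimes>\<^bsub>L\<^esub> (y \<otimes>\<^bsub>L\<^esub> w)"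
    if "x \<in> carrier L" "y \<in> carrier L" "w \<in> carrier L" for x y w
  proof
    assume "a x y w = 0"
    then show "(x \<otimes>\<^bsub>L\<^esub> y) \<otimes>\<^bsub>L\<^esub> w = x \<otimes>\<^bsub>L\<^esub> (y \<otimes>\<^bsub>L\<^esub> w)"
      using L.associator(2)[OF that] that by (simp add: assoc_eq L.r_one L.m_closed)
  next
    assume "(x \<otimes>\<^bsub>L\<^esub> y) \<otimes>\<^bsub>L\<^esub> w = x \<otimes>\<^bsub>L\<^esub> (y \<otimes>\<^bsub>L\<^esub> w)"
    then have "associator L x y w = \<one>\<^bsub>L\<^esub>"
      using that by (intro L.associator_eqI) (simp_all add: L.loop_simps)
    then show "a x y w = 0" using assoc_eq[OF that] h1 by (simp split: if_splits)
  qed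
  have nuc_iff: "(\<forall>y\<in>carrier L. \<forall>w\<in>carrier L. a x y w = 0) \<longleftrightarrow> x \<in> {\<one>\<^bsub>L\<^esub>, h}" if x: "x \<in> carrier L" for x
  proof
    assume *: "\<forall>y\<in>carrier L. \<forall>w\<in>carrier L. a x y w = 0"
    have "assoc_form G (f x) y w = 0" if "y \<in> carrier G" "w \<in> carrier G" for y w
      using * surj[OF that(1)] surj[OF that(2)] by (auto simp: a_def)
    then have "f x \<in> {\<one>\<^bsub>G\<^esub>, z}" using triv fc[OF x] by blast
    then show "x \<in> {\<one>\<^bsub>L\<^esub>, h}" using inj[of x h] inj[of x "\<one>\<^bsub>L\<^esub>"] f1 h x L.one_closed by auto
  next
    have "a \<one>\<^bsub>L\<^esub> y w = 0" "a h y w = 0" if "y \<in> carrier L" "w \<in> carrier L" for y w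
      using that by (simp_all add: a_def f1 h(2) fc)
    then show "\<forall>y\<in>carrier L. \<forall>w\<in>carrier L. a x y w = 0" if "x \<in> {\<one>\<^bsub>L\<^esub>, h}" using that by blast
  qed
  have ah: "a h y w = 0" "a y h w = 0" "a y w h = 0" if "y \<in> carrier L" "w \<in> carrier L" for y w
  proof -
    show 1: "a h y w = 0" using nuc_iff[OF h(1)] that by blast
    show "a y h w = 0" using a_swap(1)[of y h w] 1 h that by simp
    have "a h w y = 0" using nuc_iff[OF h(1)] that by blast
    then show "a y w h = 0" using a_swap(1)[of h w y] a_swap(2)[of h w y] a_swap(1)[of y h w] a_swap(2)[of y h w] h that
      by simp
  qed
  have h_l: "(h \<otimes>\<^bsub>L\<^esub> y) \<otimes>\<^bsub>L\<^esub> w = h \<otimes>\<^bsub>L\<^esub> (y \<otimes>\<^bsub>L\<^esub> w)"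
    and h_m: "(y \<otimes>\<^bsub>L\<^esub> h) \<otimes>\<^bsub>L\<^esub> w = y \<otimes>\<^bsub>L\<^esub> (h \<otimes>\<^bsub>L\<^esub> w)"
    and h_r: "(y \<otimes>\<^bsub>L\<^esub> w) \<otimes>\<^bsub>L\<^esub> h = y \<otimes>\<^bsub>L\<^esub> (w \<otimes>\<^bsub>L\<^esub> h)"
    if "y \<in> carrier L" "w \<in> carrier L" for y w
    using a0_iff[OF h(1) that] a0_iff[OF that(1) h(1) that(2)] a0_iff[OF that h(1)] ah[OF that] by simp_all
  have h_comm: "h \<otimes>\<^bsub>L\<^esub> x = x \<otimes>\<^bsub>L\<^esub> h" if "x \<in> carrier L" for x
  proof (rule L.nuclear_involution_commutes[OF h(1) h1 that h_l])
    fix k assume "k \<in> carrier L" and "\<And>y w. \<lbrakk>y \<in> carrier L; w \<in> carrier L\<rbrakk>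
      \<Longrightarrow> (k \<otimes>\<^bsub>L\<^esub> y) \<otimes>\<^bsub>L\<^esub> w = k \<otimes>\<^bsub>L\<^esub> (y \<otimes>\<^bsub>L\<^esub> w)"
    then show "k \<in> {\<one>\<^bsub>L\<^esub>, h}" using nuc_iff a0_iff by blast
  qed
  have hh: "h \<otimes>\<^bsub>L\<^esub> h = \<one>\<^bsub>L\<^esub>"
  proof -
    have "a (h \<otimes>\<^bsub>L\<^esub> h) y w = 0" if "y \<in> carrier L" "w \<in> carrier L" for y w
      using that h by (subst a0_iff) (simp_all add: L.m_closed h_l)
    then have "h \<otimes>\<^bsub>L\<^esub> h \<in> {\<one>\<^bsub>L\<^esub>, h}" using nuc_iff[OF L.m_closed[OF h(1) h(1)]] by blast
    moreover have "h \<otimes>\<^bsub>L\<^esub> h \<noteq> h \<otimes>\<^bsub>L\<^esub> \<one>\<^bsub>L\<^esub>" using L.l_cancel[OF h(1) h(1) L.one_closed] h1 by simp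
    ultimately show ?thesis using h by (simp add: L.r_one)
  qed
  interpret L: central_involution L h
  proof
    fix x y assume xy: "x \<in> carrier L" "y \<in> carrier L"
    show "h \<otimes>\<^bsub>L\<^esub> x = x \<otimes>\<^bsub>L\<^esub> h" using h_comm xy by blast
    show "(x \<otimes>\<^bsub>L\<^esub> h) \<otimes>\<^bsub>L\<^esub> y = (x \<otimes>\<^bsub>L\<^esub> y) \<otimes>\<^bsub>L\<^esub> h" by (simp only: h_m[OF xy] h_r[OF xy] h_comm[OF xy(2)])
    show "x \<otimes>\<^bsub>L\<^esub> (y \<otimes>\<^bsub>L\<^esub> h) = (x \<otimes>\<^bsub>L\<^esub> y) \<otimes>\<^bsub>L\<^esub> h" using h_r[OF xy] by simp
  qed (rule h(1) h1 hh)+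
  have assoc: "(x \<otimes>\<^bsub>L\<^esub> y) \<otimes>\<^bsub>L\<^esub> w = L.shift (x \<otimes>\<^bsub>L\<^esub> (y \<otimes>\<^bsub>L\<^esub> w)) (a x y w)"
    if "x \<in> carrier L" "y \<in> carrier L" "w \<in> carrier L" for x y w
    using L.associator(2)[OF that] that by (simp add: assoc_eq L.shift_def L.r_one L.m_closed split: if_splits)
  have a_add: "a (x \<otimes>\<^bsub>L\<^esub> y) u w = a x u w + a y u w"
    if "x \<in> carrier L" "y \<in> carrier L" "u \<in> carrier L" "w \<in> carrier L" for x y u w
    using L.symmetric_associator_additive[of a, OF assoc a_swap that] .
  have a_add2: "a u (x \<otimes>\<^bsub>L\<^esub> y) w = a u x w + a u y w" "a u w (x \<otimes>\<^bsub>L\<^esub> y) = a u w x + a u w y"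
    if "x \<in> carrier L" "y \<in> carrier L" "u \<in> carrier L" "w \<in> carrier L" for x y u w
  proof -
    have "a u v w = a v u w" "a u w v = a v u w" if "v \<in> carrier L" for v
      using \<open>u \<in> carrier L\<close> \<open>w \<in> carrier L\<close> that a_swap by metis+
    then show "a u (x \<otimes>\<^bsub>L\<^esub> y) w = a u x w + a u y w" "a u w (x \<otimes>\<^bsub>L\<^esub> y) = a u w x + a u w y"
      using that a_add by (simp_all add: L.m_closed)
  qed
  have in_Z: "\<exists>b. x = L.shift \<one>\<^bsub>L\<^esub> b" if "x \<in> carrier L" "\<And>y w. \<lbrakk>y \<in> carrier L; w \<in> carrier L\<rbrakk> \<Longrightarrow> a x y w = 0" for x
    using nuc_iff[OF that(1)] that(2) L.shift_one_iff by blast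
  \<comment> \<open>Over GF(2) additivity makes the associators of a square vanish, so the square is
    nuclear.\<close>
  have sq: "x \<otimes>\<^bsub>L\<^esub> x = L.shift \<one>\<^bsub>L\<^esub> (sq_bit L x)" if x: "x \<in> carrier L" for x
  proof -
    obtain b where "x \<otimes>\<^bsub>L\<^esub> x = L.shift \<one>\<^bsub>L\<^esub> b" using in_Z[of "x \<otimes>\<^bsub>L\<^esub> x"] x by (auto simp: a_add L.m_closed)
    then show ?thesis by (simp add: sq_bit_def L.to_GF2_shift)
  qed
  define c where "c x y = to_GF2 L (commutator L x y)" for x y
  have comm: "x \<otimes>\<^bsub>L\<^esub> y = L.shift (y \<otimes>\<^bsub>L\<^esub> x) (c x y)" if xy: "x \<in> carrier L" "y \<in> carrier L" for x y
  proof -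
    note k = L.commutator[OF xy]
    \<comment> \<open>By additivity \<open>x y\<close> and \<open>y x\<close> have the same
      associators, which leaves none for the commutator.\<close>
    have "a (commutator L x y) u w = 0" if "u \<in> carrier L" "w \<in> carrier L" for u w
    proof -
      have "a (x \<otimes>\<^bsub>L\<^esub> y) u w = a (y \<otimes>\<^bsub>L\<^esub> x) u w + a (commutator L x y) u w"
        using k xy that by (metis a_add L.m_closed)
      then show ?thesis using xy that by (simp add: a_add add.commute)
    qed
    then obtain b where b: "commutator L x y = L.shift \<one>\<^bsub>L\<^esub> b" using in_Z[OF k(1)] by blast
    have "x \<otimes>\<^bsub>L\<^esub> y = L.shift (y \<otimes>\<^bsub>L\<^esub> x) b" using k(2) xy unfolding b by (simp add: L.shift_simps)
    then show ?thesis by (simp add: c_def b L.to_GF2_shift)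
  qed
  \<comment> \<open>The form \<open>a\<close> is additive and alternating, so words in
    \<open>x\<close> and \<open>y\<close> may be rebracketed. Then \<open>(x y)(x y)\<close> becomes
    \<open>(x x)(y y)\<close> at the cost of one commutator.\<close>
  have c_eq: "c x y = comm_form L x y" if xy: "x \<in> carrier L" "y \<in> carrier L" for x y
  proof -
    have yx: "y \<otimes>\<^bsub>L\<^esub> x = L.shift (x \<otimes>\<^bsub>L\<^esub> y) (c x y)"
      using comm[OF xy] L.shift_eq_swap xy L.m_closed by metis
    have "(y \<otimes>\<^bsub>L\<^esub> x) \<otimes>\<^bsub>L\<^esub> y = L.shift (x \<otimes>\<^bsub>L\<^esub> (y \<otimes>\<^bsub>L\<^esub> y)) (c x y)"
      unfolding yx using xy by (simp add: L.shift_simps assoc a_same)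
    then have y: "y \<otimes>\<^bsub>L\<^esub> (x \<otimes>\<^bsub>L\<^esub> y) = L.shift (x \<otimes>\<^bsub>L\<^esub> (y \<otimes>\<^bsub>L\<^esub> y)) (c x y)"
      using assoc[of y x y] xy by (simp add: a_same L.shift_0)
    have "x \<otimes>\<^bsub>L\<^esub> (x \<otimes>\<^bsub>L\<^esub> (y \<otimes>\<^bsub>L\<^esub> y)) = (x \<otimes>\<^bsub>L\<^esub> x) \<otimes>\<^bsub>L\<^esub> (y \<otimes>\<^bsub>L\<^esub> y)"
      using assoc[of x x "y \<otimes>\<^bsub>L\<^esub> y"] xy by (simp add: a_same L.shift_0 L.m_closed)
    also have "\<dots> = L.shift \<one>\<^bsub>L\<^esub> (sq_bit L x + sq_bit L y)"
      using xy by (simp add: sq L.shift_simps)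
    finally have xx: "x \<otimes>\<^bsub>L\<^esub> (x \<otimes>\<^bsub>L\<^esub> (y \<otimes>\<^bsub>L\<^esub> y)) = L.shift \<one>\<^bsub>L\<^esub> (sq_bit L x + sq_bit L y)" .
    have "(x \<otimes>\<^bsub>L\<^esub> y) \<otimes>\<^bsub>L\<^esub> (x \<otimes>\<^bsub>L\<^esub> y) = x \<otimes>\<^bsub>L\<^esub> (y \<otimes>\<^bsub>L\<^esub> (x \<otimes>\<^bsub>L\<^esub> y))"
      using assoc[of x y "x \<otimes>\<^bsub>L\<^esub> y"] xy by (simp add: a_same a_add2 L.shift_0 L.m_closed)
    also have "\<dots> = L.shift \<one>\<^bsub>L\<^esub> (sq_bit L x + sq_bit L y + c x y)"
      unfolding y using xy by (simp add: L.shift_mult_right L.m_closed xx L.shift_shift L.one_closed)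
    finally have "sq_bit L (x \<otimes>\<^bsub>L\<^esub> y) = sq_bit L x + sq_bit L y + c x y"
      by (simp add: sq_bit_def[of L "x \<otimes>\<^bsub>L\<^esub> y"] L.to_GF2_shift)
    then show ?thesis by (simp add: comm_form_def ac_simps)
  qed
  \<comment> \<open>Moving \<open>w\<close> to the front of \<open>(x y) w\<close> in one go costs
    \<open>c (x y) w\<close>. Moving it past \<open>y\<close> and then past \<open>x\<close> costs
    two commutators and three equal associators, of which one survives modulo two.\<close>
  have a_eq: "a x y w = assoc_form L x y w" if xyw: "x \<in> carrier L" "y \<in> carrier L" "w \<in> carrier L" for x y w
  proof -
    have "a w x y = a x y w" "a x w y = a x y w" using a_swap xyw by metis+
    note a = this
    have "(x \<otimes>\<^bsub>L\<^esub> y) \<otimes>\<^bsub>L\<^esub> w = L.shift (x \<otimes>\<^bsub>L\<^esub> (y \<otimes>\<^bsub>L\<^esub> w)) (a x y w)" by (rule assoc[OF xyw])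
    also have "x \<otimes>\<^bsub>L\<^esub> (y \<otimes>\<^bsub>L\<^esub> w) = L.shift (x \<otimes>\<^bsub>L\<^esub> (w \<otimes>\<^bsub>L\<^esub> y)) (c y w)"
      using xyw by (subst comm[of y w]) (simp_all add: L.shift_simps)
    also have "x \<otimes>\<^bsub>L\<^esub> (w \<otimes>\<^bsub>L\<^esub> y) = L.shift ((x \<otimes>\<^bsub>L\<^esub> w) \<otimes>\<^bsub>L\<^esub> y) (a x y w)"
      using xyw assoc[of x w y] by (simp add: a L.shift_simps)
    also have "(x \<otimes>\<^bsub>L\<^esub> w) \<otimes>\<^bsub>L\<^esub> y = L.shift ((w \<otimes>\<^bsub>L\<^esub> x) \<otimes>\<^bsub>L\<^esub> y) (c x w)"
      using xyw by (subst comm[of x w]) (simp_all add: L.shift_simps)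
    also have "(w \<otimes>\<^bsub>L\<^esub> x) \<otimes>\<^bsub>L\<^esub> y = L.shift (w \<otimes>\<^bsub>L\<^esub> (x \<otimes>\<^bsub>L\<^esub> y)) (a x y w)"
      using xyw assoc[of w x y] by (simp add: a)
    finally have "L.shift (w \<otimes>\<^bsub>L\<^esub> (x \<otimes>\<^bsub>L\<^esub> y)) (c (x \<otimes>\<^bsub>L\<^esub> y) w)
        = L.shift (w \<otimes>\<^bsub>L\<^esub> (x \<otimes>\<^bsub>L\<^esub> y)) (a x y w + c x w + c y w)"
      using xyw comm[of "x \<otimes>\<^bsub>L\<^esub> y" w] by (simp add: L.shift_simps ac_simps)
    then have "c (x \<otimes>\<^bsub>L\<^esub> y) w = a x y w + c x w + c y w" using xyw by (simp add: L.shift_inject L.m_closed)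
    then show ?thesis using xyw by (simp add: assoc_form_eq c_eq[symmetric] L.m_closed ac_simps)
  qed
  have "based_code_loop L h"
  proof
    show "finite (carrier L)" using bij_betw_finite[OF bij] G.finite_carrier by simp
  next
    fix x y w assume "x \<in> carrier L" "y \<in> carrier L" "w \<in> carrier L"
    then show "x \<otimes>\<^bsub>L\<^esub> y \<otimes>\<^bsub>L\<^esub> w = L.shift (x \<otimes>\<^bsub>L\<^esub> (y \<otimes>\<^bsub>L\<^esub> w)) (assoc_form L x y w)"
      by (simp only: assoc a_eq)
  next
    fix x y assume xy: "x \<in> carrier L" "y \<in> carrier L"
    show "x \<otimes>\<^bsub>L\<^esub> y = L.shift (y \<otimes>\<^bsub>L\<^esub> x) (comm_form L x y)"
      using comm[OF xy] c_eq[OF xy] by argo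
  qed (rule sq)
  then show ?thesis
    unfolding code_loop_trivial_radical_iff using nuc_iff a_eq by (intro exI[of _ h]) simp
qed

section \<open>Realizing quadratic forms by the constructions\<close>

context based_code_loop
begin

lemma z_nucleus: "z \<in> nucleus G"
  by (simp add: nucleus_eq z_closed)

text \<open>Condition (D) speaks of the center of \<open>G_0\<close>, where commutators and
  associators are definite descriptions over a smaller carrier and must be evaluated anew.\<close>

lemma z_moufang_center:
  assumes "A \<subseteq> carrier G" "\<one> \<in> A" "z \<in> A"
  shows "z \<in> moufang_center (G\<lparr>carrier := A\<rparr>)"
proof -
  have "commutator (G\<lparr>carrier := A\<rparr>) z y = \<one>" if y: "y \<in> A" for y
  proof -
    have c: "y \<in> carrier G" using assms y by auto
    show ?thesis
      unfolding commutator_def using assms c z_comm[OF c] l_cancel[of "z \<otimes> y" \<one>]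
      by (intro the_equality) (auto simp: loop_simps z_closed subset_iff)
  qed
  moreover have "associator (G\<lparr>carrier := A\<rparr>) z y w = \<one>" if yw: "y \<in> A" "w \<in> A" for y w
  proof -
    have c: "y \<in> carrier G" "w \<in> carrier G" using assms yw by auto
    have e: "(z \<otimes> y) \<otimes> w = z \<otimes> (y \<otimes> w)" using c by (simp add: shift_simps)
    show ?thesis
      unfolding associator_def using assms c e l_cancel[of "z \<otimes> (y \<otimes> w)" \<one>]
      by (intro the_equality) (auto simp: loop_simps z_closed subset_iff)
  qed
  ultimately show ?thesis using assms by (simp add: moufang_center_def)
qed

text \<open>The subloop \<open>S\<close> of both constructions: of index two when
  \<open>l = m\<close> is nonzero, of index four when the functionals are independent.\<close>

definition joint_kernel :: "('a \<Rightarrow> bit) \<Rightarrow> ('a \<Rightarrow> bit) \<Rightarrow> 'a set" where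
  "joint_kernel l m = {x \<in> carrier G. l x = 0 \<and> m x = 0}"

context
  fixes l m assumes l: "functional l" and m: "functional m"
begin

lemmas l_simps = functional_mult[OF l] functional_mult[OF m] functional_shift[OF l] functional_shift[OF m]

lemma joint_kernel_saturated: "mod_z.saturated (joint_kernel l m)"
proof -
  have "l z = 0" "m z = 0" using l m by (simp_all add: functional_def)
  then have "z \<in> joint_kernel l m" by (simp add: joint_kernel_def z_closed)
  then show ?thesis
    unfolding mod_z.saturated_def joint_kernel_def by (auto simp: l_simps m_closed)
qed

lemma joint_kernel_coset:
  "x \<in> carrier G \<Longrightarrow> coset (joint_kernel l m) x = {u \<in> carrier G. l u = l x \<and> m u = m x}"
  unfolding coset_def joint_kernel_def by (auto simp: l_simps m_closed bit_eq_iff_add[symmetric])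

end

text \<open>The element \<open>a\<close> with \<open>l a = 1\<close> ensures that the kernel of
  \<open>l\<close> has index two, and the index in the cyclic construction is then \<open>l\<close>
  itself.\<close>

lemma functional_cyclic:
  assumes l: "functional l" and a: "a \<in> carrier G" "l a = 1"
  obtains S \<alpha> where "condition_C 1 G S \<alpha> z" "\<And>x. x \<in> carrier G \<Longrightarrow> indicator_functional S x = l x"
proof -
  define S where "S = joint_kernel l l"
  note S = joint_kernel_saturated[OF l l, folded S_def]
  have coset: "coset S x = {u \<in> carrier G. l u = l x}" if "x \<in> carrier G" for x
    using joint_kernel_coset[OF l l that] by (simp add: S_def)
  have S_eq: "S = {u \<in> carrier G. l u = 0}" by (auto simp: S_def joint_kernel_def)
  define \<alpha> where "\<alpha> = {u \<in> carrier G. l u = 1}"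
  let ?K = "G Mod S"
  interpret K: comm_group ?K by (rule factor_comm_group[OF S])
  have \<alpha>: "\<alpha> = coset S a" using coset[OF a(1)] a by (simp add: \<alpha>_def)
  have \<alpha>K: "\<alpha> \<in> carrier ?K" using a by (simp add: \<alpha> factor_carrier[OF S])
  have "coset S x \<in> {S, \<alpha>}" if "x \<in> carrier G" for x
    using coset[OF that] by (cases "l x") (simp_all add: S_eq \<alpha>_def)
  then have carr: "carrier ?K = {S, \<alpha>}"
    using \<alpha>K K.one_closed by (auto simp: factor_carrier[OF S])
  have "a \<in> \<alpha>" "a \<notin> S" using a by (simp_all add: \<alpha>_def S_eq)
  then have ne: "\<alpha> \<noteq> S" by blast
  have "condition_C 1 G S \<alpha> z"
    unfolding condition_C_def
  proof (intro conjI)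
    show "carrier ?K = generate ?K {\<alpha>}"
      using K.generate_involution[OF \<alpha>K factor_sq[OF S \<alpha>K]] carr by simp
    show "order ?K = 2 * 1" using ne by (simp add: order_def carr)
    show "z \<in> S \<inter> moufang_center G"
      using one_z_mem[OF S] z_moufang_center[of "carrier G"] by (simp add: one_closed z_closed)
  qed (use is_moufang saturated_normal[OF S] K.is_group \<alpha>K z_neq_one in simp_all)
  moreover have "indicator_functional S x = l x" if "x \<in> carrier G" for x
    using that by (cases "l x") (simp_all add: indicator_functional_def S_eq)
  ultimately show ?thesis using that by blast
qed

text \<open>The elements \<open>f, e\<close> are dual to \<open>l, m\<close>. This puts \<beta>, the
  coset of \<open>e\<close>, into the kernel of \<open>l\<close> and \<gamma>, the coset of
  \<open>f\<close>, into the kernel of \<open>m\<close>, as the index sets of the dihedral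
  construction demand.\<close>

lemma functional_dihedral:
  assumes l: "functional l" and m: "functional m"
    and e: "e \<in> carrier G" "l e = 0" "m e = 1" and f: "f \<in> carrier G" "l f = 1" "m f = 0"
  obtains S \<beta> \<gamma> where "condition_D 1 G S \<beta> \<gamma> z" "e \<in> \<beta>" "f \<in> \<gamma>"
    "\<And>x. x \<in> carrier G \<Longrightarrow> indicator_functional (S \<union> \<beta>) x = l x"
    "\<And>x. x \<in> carrier G \<Longrightarrow> indicator_functional (S \<union> \<gamma>) x = m x"
proof -
  define S where "S = joint_kernel l m"
  note S = joint_kernel_saturated[OF l m, folded S_def]
  note coset = joint_kernel_coset[OF l m, folded S_def]
  define C where "C i j = {u \<in> carrier G. l u = i \<and> m u = j}" for i j
  have S_eq: "S = C 0 0" by (auto simp: S_def C_def joint_kernel_def)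
  have cC: "coset S x = C (l x) (m x)" if "x \<in> carrier G" for x
    using coset[OF that] by (simp add: C_def)
  let ?\<alpha> = "C 1 1" and ?\<beta> = "C 0 1" and ?\<gamma> = "C 1 0"
  let ?K = "G Mod S"
  interpret K: comm_group ?K by (rule factor_comm_group[OF S])
  have ef: "e \<otimes> f \<in> carrier G" "l (e \<otimes> f) = 1" "m (e \<otimes> f) = 1"
    using e f by (simp_all add: m_closed functional_mult[OF l] functional_mult[OF m])
  have reps: "?\<beta> = coset S e" "?\<gamma> = coset S f" "?\<alpha> = coset S (e \<otimes> f)"
    using e f ef by (simp_all add: cC)
  have in_K: "?\<alpha> \<in> carrier ?K" "?\<beta> \<in> carrier ?K" "?\<gamma> \<in> carrier ?K"
    unfolding reps factor_carrier[OF S] using e f ef by simp_all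
  have \<alpha>: "?\<beta> \<otimes>\<^bsub>?K\<^esub> ?\<gamma> = ?\<alpha>"
    unfolding reps by (rule factor_mult[OF S e(1) f(1)])
  have mems: "e \<in> ?\<beta>" "f \<in> ?\<gamma>" "e \<otimes> f \<in> ?\<alpha>" "\<one> \<in> S" using e f ef one_z_mem[OF S] by (simp_all add: C_def)
  have disj: "C i j \<noteq> C i' j'" if "x \<in> C i j" "i \<noteq> i' \<or> j \<noteq> j'" for x i j i' j'
    using that by (auto simp: C_def)
  have ne: "?\<alpha> \<noteq> S" "?\<beta> \<noteq> S" "?\<gamma> \<noteq> S" "?\<alpha> \<noteq> ?\<beta>" "?\<alpha> \<noteq> ?\<gamma>" "?\<beta> \<noteq> ?\<gamma>"
    using disj[OF mems(1)] disj[OF mems(2)] disj[OF mems(3)] by (simp_all add: S_eq)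
  have "coset S x \<in> {S, ?\<alpha>, ?\<beta>, ?\<gamma>}" if "x \<in> carrier G" for x
    using cC[OF that] by (cases "l x"; cases "m x"; simp add: S_eq)
  then have carr: "carrier ?K = {S, ?\<alpha>, ?\<beta>, ?\<gamma>}"
    using in_K K.one_closed by (auto simp: factor_carrier[OF S])
  have one: "\<one>\<^bsub>?K\<^esub> = S" by (rule factor_one[OF S])
  have sq: "A \<otimes>\<^bsub>?K\<^esub> A = \<one>\<^bsub>?K\<^esub>" if "A \<in> carrier ?K" for A by (rule factor_sq[OF S that])
  note t = K.klein_table[OF in_K(2,3) sq[OF in_K(2)] sq[OF in_K(3)], unfolded \<alpha>]
  have ord: "K.ord ?\<alpha> = 2" "K.ord ?\<beta> = 2"
    using K.ord_involution[OF in_K(1) _ sq[OF in_K(1)]] K.ord_involution[OF in_K(2) _ sq[OF in_K(2)]] ne one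
    by simp_all
  have order: "order ?K = 4 * 1" using ne by (simp add: order_def carr)
  have inv: "inv\<^bsub>?K\<^esub> ?\<alpha> = ?\<alpha>" by (rule K.inv_equality[OF sq[OF in_K(1)] in_K(1) in_K(1)])
  have G0: "G0_part 1 G S ?\<alpha> = S \<union> ?\<alpha>"
  proof -
    have "index_range 1 = {0, 1}" by (auto simp: index_range_def)
    then show ?thesis
      using K.int_pow_1[OF in_K(1)] by (simp add: G0_part_def int_pow_0 del: One_nat_def)
  qed
  \<comment> \<open>The Klein four-group as a dihedral group, with rotation \<alpha> of order two
    and reflection \<beta>; the remaining element is \<gamma> = \<alpha>\<beta>.\<close>
  have "dihedral_of_order ?K (4 * 1)"
    unfolding dihedral_of_order_def
  proof (intro conjI bexI)
    show "?\<beta> \<otimes>\<^bsub>?K\<^esub> ?\<alpha> \<otimes>\<^bsub>?K\<^esub> ?\<beta> = inv\<^bsub>?K\<^esub> ?\<alpha>"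
      unfolding inv t(4) using K.m_comm[OF in_K(3,2)] \<alpha> by simp
    have "?\<gamma> \<in> generate ?K {?\<alpha>, ?\<beta>}" using generate.eng[of ?\<alpha> ?K "{?\<alpha>, ?\<beta>}" ?\<beta>]
      by (simp only: t(2)) (auto intro: generate.intros)
    then show "carrier ?K = generate ?K {?\<alpha>, ?\<beta>}"
      using K.generate_incl[of "{?\<alpha>, ?\<beta>}"] in_K generate.one[of ?K "{?\<alpha>, ?\<beta>}"]
      unfolding one by (auto simp: carr intro: generate.incl)
  qed (use in_K ord order K.is_group in simp_all)
  moreover have "involution ?K ?\<beta>" "involution ?K ?\<gamma>"
    using in_K sq ne one by (simp_all add: involution_def)
  moreover have "z \<in> moufang_center (G\<lparr>carrier := S \<union> ?\<alpha>\<rparr>)"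
    by (rule z_moufang_center) (use one_z_mem[OF S] in \<open>auto simp: S_eq C_def\<close>)
  moreover have "e \<in> carrier G - (S \<union> ?\<alpha>)" "(z \<otimes> e) \<otimes> z = e"
    using e by (simp_all add: S_eq C_def shift_simps z_shift(3))
  ultimately have "condition_D 1 G S ?\<beta> ?\<gamma> z"
    unfolding condition_D_def Let_def \<alpha> G0
    using is_moufang saturated_normal[OF S] z_neq_one one_z_mem[OF S] z_nucleus ord by auto
  moreover have "indicator_functional (S \<union> ?\<beta>) x = l x" "indicator_functional (S \<union> ?\<gamma>) x = m x"
    if "x \<in> carrier G" for x
    using that by (cases "l x"; cases "m x"; simp add: indicator_functional_def S_eq C_def)+
  ultimately show ?thesis using that mems by blast
qed

end

text \<open>The loop property is recorded so that a chain of steps delivers it for each of its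
  members.\<close>

definition step :: "'a monoid \<Rightarrow> 'a monoid \<Rightarrow> bool" where
  "step G H \<longleftrightarrow> loop H \<and> (obtained_by_cyclic G H \<or> obtained_by_dihedral G H)"

text \<open>Two functionals over GF(2) are dependent only if one of them is zero or they are equal.
  The first case takes no step, the second a cyclic one, and independent functionals take a dihedral
  one.\<close>

lemma twist_reachable:
  fixes G :: "'a monoid" (structure)
  assumes "based_code_loop G z" "central_involution.functional G z l" "central_involution.functional G z m"
  obtains H where "step\<^sup>*\<^sup>* G H" "carrier H = carrier G" "\<one>\<^bsub>H\<^esub> = \<one>"
    "\<And>x y. \<lbrakk>x \<in> carrier G; y \<in> carrier G\<rbrakk> \<Longrightarrow> x \<otimes>\<^bsub>H\<^esub> y = central_involution.shift G z (x \<otimes> y) (l x * m y)"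
proof -
  interpret based_code_loop G z by fact
  note lm = assms(2,3)
  note fm = functional_mult[OF lm(1)] functional_mult[OF lm(2)]
  consider (trivial) "\<And>x y. \<lbrakk>x \<in> carrier G; y \<in> carrier G\<rbrakk> \<Longrightarrow> l x * m y = 0"
    | (cyclic) a where "a \<in> carrier G" "l a = 1" "\<And>x. x \<in> carrier G \<Longrightarrow> l x = m x"
    | (dihedral) e f where "e \<in> carrier G" "l e = 0" "m e = 1" "f \<in> carrier G" "l f = 1" "m f = 0"
  proof -
    consider "\<And>x. x \<in> carrier G \<Longrightarrow> l x = 0" | "\<And>x. x \<in> carrier G \<Longrightarrow> m x = 0"
      | a b where "a \<in> carrier G" "l a = 1" "b \<in> carrier G" "m b = 1"
      using bit_not_zero_iff by blast
    then show ?thesis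
    proof cases
      case (3 a b)
      show ?thesis
      proof (cases "\<forall>x\<in>carrier G. l x = m x")
        case True
        then show ?thesis using cyclic 3 by blast
      next
        case False
        then obtain c where c: "c \<in> carrier G" "l c \<noteq> m c" by blast
        show ?thesis
        \<comment> \<open>If \<open>l c = 0\<close>, then \<open>c\<close> serves as
          \<open>e\<close>, and \<open>f\<close> is \<open>a\<close> or
          \<open>a \<otimes> c\<close>, whichever \<open>m\<close> maps to zero. The other case is
          symmetric, with \<open>b\<close> in place of \<open>a\<close>.\<close>
        proof (cases "l c")
          case zero
          then have "m c = 1" using c by simp
          then have "l (a \<otimes> c) = 1" "m (a \<otimes> c) = m a + 1" using fm c 3 zero by simp_all
          then show ?thesis
            using dihedral[OF c(1) zero _ 3(1,2)] dihedral[OF c(1) zero _ m_closed[OF 3(1) c(1)]] \<open>m c = 1\<close>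
            by (cases "m a") simp_all
        next
          case one
          then have "m c = 0" using c by simp
          then have "m (b \<otimes> c) = 1" "l (b \<otimes> c) = l b + 1" using fm c 3 one by simp_all
          then show ?thesis
            using dihedral[OF 3(3) _ 3(4) c(1) one] dihedral[OF m_closed[OF 3(3) c(1)] _ _ c(1) one] \<open>m c = 0\<close>
            by (cases "l b") simp_all
        qed
      qed
    qed (use trivial in simp_all)
  qed
  then show ?thesis
  proof cases
    case trivial
    then show ?thesis by (intro that[of G]) (simp_all only: shift_0 rtranclp.rtrancl_refl)
  next
    case (cyclic a)
    obtain S \<alpha> where C: "condition_C 1 G S \<alpha> z"
      and ind: "\<And>x. x \<in> carrier G \<Longrightarrow> indicator_functional S x = l x"
      using functional_cyclic[OF lm(1) cyclic(1,2)] by metis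
    let ?H = "cyclic_construction 1 G S \<alpha> z"
    note tw = cyclic_construction_twist[OF C]
    have H: "carrier ?H = carrier G" "\<one>\<^bsub>?H\<^esub> = \<one>" by (simp_all add: cyclic_construction_def del: One_nat_def)
    interpret H: based_code_loop ?H z by (rule twist(1)[OF tw(2,2) H tw(3)])
    have "step G ?H" using C H.loop_axioms unfolding step_def obtained_by_cyclic_def by blast
    then show ?thesis
      using tw(3) ind cyclic(3) by (intro that[of ?H]) (simp_all add: H del: One_nat_def)
  next
    case (dihedral e f)
    obtain S \<beta> \<gamma> where D: "condition_D 1 G S \<beta> \<gamma> z" and ef: "e \<in> \<beta>" "f \<in> \<gamma>"
      and ind: "\<And>x. x \<in> carrier G \<Longrightarrow> indicator_functional (S \<union> \<beta>) x = l x"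
      "\<And>x. x \<in> carrier G \<Longrightarrow> indicator_functional (S \<union> \<gamma>) x = m x"
      using functional_dihedral[OF lm dihedral] by metis
    let ?H = "dihedral_construction 1 G S \<beta> \<gamma> e f z"
    note tw = dihedral_construction_twist[OF D ef]
    have H: "carrier ?H = carrier G" "\<one>\<^bsub>?H\<^esub> = \<one>" by (simp_all add: dihedral_construction_def)
    interpret H: based_code_loop ?H z by (rule twist(1)[OF tw(2,3) H tw(4)])
    have "step G ?H" using D ef H.loop_axioms unfolding step_def obtained_by_dihedral_def by blast
    then show ?thesis
      using tw(4) ind by (intro that[of ?H]) (simp_all add: H del: One_nat_def)
  qed
qed

text \<open>After a twist the remaining functionals must be linear for the new multiplication. They
  are, because products change only by powers of \<open>z\<close>; this invariant is carried
  along.\<close>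

lemma twists_reachable:
  fixes G :: "'a monoid" (structure)
  assumes "based_code_loop G z"
    and "\<forall>(l, m)\<in>set ps. central_involution.functional G z l \<and> central_involution.functional G z m"
  shows "\<exists>H. step\<^sup>*\<^sup>* G H \<and> based_code_loop H z \<and> carrier H = carrier G \<and> \<one>\<^bsub>H\<^esub> = \<one> \<and>
    (\<forall>x\<in>carrier G. \<forall>y\<in>carrier G. \<exists>b. x \<otimes>\<^bsub>H\<^esub> y = central_involution.shift G z (x \<otimes> y) b) \<and>
    (\<forall>x\<in>carrier G. \<forall>b. central_involution.shift H z x b = central_involution.shift G z x b) \<and>
    (\<forall>x\<in>carrier G. sq_bit H x = sq_bit G x + (\<Sum>(l, m)\<leftarrow>ps. l x * m x))"
  using assms
proof (induction ps arbitrary: G)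
  case Nil
  then interpret based_code_loop G z by simp
  show ?case using Nil by (intro exI[of _ G]) (auto intro: exI[of _ 0] simp: shift_0)
next
  case (Cons p ps)
  obtain l m where p: "p = (l, m)" by fastforce
  interpret based_code_loop G z by fact
  have lm: "functional l" "functional m" using Cons.prems p by auto
  obtain H where H: "step\<^sup>*\<^sup>* G H" "carrier H = carrier G" "\<one>\<^bsub>H\<^esub> = \<one>\<^bsub>G\<^esub>"
    "\<And>x y. \<lbrakk>x \<in> carrier G; y \<in> carrier G\<rbrakk> \<Longrightarrow> x \<otimes>\<^bsub>H\<^esub> y = shift (x \<otimes>\<^bsub>G\<^esub> y) (l x * m y)"
    using twist_reachable[OF Cons.prems(1) lm] by metis
  note tw = twist[OF lm H(2-4)]
  interpret H: based_code_loop H z by (rule tw(1))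
  have "H.functional k" if "functional k" for k
    using that by (simp add: H.functional_def functional_def H(2,4) functional_shift[OF that] m_closed)
  then have "\<forall>(l, m)\<in>set ps. H.functional l \<and> H.functional m" using Cons.prems(2) by auto
  then obtain H' where H': "step\<^sup>*\<^sup>* H H'" "based_code_loop H' z" "carrier H' = carrier G" "\<one>\<^bsub>H'\<^esub> = \<one>\<^bsub>G\<^esub>"
    "\<And>x y. \<lbrakk>x \<in> carrier G; y \<in> carrier G\<rbrakk> \<Longrightarrow> \<exists>b. x \<otimes>\<^bsub>H'\<^esub> y = H.shift (x \<otimes>\<^bsub>H\<^esub> y) b"
    "\<And>x b. x \<in> carrier G \<Longrightarrow> central_involution.shift H' z x b = H.shift x b"
    "\<And>x. x \<in> carrier G \<Longrightarrow> sq_bit H' x = sq_bit H x + (\<Sum>(l, m)\<leftarrow>ps. l x * m x)"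
    using Cons.IH[OF tw(1)] H(2,3) by auto
  have "\<exists>b. x \<otimes>\<^bsub>H'\<^esub> y = shift (x \<otimes>\<^bsub>G\<^esub> y) b" if xy: "x \<in> carrier G" "y \<in> carrier G" for x y
  proof -
    obtain b where "x \<otimes>\<^bsub>H'\<^esub> y = H.shift (x \<otimes>\<^bsub>H\<^esub> y) b" using H'(5)[OF xy] by blast
    then show ?thesis using xy by (simp add: H(4) tw(2) shift_simps) blast
  qed
  then show ?case
    using H'(1-4,6,7) H(1) tw(2,3) p by (intro exI[of _ H']) (auto simp: ac_simps)
qed

section \<open>Quadratic forms as sums of products of functionals\<close>

context based_code_loop
begin

definition polar :: "('a \<Rightarrow> bit) \<Rightarrow> 'a \<Rightarrow> 'a \<Rightarrow> bit" where
  "polar Q x y = Q x + Q y + Q (x \<otimes> y)"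

definition quadratic :: "('a \<Rightarrow> bit) \<Rightarrow> bool" where
  "quadratic Q \<longleftrightarrow> (\<forall>x\<in>carrier G. \<forall>b. Q (shift x b) = Q x) \<and>
     (\<forall>x\<in>carrier G. \<forall>y\<in>carrier G. \<forall>w\<in>carrier G. polar Q (x \<otimes> y) w = polar Q x w + polar Q y w)"

lemma quadratic_add:
  assumes "quadratic Q" "quadratic R"
  shows "quadratic (\<lambda>x. Q x + R x)"
proof -
  have "polar (\<lambda>x. Q x + R x) x y = polar Q x y + polar R x y" for x y
    by (simp add: polar_def ac_simps)
  then show ?thesis using assms by (simp add: quadratic_def ac_simps)
qed

lemma quadratic_prod:
  assumes "functional l" "functional m"
  shows "quadratic (\<lambda>x. l x * m x)"
  using functional_mult[OF assms(1)] functional_mult[OF assms(2)]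
    functional_shift[OF assms(1)] functional_shift[OF assms(2)]
  by (simp add: quadratic_def polar_def m_closed algebra_simps)

lemma quadratic_sum_list:
  assumes "\<forall>(l, m)\<in>set ps. functional l \<and> functional m"
  shows "quadratic (\<lambda>x. \<Sum>(l, m)\<leftarrow>ps. l x * m x)"
  using assms
proof (induction ps)
  case Nil
  then show ?case by (simp add: quadratic_def polar_def)
next
  case (Cons p ps)
  then show ?case using quadratic_prod quadratic_add by (cases p) simp
qed

lemma functional_hyperplane:
  assumes U: "mod_z.saturated U" and v: "v \<in> carrier G - U"
  obtains l where "functional l" "\<And>x. x \<in> U \<Longrightarrow> l x = 0" "l v = 1"
proof -
  obtain M where M: "mod_z.saturated M" "U \<subseteq> M" "v \<notin> M"
    and hyp: "\<And>x. x \<in> carrier G \<Longrightarrow> x \<in> M \<or> v \<otimes> x \<in> M"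
    using mod_z.ex_hyperplane[OF U v] by metis
  have "functional (indicator_functional M)"
    using mod_z.hyperplane_mult_iff[OF M(1) _ hyp] v one_z_mem(2)[OF M(1)]
    by (intro functional_indicator) auto
  then show ?thesis
    using M by (intro that[of "indicator_functional M"]) (auto simp: indicator_functional_def)
qed

text \<open>Suppose the form agrees with a sum of products on \<open>U\<close>. On the span of
  \<open>U\<close> and \<open>v\<close> the remainder \<open>R\<close> vanishes on the hyperplane
  \<open>U\<close>, hence is divisible there by the functional \<open>l\<close> that vanishes on
  \<open>U\<close>; one more product corrects it.\<close>

lemma quadratic_decomposition:
  assumes Q: "quadratic Q"
  obtains ps where "\<forall>(l, m)\<in>set ps. functional l \<and> functional m"
    "\<And>x. x \<in> carrier G \<Longrightarrow> Q x = (\<Sum>(l, m)\<leftarrow>ps. l x * m x)"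
proof -
  have "\<exists>ps. (\<forall>(l, m)\<in>set ps. functional l \<and> functional m) \<and>
    (\<forall>x\<in>carrier G. Q x = (\<Sum>(l, m)\<leftarrow>ps. l x * m x))"
    using saturated_one_z
  proof (induction rule: mod_z.saturated_induct)
    case base
    \<comment> \<open>\<open>Q \<one> = 0\<close> is forced by additivity of the polar form, whose
      value at two units is \<open>Q \<one>\<close>.\<close>
    have "polar Q (\<one> \<otimes> \<one>) \<one> = polar Q \<one> \<one> + polar Q \<one> \<one>"
      using Q one_closed unfolding quadratic_def by blast
    then have "Q \<one> = 0" by (simp add: polar_def l_one one_closed)
    moreover have "Q z = Q \<one>" using Q one_closed unfolding quadratic_def by (metis z_shift(1))
    ultimately show ?case by (intro exI[of _ "[]"]) simp
  next
    case (step U v)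
    then obtain ps where ps: "\<forall>(l, m)\<in>set ps. functional l \<and> functional m"
      "\<forall>x\<in>U. Q x = (\<Sum>(l, m)\<leftarrow>ps. l x * m x)" by blast
    define R where "R x = Q x + (\<Sum>(l, m)\<leftarrow>ps. l x * m x)" for x
    have R: "quadratic R" unfolding R_def using Q quadratic_sum_list[OF ps(1)] by (rule quadratic_add)
    have RU: "R x = 0" if "x \<in> U" for x using ps(2) that by (simp add: R_def)
    obtain l where l: "functional l" "\<And>x. x \<in> U \<Longrightarrow> l x = 0" "l v = 1"
      using functional_hyperplane[OF step(1,2)] by blast
    \<comment> \<open>On the coset of \<open>v\<close> the value \<open>R (x \<otimes> v)\<close>
      vanishes, so \<open>polar R x v\<close> is \<open>R x + R v\<close>. The second summand
      removes \<open>R v\<close> and leaves \<open>m x = R x\<close>.\<close>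
    define m where "m x = polar R x v + R v * l x" for x
    have v: "v \<in> carrier G" using step by blast
    have R_shift: "R (shift x b) = R x" if "x \<in> carrier G" for x b
      using R that by (simp add: quadratic_def)
    have R_comm: "R (x \<otimes> v) = R (v \<otimes> x)" if "x \<in> carrier G" for x
      using comm[OF that v] R_shift[OF m_closed[OF v that]] by metis
    have "polar R z v = 0"
      using RU[OF one_z_mem(2)[OF step(1)]] R_shift[OF v] v by (simp add: polar_def z_mult)
    then have m: "functional m"
      using R l v by (auto simp: functional_def m_def quadratic_def distrib_left ac_simps)
    have "R x = l x * m x" if x: "x \<in> mod_z.adjoin v U" for x
    proof (cases "x \<in> U")
      case True
      then show ?thesis using RU l by simp
    next
      case False
      then have xc: "x \<in> carrier G" and vx: "v \<otimes> x \<in> U" using x by (auto simp: mod_z.adjoin_def)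
      have "l x = 1" using l(2)[OF vx] functional_mult[OF l(1) v xc] l(3) by (cases "l x") simp_all
      moreover have "R (x \<otimes> v) = 0" using R_comm[OF xc] RU[OF vx] by simp
      ultimately show ?thesis by (simp add: m_def polar_def ac_simps)
    qed
    moreover have "Q x = R x + (\<Sum>(l, m)\<leftarrow>ps. l x * m x)" for x by (simp add: R_def add.assoc)
    ultimately have "\<forall>x\<in>mod_z.adjoin v U. Q x = (\<Sum>(l, m)\<leftarrow>(l, m) # ps. l x * m x)" by simp
    moreover have "\<forall>(l, m)\<in>set ((l, m) # ps). functional l \<and> functional m" using ps l m by simp
    ultimately show ?case by blast
  qed
  then show ?thesis using that by blast
qed

end

section \<open>Code loops with equivalent associators\<close>

lemma elementary_quotient_Times:
  assumes "elementary_quotient K1 p1 c1" "elementary_quotient K2 p2 c2"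
  shows "elementary_quotient (K1 \<times> K2) (\<lambda>x y. (p1 (fst x) (fst y), p2 (snd x) (snd y)))
    (\<lambda>x y. c1 (fst x) (fst y) \<and> c2 (snd x) (snd y))"
proof -
  interpret A: elementary_quotient K1 p1 c1 by fact
  interpret B: elementary_quotient K2 p2 c2 by fact
  show ?thesis
    by unfold_locales
      (auto intro: A.finite_K B.finite_K A.K_closed B.K_closed A.K_sym B.K_sym A.K_cong B.K_cong
        A.K_comm B.K_comm A.K_assoc B.K_assoc A.K_sq B.K_sq elim: A.K_trans[rotated 3] B.K_trans[rotated 3])
qed

lemma card_two_fibres:
  assumes "finite r" "\<And>x. x \<in> Domain r \<Longrightarrow> card (r `` {x}) = 2"
  shows "card r = 2 * card (Domain r)"
proof -
  have "r = (SIGMA x:Domain r. r `` {x})" by auto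
  then have "card r = card (SIGMA x:Domain r. r `` {x})" by simp
  also have "\<dots> = (\<Sum>x\<in>Domain r. card (r `` {x}))"
    using assms(1) by (intro card_SigmaI) (auto intro: finite_Image finite_Domain)
  finally show ?thesis using assms(2) by simp
qed

text \<open>Double counting. In the application the fibres on either side are cosets of a central
  subloop of order two.\<close>

lemma card_Domain_eq_Range:
  assumes "finite r" "\<And>x. x \<in> Domain r \<Longrightarrow> card (r `` {x}) = 2" "\<And>y. y \<in> Range r \<Longrightarrow> card (r\<inverse> `` {y}) = 2"
  shows "card (Domain r) = card (Range r)"
  using card_two_fibres[OF assms(1,2)] card_two_fibres[of "r\<inverse>"] assms by simp

lemma (in based_code_loop) mult_in_Z:
  assumes "x \<in> carrier G" "y \<in> carrier G" "x \<otimes> y \<in> {\<one>, z}"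
  obtains b where "y = shift x b"
proof -
  obtain b where "x \<otimes> y = shift \<one> b" using assms(3) shift_one_iff[of "x \<otimes> y"] by blast
  then have "shift y (sq_bit G x) = shift x b"
    using left_alt[OF assms(1,2)] assms by (simp add: shift_simps)
  then have "y = shift x (sq_bit G x + b)" using shift_eqD[OF assms(2,1)] by blast
  then show ?thesis using that by blast
qed

locale code_loop_pair =
  G: based_code_loop G z + L: based_code_loop L t
  for G :: "('a, 'c) monoid_scheme" and z and L :: "('b, 'd) monoid_scheme" and t
begin

abbreviation pair_mult :: "'a \<times> 'b \<Rightarrow> 'a \<times> 'b \<Rightarrow> 'a \<times> 'b" where
  "pair_mult p q \<equiv> (fst p \<otimes>\<^bsub>G\<^esub> fst q, snd p \<otimes>\<^bsub>L\<^esub> snd q)"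

sublocale pair: elementary_quotient "carrier G \<times> carrier L" pair_mult
  "\<lambda>p q. (\<exists>b. fst q = G.shift (fst p) b) \<and> (\<exists>b. snd q = L.shift (snd p) b)"
  by (rule elementary_quotient_Times) (rule G.mod_z.elementary_quotient_axioms L.mod_z.elementary_quotient_axioms)+

text \<open>
  The condition on the central subloops makes a saturated set of pairs the graph of an isomorphism
  between subspaces of \<open>G / {1, z}\<close> and \<open>L / {1, t}\<close>.
\<close>

definition correspondence :: "('a \<times> 'b) set \<Rightarrow> bool" where
  "correspondence \<rho> \<longleftrightarrow> pair.saturated \<rho> \<and> (\<forall>(x, y)\<in>\<rho>. x \<in> {\<one>\<^bsub>G\<^esub>, z} \<longleftrightarrow> y \<in> {\<one>\<^bsub>L\<^esub>, t})"

context
  fixes \<rho> assumes \<rho>: "correspondence \<rho>"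
begin

lemma corr_saturated: "pair.saturated \<rho>"
  using \<rho> by (simp add: correspondence_def)

lemma corr_carrier: "(x, y) \<in> \<rho> \<Longrightarrow> x \<in> carrier G \<and> y \<in> carrier L"
  using pair.saturatedD(1)[OF corr_saturated] by auto

lemma corr_mult: "\<lbrakk>(x, y) \<in> \<rho>; (u, v) \<in> \<rho>\<rbrakk> \<Longrightarrow> (x \<otimes>\<^bsub>G\<^esub> u, y \<otimes>\<^bsub>L\<^esub> v) \<in> \<rho>"
  using pair.saturatedD(2)[OF corr_saturated, of "(x, y)" "(u, v)"] by simp

lemma corr_shift: "(x, y) \<in> \<rho> \<Longrightarrow> (G.shift x b, L.shift y c) \<in> \<rho>"
  using pair.saturatedD(3)[OF corr_saturated, of "(x, y)" "(G.shift x b, L.shift y c)"] corr_carrier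
  by (auto simp: G.shift_closed L.shift_closed)

lemma corr_Z: "(x, y) \<in> \<rho> \<Longrightarrow> x \<in> {\<one>\<^bsub>G\<^esub>, z} \<longleftrightarrow> y \<in> {\<one>\<^bsub>L\<^esub>, t}"
  using \<rho> by (auto simp: correspondence_def)

lemma corr_one: "(G.shift \<one>\<^bsub>G\<^esub> b, L.shift \<one>\<^bsub>L\<^esub> c) \<in> \<rho>"
proof -
  have "(\<one>\<^bsub>G\<^esub>, \<one>\<^bsub>L\<^esub>) \<in> \<rho>"
    using pair.saturated_sq[OF corr_saturated, of "(\<one>\<^bsub>G\<^esub>, \<one>\<^bsub>L\<^esub>)"] by (simp add: G.loop_simps L.loop_simps)
  then show ?thesis by (rule corr_shift)
qed

text \<open>Multiplying the two pairs turns the common component into a square, which is central.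
  The condition on the central subloops then makes \<open>y y'\<close> central, so \<open>y\<close>
  and \<open>y'\<close> are congruent.\<close>

lemma corr_unique_right:
  assumes "(x, y) \<in> \<rho>" "(x, y') \<in> \<rho>"
  obtains b where "y' = L.shift y b"
proof -
  have c: "x \<in> carrier G" "y \<in> carrier L" "y' \<in> carrier L" using assms corr_carrier by auto
  have "x \<otimes>\<^bsub>G\<^esub> x \<in> {\<one>\<^bsub>G\<^esub>, z}" using G.sq[OF c(1)] G.shift_one_iff by blast
  then have "y \<otimes>\<^bsub>L\<^esub> y' \<in> {\<one>\<^bsub>L\<^esub>, t}" using corr_Z[OF corr_mult[OF assms]] by blast
  then show ?thesis using L.mult_in_Z[OF c(2,3)] that by blast
qed

lemma corr_unique_left:
  assumes "(x, y) \<in> \<rho>" "(x', y) \<in> \<rho>"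
  obtains b where "x' = G.shift x b"
proof -
  have c: "y \<in> carrier L" "x \<in> carrier G" "x' \<in> carrier G" using assms corr_carrier by auto
  have "y \<otimes>\<^bsub>L\<^esub> y \<in> {\<one>\<^bsub>L\<^esub>, t}" using L.sq[OF c(1)] L.shift_one_iff by blast
  then have "x \<otimes>\<^bsub>G\<^esub> x' \<in> {\<one>\<^bsub>G\<^esub>, z}" using corr_Z[OF corr_mult[OF assms]] by blast
  then show ?thesis using G.mult_in_Z[OF c(2,3)] that by blast
qed

text \<open>Stated for any part of \<rho> closed under shifts, because it is applied to the part
  over the nuclei as well as to all of \<rho>.\<close>

lemma corr_card:
  assumes "\<sigma> \<subseteq> \<rho>" and sat: "\<And>x y b c. (x, y) \<in> \<sigma> \<Longrightarrow> (G.shift x b, L.shift y c) \<in> \<sigma>"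
  shows "card (Domain \<sigma>) = card (Range \<sigma>)"
proof (rule card_Domain_eq_Range)
  have "\<sigma> \<subseteq> carrier G \<times> carrier L" using assms(1) corr_carrier by auto
  then show "finite \<sigma>" using G.finite_carrier L.finite_carrier by (meson finite_SigmaI finite_subset)
next
  fix x assume "x \<in> Domain \<sigma>"
  then obtain y where y: "(x, y) \<in> \<sigma>" by blast
  then have yc: "y \<in> carrier L" using assms(1) corr_carrier by blast
  have "\<sigma> `` {x} = {L.shift y 0, L.shift y 1}"
  proof
    show "\<sigma> `` {x} \<subseteq> {L.shift y 0, L.shift y 1}"
    proof
      fix y' assume "y' \<in> \<sigma> `` {x}"
      then obtain b where "y' = L.shift y b" using y assms(1) corr_unique_right by blast
      then show "y' \<in> {L.shift y 0, L.shift y 1}" by (cases b) simp_all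
    qed
    show "{L.shift y 0, L.shift y 1} \<subseteq> \<sigma> `` {x}"
      using sat[OF y, of 0 0] sat[OF y, of 0 1] by (auto simp: G.shift_0)
  qed
  then show "card (\<sigma> `` {x}) = 2" using L.shift_inject[OF yc, of 0 1] by simp
next
  fix y assume "y \<in> Range \<sigma>"
  then obtain x where x: "(x, y) \<in> \<sigma>" by blast
  then have xc: "x \<in> carrier G" using assms(1) corr_carrier by blast
  have "\<sigma>\<inverse> `` {y} = {G.shift x 0, G.shift x 1}"
  proof
    show "\<sigma>\<inverse> `` {y} \<subseteq> {G.shift x 0, G.shift x 1}"
    proof
      fix x' assume "x' \<in> \<sigma>\<inverse> `` {y}"
      then obtain b where "x' = G.shift x b" using x assms(1) corr_unique_left by blast
      then show "x' \<in> {G.shift x 0, G.shift x 1}" by (cases b) simp_all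
    qed
    show "{G.shift x 0, G.shift x 1} \<subseteq> \<sigma>\<inverse> `` {y}"
      using sat[OF x, of 0 0] sat[OF x, of 1 0] by (auto simp: L.shift_0)
  qed
  then show "card (\<sigma>\<inverse> `` {y}) = 2" using G.shift_inject[OF xc, of 0 1] by simp
qed

end

text \<open>
  Modulo the diagonal involution \<open>(z, t)\<close> the correspondence is an elementary abelian group,
  and a hyperplane avoiding \<open>(z, 1)\<close> is the graph of an isomorphism.
\<close>

lemma correspondence_iso:
  assumes \<rho>: "correspondence \<rho>" and dom: "Domain \<rho> = carrier G" and ran: "Range \<rho> = carrier L"
    and sq: "\<And>x y. (x, y) \<in> \<rho> \<Longrightarrow> sq_bit G x = sq_bit L y"
  shows "G \<cong> L"
proof -
  note c = corr_carrier[OF \<rho>] and mult = corr_mult[OF \<rho>] and shift = corr_shift[OF \<rho>]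
  \<comment> \<open>Here both components must be shifted by the same exponent. This is compatible
    with the product because equal squaring maps force equal commutator and associator
    exponents.\<close>
  interpret D: elementary_quotient \<rho> pair_mult
    "\<lambda>p q. \<exists>b. fst q = G.shift (fst p) b \<and> snd q = L.shift (snd p) b"
  proof
    have "\<rho> \<subseteq> carrier G \<times> carrier L" using c by auto
    then show "finite \<rho>" using G.finite_carrier L.finite_carrier by (meson finite_SigmaI finite_subset)
  next
    fix p q assume p: "p \<in> \<rho>" and q: "q \<in> \<rho>"
    obtain x y u v where pq: "p = (x, y)" "q = (u, v)" by fastforce
    have xy: "x \<in> carrier G" "y \<in> carrier L" "u \<in> carrier G" "v \<in> carrier L" using c p q pq by auto
    show "pair_mult p q \<in> \<rho>" using mult p q pq by simp
    show "\<exists>b. fst p = G.shift (fst q) b \<and> snd p = L.shift (snd q) b"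
      if "\<exists>b. fst q = G.shift (fst p) b \<and> snd q = L.shift (snd p) b"
      using that xy pq G.shift_eq_swap[OF xy(1,3)] L.shift_eq_swap[OF xy(2,4)] by (metis fst_conv snd_conv)
    have "comm_form G u x = comm_form L v y"
      using sq[of x y] sq[of u v] sq[OF mult[of u v x y]] p q pq by (simp add: comm_form_def)
    then show "\<exists>b. fst (pair_mult q p) = G.shift (fst (pair_mult p q)) b \<and>
        snd (pair_mult q p) = L.shift (snd (pair_mult p q)) b"
      using G.comm[OF xy(3,1)] L.comm[OF xy(4,2)] pq by auto
    show "\<exists>b. fst q = G.shift (fst (pair_mult (pair_mult p p) q)) b \<and>
        snd q = L.shift (snd (pair_mult (pair_mult p p) q)) b"
      using xy sq[of x y] p pq
      by (intro exI[of _ "sq_bit G x"])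
        (simp add: G.sq_mult L.sq_mult G.shift_shift L.shift_shift G.shift_0 L.shift_0)
    fix r assume r: "r \<in> \<rho>"
    obtain g k where gk: "r = (g, k)" by fastforce
    have gkc: "g \<in> carrier G" "k \<in> carrier L" using c r gk by auto
    show "\<exists>b. fst r = G.shift (fst p) b \<and> snd r = L.shift (snd p) b"
      if "\<exists>b. fst q = G.shift (fst p) b \<and> snd q = L.shift (snd p) b"
        "\<exists>b. fst r = G.shift (fst q) b \<and> snd r = L.shift (snd q) b"
      using that xy pq by (auto simp: G.shift_shift L.shift_shift)
    show "\<exists>b. fst (pair_mult r q) = G.shift (fst (pair_mult r p)) b \<and>
        snd (pair_mult r q) = L.shift (snd (pair_mult r p)) b"
      if "\<exists>b. fst q = G.shift (fst p) b \<and> snd q = L.shift (snd p) b"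
      using that xy pq gk gkc by (auto simp: G.shift_mult_right L.shift_mult_right)
    have m: "(x, y) \<in> \<rho>" "(u, v) \<in> \<rho>" "(g, k) \<in> \<rho>" using p q r pq gk by simp_all
    have "assoc_form G x u g = assoc_form L y v k"
      unfolding assoc_form_def
      by (simp only: m[THEN sq] mult[OF m(1,2), THEN sq] mult[OF m(1,3), THEN sq] mult[OF m(2,3), THEN sq]
          mult[OF mult[OF m(1,2)] m(3), THEN sq])
    then show "\<exists>b. fst (pair_mult p (pair_mult q r)) = G.shift (fst (pair_mult (pair_mult p q) r)) b \<and>
        snd (pair_mult p (pair_mult q r)) = L.shift (snd (pair_mult (pair_mult p q) r)) b"
      using xy pq gk gkc
      by (intro exI[of _ "assoc_form G x u g"])
        (simp add: G.assoc L.assoc G.shift_shift L.shift_shift G.shift_0 L.shift_0 G.m_closed L.m_closed)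
  qed
  have one: "(\<one>\<^bsub>G\<^esub>, \<one>\<^bsub>L\<^esub>) \<in> \<rho>" "(z, t) \<in> \<rho>" "(z, \<one>\<^bsub>L\<^esub>) \<in> \<rho>"
    using corr_one[OF \<rho>, of 0 0] corr_one[OF \<rho>, of 1 1] corr_one[OF \<rho>, of 1 0]
    by (simp_all add: G.shift_0 L.shift_0 G.z_shift L.z_shift)
  have sat: "D.saturated {(\<one>\<^bsub>G\<^esub>, \<one>\<^bsub>L\<^esub>), (z, t)}"
    unfolding D.saturated_def
  proof (intro conjI ballI impI)
    fix p q assume "p \<in> {(\<one>\<^bsub>G\<^esub>, \<one>\<^bsub>L\<^esub>), (z, t)}"
      "\<exists>b. fst q = G.shift (fst p) b \<and> snd q = L.shift (snd p) b"
    then obtain b where "q = (G.shift \<one>\<^bsub>G\<^esub> b, L.shift \<one>\<^bsub>L\<^esub> b) \<or> q = (G.shift z b, L.shift t b)"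
      by (metis fst_conv insertE prod.collapse singletonD snd_conv)
    then show "q \<in> {(\<one>\<^bsub>G\<^esub>, \<one>\<^bsub>L\<^esub>), (z, t)}"
      by (cases b) (auto simp: G.shift_0 L.shift_0 G.z_shift L.z_shift)
  qed (use one in \<open>auto simp: G.loop_simps L.loop_simps G.z_closed L.z_closed G.z_z L.z_z\<close>)
  have z1: "(z, \<one>\<^bsub>L\<^esub>) \<in> \<rho> - {(\<one>\<^bsub>G\<^esub>, \<one>\<^bsub>L\<^esub>), (z, t)}"
    using one G.z_neq_one L.z_neq_one by auto
  obtain M where M: "D.saturated M" "{(\<one>\<^bsub>G\<^esub>, \<one>\<^bsub>L\<^esub>), (z, t)} \<subseteq> M" "(z, \<one>\<^bsub>L\<^esub>) \<notin> M"
    and hyp: "\<And>p. p \<in> \<rho> \<Longrightarrow> p \<in> M \<or> pair_mult (z, \<one>\<^bsub>L\<^esub>) p \<in> M"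
    by (rule D.ex_hyperplane[OF sat z1]) (rule that; simp)
  have Mc: "x \<in> carrier G" "y \<in> carrier L" "(x, y) \<in> \<rho>" if "(x, y) \<in> M" for x y
    using D.saturatedD(1)[OF M(1) that] c by auto
  have Mm: "(x \<otimes>\<^bsub>G\<^esub> u, y \<otimes>\<^bsub>L\<^esub> v) \<in> M" if "(x, y) \<in> M" "(u, v) \<in> M" for x y u v
    using D.saturatedD(2)[OF M(1) that] by simp
  have Ms: "(G.shift x b, L.shift y b) \<in> M" if "(x, y) \<in> M" for x y b
    using D.saturatedD(3)[OF M(1) that, of "(G.shift x b, L.shift y b)"] shift Mc(3)[OF that] by auto
  have half: "(x, y) \<in> M \<or> (G.shift x 1, y) \<in> M" if "(x, y) \<in> \<rho>" for x y
    using hyp[OF that] c[OF that] by (simp add: G.z_mult L.l_one)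
  \<comment> \<open>The product of the two pairs has second component \<open>y y\<close> and first
    component \<open>x x\<close> times \<open>z\<close>. As \<open>x\<close> and \<open>y\<close>
    have the same square bit, a diagonal shift turns it into \<open>(z, \<one>)\<close>, which
    \<open>M\<close> avoids.\<close>
  have no: "\<not> ((G.shift x b, y) \<in> M \<and> (x, y) \<in> M)" if "b = 1" for x y b
  proof
    assume *: "(G.shift x b, y) \<in> M \<and> (x, y) \<in> M"
    then have xy: "x \<in> carrier G" "y \<in> carrier L" "(x, y) \<in> \<rho>" using Mc by blast+
    have "(G.shift x b \<otimes>\<^bsub>G\<^esub> x, y \<otimes>\<^bsub>L\<^esub> y) \<in> M" using * Mm by blast
    then have "(G.shift \<one>\<^bsub>G\<^esub> (b + sq_bit G x), L.shift \<one>\<^bsub>L\<^esub> (sq_bit G x)) \<in> M"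
      using xy sq[OF xy(3)] by (simp add: G.shift_mult_left G.sq L.sq G.shift_shift G.one_closed add.commute)
    from Ms[OF this, of "sq_bit G x"] have "(z, \<one>\<^bsub>L\<^esub>) \<in> M"
      using that by (simp add: G.shift_shift L.shift_shift G.one_closed L.one_closed L.shift_0 G.z_shift ac_simps)
    then show False using M(3) by blast
  qed
  have ex: "\<exists>!y. (x, y) \<in> M" if x: "x \<in> carrier G" for x
  proof -
    obtain y where y: "(x, y) \<in> \<rho>" using x dom by blast
    \<comment> \<open>A diagonal shift, under which \<open>M\<close> is closed, moves the factor
      from the first component to the second.\<close>
    have "(x, y) \<in> M \<or> (x, L.shift y 1) \<in> M"
      using half[OF y] Ms[of "G.shift x 1" y 1] x by (auto simp: G.shift_shift G.shift_0)
    moreover have "v = w" if vw: "(x, v) \<in> M" "(x, w) \<in> M" for v w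
    proof -
      obtain b where b: "w = L.shift v b" using corr_unique_right[OF \<rho> Mc(3)[OF vw(1)] Mc(3)[OF vw(2)]] .
      have v: "v \<in> carrier L" using Mc vw by blast
      have "(G.shift x b, v) \<in> M" using Ms[OF vw(2), of b] v b by (simp add: L.shift_shift L.shift_0)
      then have "b \<noteq> 1" using no vw(1) by blast
      then show ?thesis using b by (simp add: L.shift_0)
    qed
    ultimately show ?thesis by blast
  qed
  define \<phi> where "\<phi> x = (THE y. (x, y) \<in> M)" for x
  have \<phi>: "(x, \<phi> x) \<in> M" if "x \<in> carrier G" for x unfolding \<phi>_def using theI'[OF ex[OF that]] .
  have \<phi>_eq: "\<phi> x = y" if "(x, y) \<in> M" for x y
    unfolding \<phi>_def using ex[OF Mc(1)[OF that]] that by (intro the1_equality)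
  have inj: "x = u" if xu: "(x, y) \<in> M" "(u, y) \<in> M" for x u y
  proof -
    obtain b where b: "x = G.shift u b" using corr_unique_left[OF \<rho> Mc(3)[OF xu(2)] Mc(3)[OF xu(1)]] .
    then have "b \<noteq> 1" using no xu by blast
    then show ?thesis using b by (simp add: G.shift_0)
  qed
  have "\<phi> \<in> hom G L"
  proof (rule homI)
    fix x y assume xy: "x \<in> carrier G" "y \<in> carrier G"
    show "\<phi> x \<in> carrier L" by (rule Mc(2)[OF \<phi>[OF xy(1)]])
    show "\<phi> (x \<otimes>\<^bsub>G\<^esub> y) = \<phi> x \<otimes>\<^bsub>L\<^esub> \<phi> y"
      by (rule \<phi>_eq[OF Mm[OF \<phi>[OF xy(1)] \<phi>[OF xy(2)]]])
  qed
  moreover have "inj_on \<phi> (carrier G)" by (rule inj_onI) (metis inj \<phi>)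
  moreover have "y \<in> \<phi> ` carrier G" if "y \<in> carrier L" for y
  proof -
    have "y \<in> Range \<rho>" using that ran by simp
    then obtain x where "(x, y) \<in> \<rho>" by (rule RangeE)
    then have "(x, y) \<in> M \<or> (G.shift x 1, y) \<in> M" by (rule half)
    then obtain u where u: "(u, y) \<in> M" by (elim disjE) auto
    show ?thesis using \<phi>_eq[OF u] Mc(1)[OF u] by (intro image_eqI[of _ _ u]) simp_all
  qed
  then have "\<phi> ` carrier G = carrier L" using Mc(2)[OF \<phi>] by (intro subset_antisym subsetI) auto
  ultimately show ?thesis by (intro is_isoI isoI) (simp_all add: bij_betw_def)
qed

end

context code_loop_pair
begin

lemma saturated_Times:
  assumes A: "G.mod_z.saturated A" and B: "L.mod_z.saturated B"
  shows "pair.saturated (A \<times> B)"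
  unfolding pair.saturated_def
proof (intro conjI ballI impI)
  note DA = G.mod_z.saturatedD[OF A] and DB = L.mod_z.saturatedD[OF B]
  show "A \<times> B \<subseteq> carrier G \<times> carrier L" using DA(1) DB(1) by auto
  show "A \<times> B \<noteq> {}" using A B by (auto simp: G.mod_z.saturated_def L.mod_z.saturated_def)
  fix p assume p: "p \<in> A \<times> B"
  show "pair_mult p q \<in> A \<times> B" if "q \<in> A \<times> B" for q
    using DA(2)[of "fst p" "fst q"] DB(2)[of "snd p" "snd q"] p that by (simp add: mem_Times_iff)
  fix q assume "q \<in> carrier G \<times> carrier L"
    and "(\<exists>b. fst q = G.shift (fst p) b) \<and> (\<exists>b. snd q = L.shift (snd p) b)"
  then show "q \<in> A \<times> B"
    using DA(3)[of "fst p" "fst q"] DB(3)[of "snd p" "snd q"] p by (simp add: mem_Times_iff)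
qed

text \<open>
  A bijection \<open>f\<close> preserving associators need not be multiplicative, but it is so modulo the nuclei.
  A maximal correspondence congruent to \<open>f\<close> modulo the nucleus of \<open>L\<close> is everywhere defined:
  if all candidates for the image of \<open>v\<close> were already used, then so would be the whole nucleus
  of \<open>L\<close>, and counting would put \<open>v\<close> into the domain.
\<close>

lemma ex_correspondence:
  assumes bij: "bij_betw f (carrier G) (carrier L)"
    and f: "\<And>x y w. \<lbrakk>x \<in> carrier G; y \<in> carrier G; w \<in> carrier G\<rbrakk>
      \<Longrightarrow> assoc_form L (f x) (f y) (f w) = assoc_form G x y w"
  obtains \<rho> where "correspondence \<rho>" "Domain \<rho> = carrier G" "Range \<rho> = carrier L"
    "\<And>x y u v w k. \<lbrakk>(x, y) \<in> \<rho>; (u, v) \<in> \<rho>; (w, k) \<in> \<rho>\<rbrakk> \<Longrightarrow> assoc_form L y v k = assoc_form G x u w"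
proof -
  have fc: "f x \<in> carrier L" if "x \<in> carrier G" for x using bij that bij_betwE by blast
  have surj: "\<exists>x\<in>carrier G. y = f x" if "y \<in> carrier L" for y
    using bij that by (metis bij_betw_imp_surj_on imageE)
  \<comment> \<open>Congruence modulo the nucleus of \<open>L\<close>, phrased with associators
    because \<open>f\<close> respects nothing else.\<close>
  define sim where "sim y y' \<longleftrightarrow> (\<forall>b\<in>carrier L. \<forall>c\<in>carrier L. assoc_form L y b c = assoc_form L y' b c)" for y y'
  have sim_sym: "sim y y' \<Longrightarrow> sim y' y" and sim_refl: "sim y y"
    and sim_trans: "sim y y' \<Longrightarrow> sim y' y'' \<Longrightarrow> sim y y''" for y y' y'' by (simp_all add: sim_def)
  have sim_f: "sim (f x) (f y) \<longleftrightarrow> (\<forall>b\<in>carrier G. \<forall>c\<in>carrier G. assoc_form G x b c = assoc_form G y b c)"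
    if "x \<in> carrier G" "y \<in> carrier G" for x y
  proof
    assume s: "sim (f x) (f y)"
    show "\<forall>b\<in>carrier G. \<forall>c\<in>carrier G. assoc_form G x b c = assoc_form G y b c"
    proof (intro ballI)
      fix b c assume bc: "b \<in> carrier G" "c \<in> carrier G"
      then have "assoc_form L (f x) (f b) (f c) = assoc_form L (f y) (f b) (f c)"
        using s fc unfolding sim_def by blast
      then show "assoc_form G x b c = assoc_form G y b c" using f that bc by simp
    qed
  next
    assume "\<forall>b\<in>carrier G. \<forall>c\<in>carrier G. assoc_form G x b c = assoc_form G y b c"
    then have "assoc_form L (f x) (f b) (f c) = assoc_form L (f y) (f b) (f c)"
      if "b \<in> carrier G" "c \<in> carrier G" for b c
      using f \<open>x \<in> carrier G\<close> \<open>y \<in> carrier G\<close> that by simp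
    then show "sim (f x) (f y)" using surj unfolding sim_def by blast
  qed
  have sim_mult: "sim (y \<otimes>\<^bsub>L\<^esub> v) (y' \<otimes>\<^bsub>L\<^esub> v')"
    if "sim y y'" "sim v v'" "y \<in> carrier L" "y' \<in> carrier L" "v \<in> carrier L" "v' \<in> carrier L" for y y' v v'
    using that by (simp add: sim_def L.assoc_form_add1)
  have sim_cancel: "sim v v'"
    if "sim (y \<otimes>\<^bsub>L\<^esub> v) (y' \<otimes>\<^bsub>L\<^esub> v')" "sim y y'" "y \<in> carrier L" "y' \<in> carrier L" "v \<in> carrier L" "v' \<in> carrier L" for y y' v v'
    using that by (simp add: sim_def L.assoc_form_add1)
  \<comment> \<open>All elements of \<open>L\<close> are values of \<open>f\<close>, and both
    associator forms are additive.\<close>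
  have f_mult: "sim (f (x \<otimes>\<^bsub>G\<^esub> y)) (f x \<otimes>\<^bsub>L\<^esub> f y)" if "x \<in> carrier G" "y \<in> carrier G" for x y
    unfolding sim_def
  proof (intro ballI)
    fix b c assume "b \<in> carrier L" "c \<in> carrier L"
    then obtain b' c' where "b' \<in> carrier G" "b = f b'" "c' \<in> carrier G" "c = f c'" using surj by metis
    then show "assoc_form L (f (x \<otimes>\<^bsub>G\<^esub> y)) b c = assoc_form L (f x \<otimes>\<^bsub>L\<^esub> f y) b c"
      using that by (simp add: f fc G.m_closed L.assoc_form_add1 G.assoc_form_add1)
  qed
  define good where "good \<rho> \<longleftrightarrow> correspondence \<rho> \<and> (\<forall>(x, y)\<in>\<rho>. sim y (f x))" for \<rho>
  let ?U0 = "{\<one>\<^bsub>G\<^esub>, z} \<times> {\<one>\<^bsub>L\<^esub>, t}"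
  have base: "good ?U0"
  proof -
    have "pair.saturated ?U0" by (rule saturated_Times[OF G.saturated_one_z L.saturated_one_z])
    moreover have "sim y (f x)" if "x \<in> {\<one>\<^bsub>G\<^esub>, z}" "y \<in> {\<one>\<^bsub>L\<^esub>, t}" for x y
    proof -
      have x: "x \<in> carrier G" using that G.one_closed G.z_closed by auto
      have "assoc_form L (f x) b c = 0" if bc: "b \<in> carrier L" "c \<in> carrier L" for b c
      proof -
        obtain b' c' where "b' \<in> carrier G" "b = f b'" "c' \<in> carrier G" "c = f c'" using surj bc by metis
        then show ?thesis using f[OF x] \<open>x \<in> {\<one>\<^bsub>G\<^esub>, z}\<close> by auto
      qed
      moreover have "assoc_form L y b c = 0" if "b \<in> carrier L" "c \<in> carrier L" for b c
        using \<open>y \<in> {\<one>\<^bsub>L\<^esub>, t}\<close> that by auto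
      ultimately show ?thesis by (simp add: sim_def)
    qed
    ultimately show ?thesis unfolding good_def correspondence_def by blast
  qed
  have "finite {\<rho>. good \<rho>}"
    by (rule finite_subset[of _ "Pow (carrier G \<times> carrier L)"])
      (auto simp: good_def correspondence_def pair.saturated_def G.finite_carrier L.finite_carrier)
  then obtain \<rho> where g: "good \<rho>" and max: "\<forall>\<rho>'\<in>{\<rho>. good \<rho>}. \<rho> \<subseteq> \<rho>' \<longrightarrow> \<rho> = \<rho>'"
    using finite_has_maximal[of "{\<rho>. good \<rho>}"] base by blast
  have \<rho>: "correspondence \<rho>" and \<rho>_sim: "\<And>x y. (x, y) \<in> \<rho> \<Longrightarrow> sim y (f x)"
    using g unfolding good_def by blast+
  note c = corr_carrier[OF \<rho>] and mult = corr_mult[OF \<rho>] and sat = corr_saturated[OF \<rho>]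
  have shift_dom: "(G.shift x b, y) \<in> \<rho> \<longleftrightarrow> (x, y) \<in> \<rho>" if "x \<in> carrier G" for x y b
    using corr_shift[OF \<rho>, of x y b 0] corr_shift[OF \<rho>, of "G.shift x b" y b 0] that
    by (auto simp: G.shift_shift G.shift_0 L.shift_0)
  have shift_ran: "(x, L.shift y b) \<in> \<rho> \<longleftrightarrow> (x, y) \<in> \<rho>" if "y \<in> carrier L" for x y b
    using corr_shift[OF \<rho>, of x y 0 b] corr_shift[OF \<rho>, of x "L.shift y b" 0 b] that
    by (auto simp: L.shift_shift G.shift_0 L.shift_0)
  have dom_cancel: "v \<in> Domain \<rho>" if uv: "u \<in> Domain \<rho>" "u \<otimes>\<^bsub>G\<^esub> v \<in> Domain \<rho>" "v \<in> carrier G" for u v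
  proof -
    obtain y y' where yy: "(u, y) \<in> \<rho>" "(u \<otimes>\<^bsub>G\<^esub> v, y') \<in> \<rho>" using uv by blast
    have "(u \<otimes>\<^bsub>G\<^esub> (u \<otimes>\<^bsub>G\<^esub> v), y \<otimes>\<^bsub>L\<^esub> y') \<in> \<rho>" by (rule mult[OF yy])
    then show ?thesis using shift_dom[OF uv(3)] c[OF yy(1)] uv(3) by (auto simp: G.left_alt)
  qed
  have dom: "Domain \<rho> = carrier G"
  proof (rule ccontr)
    assume "Domain \<rho> \<noteq> carrier G"
    then obtain v where v: "v \<in> carrier G" "v \<notin> Domain \<rho>" using c by blast
    have "\<exists>w. w \<in> carrier L \<and> sim w (f v) \<and> w \<notin> Range \<rho>"
    proof (rule ccontr)
      assume "\<nexists>w. w \<in> carrier L \<and> sim w (f v) \<and> w \<notin> Range \<rho>"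
      then have used: "w \<in> Range \<rho>" if "w \<in> carrier L" "sim w (f v)" for w using that by blast
      obtain u where u: "(u, f v) \<in> \<rho>" using used[OF fc[OF v(1)] sim_refl] by blast
      have uc: "u \<in> carrier G" using c[OF u] by blast
      \<comment> \<open>\<open>N\<close> and \<open>N'\<close> are the two nuclei, which
        \<open>f\<close> maps onto each other, and \<sigma> is the part of \<rho> between them.
        Equal cardinalities will put all of \<open>N\<close> into the domain.\<close>
      define N where "N = {x \<in> carrier G. sim (f x) \<one>\<^bsub>L\<^esub>}"
      define N' where "N' = {y \<in> carrier L. sim y \<one>\<^bsub>L\<^esub>}"
      define \<sigma> where "\<sigma> = {(x, y) \<in> \<rho>. x \<in> N}"
      have N_iff: "x \<in> N \<longleftrightarrow> y \<in> N'" if "(x, y) \<in> \<rho>" for x y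
        using \<rho>_sim[OF that] c[OF that] sim_sym sim_trans unfolding N_def N'_def by blast
      have "Range \<sigma> = N'"
      proof
        show "Range \<sigma> \<subseteq> N'" using N_iff by (auto simp: \<sigma>_def)
        show "N' \<subseteq> Range \<sigma>"
        proof
          fix r assume r: "r \<in> N'"
          then have rc: "r \<in> carrier L" "sim r \<one>\<^bsub>L\<^esub>" by (simp_all add: N'_def)
          have "sim (f v \<otimes>\<^bsub>L\<^esub> r) (f v \<otimes>\<^bsub>L\<^esub> \<one>\<^bsub>L\<^esub>)"
            using rc fc[OF v(1)] sim_refl L.one_closed by (intro sim_mult)
          then have "f v \<otimes>\<^bsub>L\<^esub> r \<in> Range \<rho>"
            using used rc fc[OF v(1)] by (simp add: L.r_one L.m_closed)
          then obtain u' where u': "(u', f v \<otimes>\<^bsub>L\<^esub> r) \<in> \<rho>" by blast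
          have "(u \<otimes>\<^bsub>G\<^esub> u', f v \<otimes>\<^bsub>L\<^esub> (f v \<otimes>\<^bsub>L\<^esub> r)) \<in> \<rho>" by (rule mult[OF u u'])
          then have "(u \<otimes>\<^bsub>G\<^esub> u', r) \<in> \<rho>"
            using shift_ran rc fc[OF v(1)] by (simp add: L.left_alt)
          then show "r \<in> Range \<sigma>" using N_iff r by (auto simp: \<sigma>_def)
        qed
      qed
      moreover have "card (Domain \<sigma>) = card (Range \<sigma>)"
      proof (rule corr_card[OF \<rho>])
        show "\<sigma> \<subseteq> \<rho>" by (auto simp: \<sigma>_def)
        fix x y b d assume "(x, y) \<in> \<sigma>"
        then have xy: "(x, y) \<in> \<rho>" "x \<in> N" by (auto simp: \<sigma>_def)
        have "y \<in> N'" using N_iff xy by blast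
        then have "L.shift y d \<in> N'" using c[OF xy(1)] by (simp add: N'_def sim_def L.shift_closed)
        then show "(G.shift x b, L.shift y d) \<in> \<sigma>"
          using corr_shift[OF \<rho> xy(1), of b d] N_iff by (simp add: \<sigma>_def)
      qed
      moreover have "card N = card N'"
      proof (rule bij_betw_same_card)
        show "bij_betw f N N'" unfolding bij_betw_def
        proof
          show "inj_on f N" using bij by (auto simp: N_def bij_betw_def intro: inj_on_subset)
          show "f ` N = N'"
          proof
            show "f ` N \<subseteq> N'" using fc by (auto simp: N_def N'_def)
            show "N' \<subseteq> f ` N"
            proof
              fix y assume y: "y \<in> N'"
              then obtain x where "x \<in> carrier G" "y = f x" using surj[of y] by (auto simp: N'_def)
              then show "y \<in> f ` N" using y by (simp add: N_def N'_def)
            qed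
          qed
        qed
      qed
      ultimately have "card (Domain \<sigma>) = card N" by simp
      moreover have "Domain \<sigma> \<subseteq> N" by (auto simp: \<sigma>_def)
      moreover have "finite N" using G.finite_carrier by (simp add: N_def)
      ultimately have "Domain \<sigma> = N" by (simp add: card_subset_eq)
      then have "N \<subseteq> Domain \<rho>" by (auto simp: \<sigma>_def)
      \<comment> \<open>\<open>u\<close> and \<open>v\<close> have the same associators, so
        \<open>u v\<close> is nuclear and lies in the domain; cancelling \<open>u\<close> then
        yields \<open>v\<close>.\<close>
      moreover have "u \<otimes>\<^bsub>G\<^esub> v \<in> N"
      proof -
        have "assoc_form G u b c = assoc_form G v b c" if "b \<in> carrier G" "c \<in> carrier G" for b c
          using sim_f[OF v(1) uc] \<rho>_sim[OF u] that by auto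
        then have "sim (f (u \<otimes>\<^bsub>G\<^esub> v)) (f \<one>\<^bsub>G\<^esub>)"
          using uc v(1) by (subst sim_f) (simp_all add: G.m_closed G.one_closed G.assoc_form_add1)
        moreover have "sim \<one>\<^bsub>L\<^esub> (f \<one>\<^bsub>G\<^esub>)" using base by (auto simp: good_def)
        ultimately have "sim (f (u \<otimes>\<^bsub>G\<^esub> v)) \<one>\<^bsub>L\<^esub>" using sim_sym sim_trans by metis
        then show ?thesis using uc v(1) by (simp add: N_def G.m_closed)
      qed
      ultimately have "v \<in> Domain \<rho>" using dom_cancel[of u v] u v(1) by blast
      then show False using v by blast
    qed
    then obtain w where w: "w \<in> carrier L" "sim w (f v)" "w \<notin> Range \<rho>" by blast
    have vw: "(v, w) \<in> carrier G \<times> carrier L" using v w by simp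
    note adj = pair.saturated_adjoin[OF sat vw]
    \<comment> \<open>For a new pair, a central first component would put \<open>v\<close> into the
      domain and a central second one would put \<open>w\<close> into the range. Hence the condition
      on the central subloops survives.\<close>
    have "good (pair.adjoin (v, w) \<rho>)"
      unfolding good_def correspondence_def
    proof (intro conjI adj(1) ballI)
      fix p assume "p \<in> pair.adjoin (v, w) \<rho>"
      then obtain x y where p: "p = (x, y)" and xy: "x \<in> carrier G" "y \<in> carrier L"
        and alt: "(x, y) \<in> \<rho> \<or> (v \<otimes>\<^bsub>G\<^esub> x, w \<otimes>\<^bsub>L\<^esub> y) \<in> \<rho>"
        by (cases p) (auto simp: pair.adjoin_def)
      have "(x \<in> {\<one>\<^bsub>G\<^esub>, z} \<longleftrightarrow> y \<in> {\<one>\<^bsub>L\<^esub>, t}) \<and> sim y (f x)"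
        using alt
      proof
        assume "(x, y) \<in> \<rho>"
        then show ?thesis using corr_Z[OF \<rho>] \<rho>_sim by blast
      next
        assume vx: "(v \<otimes>\<^bsub>G\<^esub> x, w \<otimes>\<^bsub>L\<^esub> y) \<in> \<rho>"
        have "x \<notin> {\<one>\<^bsub>G\<^esub>, z}"
        proof
          assume "x \<in> {\<one>\<^bsub>G\<^esub>, z}"
          then obtain b where "x = G.shift \<one>\<^bsub>G\<^esub> b" using G.shift_one_iff by blast
          then have "(v, w \<otimes>\<^bsub>L\<^esub> y) \<in> \<rho>"
            using vx shift_dom v by (simp add: G.shift_mult_right G.r_one G.one_closed)
          then show False using v by blast
        qed
        moreover have "y \<notin> {\<one>\<^bsub>L\<^esub>, t}"
        proof
          assume "y \<in> {\<one>\<^bsub>L\<^esub>, t}"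
          then obtain b where "y = L.shift \<one>\<^bsub>L\<^esub> b" using L.shift_one_iff by blast
          then have "(v \<otimes>\<^bsub>G\<^esub> x, w) \<in> \<rho>"
            using vx shift_ran w by (simp add: L.shift_mult_right L.r_one L.one_closed)
          then show False using w by blast
        qed
        moreover have "sim y (f x)"
        proof (rule sim_cancel[OF _ w(2)])
          show "sim (w \<otimes>\<^bsub>L\<^esub> y) (f v \<otimes>\<^bsub>L\<^esub> f x)"
            by (rule sim_trans[OF \<rho>_sim[OF vx] f_mult[OF v(1) xy(1)]])
        qed (use w v xy fc in simp_all)
        ultimately show ?thesis by simp
      qed
      then show "case p of (x, y) \<Rightarrow> x \<in> {\<one>\<^bsub>G\<^esub>, z} \<longleftrightarrow> y \<in> {\<one>\<^bsub>L\<^esub>, t}" "case p of (x, y) \<Rightarrow> sim y (f x)"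
        using p by simp_all
    qed
    then have "\<rho> = pair.adjoin (v, w) \<rho>" using max adj(2) by blast
    then have "(v, w) \<in> \<rho>" using adj(3) by simp
    then show False using v by blast
  qed
  have "card (Domain \<rho>) = card (Range \<rho>)" by (rule corr_card[OF \<rho>]) (auto intro: corr_shift[OF \<rho>])
  then have "card (Range \<rho>) = card (carrier L)" using dom bij_betw_same_card[OF bij] by simp
  moreover have "Range \<rho> \<subseteq> carrier L" using c by auto
  ultimately have ran: "Range \<rho> = carrier L" using L.finite_carrier by (simp add: card_subset_eq)
  have "assoc_form L y v k = assoc_form G x u w" if xy: "(x, y) \<in> \<rho>" "(u, v) \<in> \<rho>" "(w, k) \<in> \<rho>" for x y u v w k
  proof -
    note cc = c[OF xy(1)] c[OF xy(2)] c[OF xy(3)]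
    note ff = fc[of x] fc[of u] fc[of w]
    \<comment> \<open>\<open>sim\<close> replaces only the first argument, so symmetry brings each
      argument to the front in turn.\<close>
    have "assoc_form L y v k = assoc_form L (f x) v k"
      using \<rho>_sim[OF xy(1)] cc unfolding sim_def by blast
    also have "\<dots> = assoc_form L v (f x) k" using cc ff by (intro L.assoc_form_swap12) auto
    also have "\<dots> = assoc_form L (f u) (f x) k"
      using \<rho>_sim[OF xy(2)] cc ff unfolding sim_def by blast
    also have "\<dots> = assoc_form L k (f x) (f u)" using cc ff by (intro L.assoc_form_swap13) auto
    also have "\<dots> = assoc_form L (f w) (f x) (f u)"
      using \<rho>_sim[OF xy(3)] cc ff unfolding sim_def by blast
    also have "\<dots> = assoc_form G w x u" using cc f by blast
    also have "\<dots> = assoc_form G x w u" using cc by (intro G.assoc_form_swap12) auto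
    also have "\<dots> = assoc_form G x u w" using cc by (intro G.assoc_form_swap23) auto
    finally show ?thesis .
  qed
  then show ?thesis using that \<rho> dom ran by blast
qed

end

text \<open>All steps stay on the carrier of \<open>G\<close>; only the last loop is compared with
  \<open>L\<close>, through a correspondence rather than a map.\<close>

lemma equivalent_code_loops_reachable:
  fixes G :: "'a monoid" and L :: "'b monoid"
  assumes "code_loop G" "code_loop L" "equivalent_associators G L"
  obtains H where "step\<^sup>*\<^sup>* G H" "H \<cong> L"
proof -
  obtain z t where "based_code_loop G z" "based_code_loop L t" using assms by (auto simp: code_loop_iff)
  then interpret code_loop_pair G z L t by (simp add: code_loop_pair_def)
  obtain f where bij: "bij_betw f (carrier G) (carrier L)"
    and f: "\<And>x y w. \<lbrakk>x \<in> carrier G; y \<in> carrier G; w \<in> carrier G\<rbrakk>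
      \<Longrightarrow> f (associator G x y w) = associator L (f x) (f y) (f w)"
    using assms(3) unfolding equivalent_associators_def by blast
  have fc: "f x \<in> carrier L" if "x \<in> carrier G" for x using bij that bij_betwE by blast
  have inj: "x = y" if "f x = f y" "x \<in> carrier G" "y \<in> carrier G" for x y
    using bij that by (meson bij_betw_imp_inj_on inj_onD)
  have f': "f (G.shift \<one>\<^bsub>G\<^esub> (assoc_form G x y w)) = L.shift \<one>\<^bsub>L\<^esub> (assoc_form L (f x) (f y) (f w))"
    if "x \<in> carrier G" "y \<in> carrier G" "w \<in> carrier G" for x y w
    using f[OF that] that by (simp add: G.associator_eq L.associator_eq fc)
  have f1: "f \<one>\<^bsub>G\<^esub> = \<one>\<^bsub>L\<^esub>"
    using f'[of "\<one>\<^bsub>G\<^esub>" "\<one>\<^bsub>G\<^esub>" "\<one>\<^bsub>G\<^esub>"] fc by (simp add: G.one_closed G.shift_0 L.shift_0)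
  have f_assoc: "assoc_form L (f x) (f y) (f w) = assoc_form G x y w"
    if "x \<in> carrier G" "y \<in> carrier G" "w \<in> carrier G" for x y w
  proof (cases "assoc_form G x y w")
    case zero
    then have "L.shift \<one>\<^bsub>L\<^esub> (assoc_form L (f x) (f y) (f w)) = \<one>\<^bsub>L\<^esub>"
      using f'[OF that] f1 by (metis G.shift_0)
    then show ?thesis using zero by (simp add: L.shift_eq_one_iff)
  next
    case one
    then have "L.shift \<one>\<^bsub>L\<^esub> (assoc_form L (f x) (f y) (f w)) = f z"
      using f'[OF that] by (simp add: G.z_shift)
    moreover have "f z \<noteq> \<one>\<^bsub>L\<^esub>" using inj[of z "\<one>\<^bsub>G\<^esub>"] f1 G.z_closed G.one_closed G.z_neq_one by auto
    ultimately show ?thesis using one by (cases "assoc_form L (f x) (f y) (f w)") (simp_all add: L.shift_0)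
  qed
  obtain \<rho> where \<rho>: "correspondence \<rho>" and dom: "Domain \<rho> = carrier G" and ran: "Range \<rho> = carrier L"
    and \<rho>_assoc: "\<And>x y u v w k. \<lbrakk>(x, y) \<in> \<rho>; (u, v) \<in> \<rho>; (w, k) \<in> \<rho>\<rbrakk>
      \<Longrightarrow> assoc_form L y v k = assoc_form G x u w"
    by (rule ex_correspondence[OF bij f_assoc]) (assumption | rule that)+
  note c = corr_carrier[OF \<rho>] and mult = corr_mult[OF \<rho>]
  define g where "g x = (SOME y. (x, y) \<in> \<rho>)" for x
  have g: "(x, g x) \<in> \<rho>" if x: "x \<in> carrier G" for x
  proof -
    have "x \<in> Domain \<rho>" using x dom by simp
    then obtain y where "(x, y) \<in> \<rho>" by (rule DomainE)
    then show ?thesis unfolding g_def by (rule someI)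
  qed
  \<comment> \<open>The squaring map of \<open>L\<close> transported to \<open>G\<close>. By
    \<open>corr_unique_right\<close> it does not depend on the choice of \<open>g\<close>.\<close>
  define P where "P x = sq_bit L (g x)" for x
  have P_eq: "P x = sq_bit L y" if xy: "(x, y) \<in> \<rho>" for x y
  proof -
    obtain b where "g x = L.shift y b" using corr_unique_right[OF \<rho> xy g] c[OF xy] by blast
    then show ?thesis using c[OF xy] by (simp add: P_def)
  qed
  define Q where "Q x = sq_bit G x + P x" for x
  have "G.quadratic Q"
    unfolding G.quadratic_def
  proof (intro conjI ballI allI)
    fix x b assume x: "x \<in> carrier G"
    have "(G.shift x b, g x) \<in> \<rho>" using corr_shift[OF \<rho> g[OF x], of b 0] by (simp add: L.shift_0)
    then show "Q (G.shift x b) = Q x"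
      using P_eq x by (simp add: Q_def P_def)
  next
    fix x y w assume xyw: "x \<in> carrier G" "y \<in> carrier G" "w \<in> carrier G"
    have polar: "G.polar Q u v = comm_form G u v + comm_form L u' v'"
      if "(u, u') \<in> \<rho>" "(v, v') \<in> \<rho>" for u u' v v'
      using P_eq[OF that(1)] P_eq[OF that(2)] P_eq[OF mult[OF that]]
      by (simp add: G.polar_def Q_def comm_form_def ac_simps)
    \<comment> \<open>The associators agree along \<rho>, so the commutator forms of both loops have
      the same additivity defect, and it cancels in the polar form of their difference.\<close>
    have "comm_form L (g x \<otimes>\<^bsub>L\<^esub> g y) (g w) + comm_form L (g x) (g w) + comm_form L (g y) (g w)
      = comm_form G (x \<otimes>\<^bsub>G\<^esub> y) w + comm_form G x w + comm_form G y w"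
      using \<rho>_assoc[OF g[OF xyw(1)] g[OF xyw(2)] g[OF xyw(3)]] by (simp add: assoc_form_eq)
    then have "comm_form L (g x \<otimes>\<^bsub>L\<^esub> g y) (g w) + comm_form L (g x) (g w) + comm_form L (g y) (g w)
      + (comm_form G (x \<otimes>\<^bsub>G\<^esub> y) w + comm_form G x w + comm_form G y w) = 0" by simp
    then show "G.polar Q (x \<otimes>\<^bsub>G\<^esub> y) w
      = G.polar Q x w + G.polar Q y w"
      by (subst bit_eq_iff_add)
        (simp add: polar[OF mult[OF g[OF xyw(1)] g[OF xyw(2)]] g[OF xyw(3)]] polar[OF g[OF xyw(1)] g[OF xyw(3)]]
          polar[OF g[OF xyw(2)] g[OF xyw(3)]] ac_simps)
  qed
  then obtain ps where ps: "\<forall>(l, m)\<in>set ps. G.functional l \<and> G.functional m"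
    "\<And>x. x \<in> carrier G \<Longrightarrow> Q x = (\<Sum>(l, m)\<leftarrow>ps. l x * m x)"
    by (rule G.quadratic_decomposition) (rule that)
  obtain H where H: "step\<^sup>*\<^sup>* G H" "based_code_loop H z" "carrier H = carrier G" "\<one>\<^bsub>H\<^esub> = \<one>\<^bsub>G\<^esub>"
    "\<And>x y. \<lbrakk>x \<in> carrier G; y \<in> carrier G\<rbrakk> \<Longrightarrow> \<exists>b. x \<otimes>\<^bsub>H\<^esub> y = G.shift (x \<otimes>\<^bsub>G\<^esub> y) b"
    "\<And>x b. x \<in> carrier G \<Longrightarrow> central_involution.shift H z x b = G.shift x b"
    "\<And>x. x \<in> carrier G \<Longrightarrow> sq_bit H x = sq_bit G x + (\<Sum>(l, m)\<leftarrow>ps. l x * m x)"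
    using twists_reachable[OF G.based_code_loop_axioms ps(1)] by metis
  interpret H: based_code_loop H z by (rule H(2))
  interpret HL: code_loop_pair H z L t by unfold_locales
  \<comment> \<open>Products in \<open>H\<close> and \<open>G\<close> differ only by powers of
    \<open>z\<close>, which \<rho> does not distinguish.\<close>
  have "HL.correspondence \<rho>"
  proof -
    have H_mult: "(x \<otimes>\<^bsub>H\<^esub> u, y \<otimes>\<^bsub>L\<^esub> v) \<in> \<rho>" if xu: "(x, y) \<in> \<rho>" "(u, v) \<in> \<rho>" for x y u v
    proof -
      obtain b where "x \<otimes>\<^bsub>H\<^esub> u = G.shift (x \<otimes>\<^bsub>G\<^esub> u) b" using H(5) c[OF xu(1)] c[OF xu(2)] by blast
      then show ?thesis using corr_shift[OF \<rho> mult[OF xu], of b 0] by (simp add: L.shift_0)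
    qed
    have H_shift: "(H.shift x b, L.shift y d) \<in> \<rho>" if "(x, y) \<in> \<rho>" for x y b d
      using corr_shift[OF \<rho> that, of b d] H(6) c[OF that] by simp
    have "HL.pair.saturated \<rho>"
      unfolding HL.pair.saturated_def
    proof (intro conjI ballI impI)
      show "\<rho> \<subseteq> carrier H \<times> carrier L" using c H(3) by auto
      show "\<rho> \<noteq> {}" using corr_one[OF \<rho>] by blast
      fix p assume "p \<in> \<rho>"
      moreover obtain x y where p: "p = (x, y)" by fastforce
      ultimately have xy: "(x, y) \<in> \<rho>" by simp
      show "HL.pair_mult p q \<in> \<rho>" if "q \<in> \<rho>" for q
        using H_mult[OF xy, of "fst q" "snd q"] that p by simp
      fix q assume "(\<exists>b. fst q = H.shift (fst p) b) \<and> (\<exists>b. snd q = L.shift (snd p) b)"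
      then obtain b d where "q = (H.shift x b, L.shift y d)" using p by (metis fst_conv prod.collapse snd_conv)
      then show "q \<in> \<rho>" using H_shift[OF xy] by simp
    qed
    then show ?thesis using \<rho> by (simp add: HL.correspondence_def correspondence_def H(4))
  qed
  moreover have "sq_bit H x = sq_bit L y" if "(x, y) \<in> \<rho>" for x y
  proof -
    have "sq_bit H x = sq_bit G x + Q x" using H(7) ps(2) c[OF that] by simp
    then show ?thesis by (simp add: Q_def P_eq[OF that])
  qed
  ultimately have "H \<cong> L" using dom ran H(3) by (intro HL.correspondence_iso[of \<rho>]) simp_all
  then show ?thesis using that H(1) by blast
qed

lemma steps_chain:
  fixes G :: "'a monoid"
  assumes "step\<^sup>*\<^sup>* G K" "loop G"
  obtains s :: nat and H where "\<forall>i\<le>s. loop (H i)" "H 0 = G" "H s = K"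
    "\<forall>i<s. obtained_by_cyclic (H i) (H (Suc i)) \<or> obtained_by_dihedral (H i) (H (Suc i))"
proof -
  obtain s where "(step ^^ s) G K" using assms(1) by (auto simp: rtranclp_power)
  then obtain H where H: "H 0 = G" "H s = K" "\<forall>i<s. step (H i) (H (Suc i))"
    by (auto simp: relpowp_fun_conv)
  have "loop (H i)" if "i \<le> s" for i
    using H assms(2) that by (cases i) (auto simp: step_def)
  then show ?thesis using that[of s H] H by (simp add: step_def)
qed

theorem theorem8p8:
  shows
    "(\<forall>(G :: 'a monoid) S h. code_loop_trivial_radical G \<longrightarrow>
        (\<forall>m \<alpha>. condition_C m G S \<alpha> h \<longrightarrow>
           (G Mod S \<cong> C2 \<or> G Mod S \<cong> V4) \<and>
           code_loop_trivial_radical (cyclic_construction m G S \<alpha> h) \<and>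
           equivalent_associators G (cyclic_construction m G S \<alpha> h)) \<and>
        (\<forall>m \<beta> \<gamma>. condition_D m G S \<beta> \<gamma> h \<longrightarrow>
           (G Mod S \<cong> C2 \<or> G Mod S \<cong> V4) \<and>
           (\<forall>e\<in>\<beta>. \<forall>f\<in>\<gamma>.
              code_loop_trivial_radical (dihedral_construction m G S \<beta> \<gamma> e f h) \<and>
              equivalent_associators G (dihedral_construction m G S \<beta> \<gamma> e f h))))
     \<and>
     (\<forall>(L :: 'b monoid) (G :: 'c monoid).
        moufang_loop L \<and> code_loop_trivial_radical G \<and> equivalent_associators L G \<longrightarrow>
        code_loop_trivial_radical L)
     \<and>
     (\<forall>(G :: 'd monoid) (G' :: 'e monoid).
        code_loop G \<and> code_loop G' \<and> equivalent_associators G G' \<longrightarrow>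
        (\<exists>(s :: nat) (H :: nat \<Rightarrow> 'd monoid).
           (\<forall>i\<le>s. loop (H i)) \<and> H 0 \<cong> G \<and> H s \<cong> G' \<and>
           (\<forall>i<s. obtained_by_cyclic (H i) (H (Suc i)) \<or>
                  obtained_by_dihedral (H i) (H (Suc i)))))"
proof (intro conjI allI impI)
  fix G :: "'a monoid" and S h m \<alpha>
  assume "code_loop_trivial_radical G" "condition_C m G S \<alpha> h"
  note * = cyclic_construction_code_loop[OF this]
  show "G Mod S \<cong> C2 \<or> G Mod S \<cong> V4" "code_loop_trivial_radical (cyclic_construction m G S \<alpha> h)"
    "equivalent_associators G (cyclic_construction m G S \<alpha> h)" using * by blast+
next
  fix G :: "'a monoid" and S h m \<beta> \<gamma>
  assume "code_loop_trivial_radical G" and D: "condition_D m G S \<beta> \<gamma> h"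
  note * = dihedral_construction_code_loop[OF this]
  show "G Mod S \<cong> C2 \<or> G Mod S \<cong> V4" using * condition_D_nonempty[OF D] by blast
  show "\<forall>e\<in>\<beta>. \<forall>f\<in>\<gamma>. code_loop_trivial_radical (dihedral_construction m G S \<beta> \<gamma> e f h) \<and>
      equivalent_associators G (dihedral_construction m G S \<beta> \<gamma> e f h)" using * by blast
next
  fix L :: "'b monoid" and G :: "'c monoid"
  assume "moufang_loop L \<and> code_loop_trivial_radical G \<and> equivalent_associators L G"
  then show "code_loop_trivial_radical L" using moufang_equivalent_code_loop by blast
next
  fix G :: "'d monoid" and G' :: "'e monoid"
  assume *: "code_loop G \<and> code_loop G' \<and> equivalent_associators G G'"
  then obtain K where K: "step\<^sup>*\<^sup>* G K" "K \<cong> G'" using equivalent_code_loops_reachable by metis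
  have "loop G" using * by (auto simp: code_loop_iff based_code_loop_def central_involution_def)
  obtain s and H :: "nat \<Rightarrow> 'd monoid" where "\<forall>i\<le>s. loop (H i)" "H 0 = G" "H s = K"
    "\<forall>i<s. obtained_by_cyclic (H i) (H (Suc i)) \<or> obtained_by_dihedral (H i) (H (Suc i))"
    using steps_chain[OF K(1) \<open>loop G\<close>] by metis
  then show "\<exists>(s :: nat) (H :: nat \<Rightarrow> 'd monoid). (\<forall>i\<le>s. loop (H i)) \<and> H 0 \<cong> G \<and> H s \<cong> G' \<and>
      (\<forall>i<s. obtained_by_cyclic (H i) (H (Suc i)) \<or> obtained_by_dihedral (H i) (H (Suc i)))"
    using K(2) iso_set_refl is_isoI by (intro exI[of _ s] exI[of _ H]) auto
qed

end
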